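(* Let $r\ge 0$ be an integer, let $\mathcal{K}$ be the integral operator with a Green's kernel $\kappa$ (with respect to $r$), let $\lambda\neq 0$ be a simple eigenvalue of $\mathcal{K}$ with spectral projection $E$, and let $P_n$ be the orthogonal projection onto $\mathcal{X}_n$, $h=1/n$. Let $\lambda_n^G$ be the corresponding Galerkin eigenvalue, i.e. the eigenvalue of $P_n\mathcal{K}$ inside $\Gamma$. Let $\varphi_n\in\mathcal{R}(E_n)$, $\|\varphi_n\|_\infty=1$, be a Galerkin eigenvector ($P_n\mathcal{K}\varphi_n=\lambda_n^G\varphi_n$), and let $\varphi_n^S=\frac{1}{\lambda_n^G}\mathcal{K}\varphi_n$ be the associated iterated Galerkin eigenvector. Then, for sufficiently large $n$, $$\|\varphi_n-E\varphi_n\|_\infty=\begin{cases}O(h^{2r+1}) & \text{for } r\ge1,\\ O(h) & \text{for } r=0,\end{cases}\qquad \|\varphi_n^S-E\varphi_n^S\|_\infty=\begin{cases}O(h^{2r+3}) & \text{for } r\ge1,\\ O(h^2) & \text{for } r=0,\end{cases}$$ and $$|\lambda-\lambda_n^G|=\begin{cases}O(h^{2r+3}) & \text{for } r\ge1,\\ O(h^2) & \text{for } r=0.\end{cases}$$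
   Context: Green's kernel (for an integer $r\ge 0$): let $\Omega_1=\{(s,t):0\le t\le s\le 1\}$ and $\Omega_2=\{(s,t):0\le s\le t\le 1\}$. A real-valued continuous function $\kappa$ on $[0,1]^2$ is a Green's kernel if $\kappa=\kappa_1$ on $\Omega_1$ and $\kappa=\kappa_2$ on $\Omega_2$, with $\kappa_1(s,s)=\kappa_2(s,s)$ for all $s\in[0,1]$, $\kappa_i\in C^\alpha(\Omega_i)$, $\alpha>r$, and with $\alpha$ large enough that all partial derivatives $\partial^{j+k}\kappa_i/\partial s^j\partial t^k$, $0\le j,k\le 2r+2$, exist, are continuous and bounded on $\Omega_i$ ($i=1,2$). Operator: $(\mathcal{K}x)(s)=\int_0^1\kappa(s,t)x(t)\,dt$, $s\in[0,1]$, a compact operator; for comparison with its discretizations all operators may be regarded as acting on (complex-valued) $L^\infty[0,1]$. Spectral projections: $\Gamma$ is a simple closed rectifiable positively oriented curve in the resolvent set of $\mathcal{K}$ separating $\lambda$ from the rest of the spectrum (including $0$), and $E=-\frac{1}{2\pi i}\int_\Gamma(\mathcal{K}-zI)^{-1}dz$; $\lambda$ is simple if its range $\mathcal{R}(E)$ has dimension one (algebraic multiplicity one). For $n$ large, $\Gamma$ lies in the resolvent set of $P_n\mathcal{K}$, $E_n=-\frac{1}{2\pi i}\int_\Gamma(P_n\mathcal{K}-zI)^{-1}dz$ has rank one, and $P_n\mathcal{K}$ has exactly one eigenvalue (which is simple) inside $\Gamma$. Approximating space: for $n\ge1$ let $h=1/n$, $t_j=j/n$, $\Delta_j=[t_{j-1},t_j]$.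 $\mathcal{X}_n$ is the space of $x\in L^\infty[0,1]$ whose restriction to each $\Delta_j$, $j=1,\dots,n$, is a polynomial of degree at most $2r$ (no continuity imposed at the partition points). $P_n$ is the restriction to $L^\infty[0,1]$ of the $L^2[0,1]$-orthogonal projection onto $\mathcal{X}_n$. $\|\cdot\|_\infty$ is the (essential) supremum norm on $[0,1]$. Constants in $O(\cdot)$ are independent of $n$. *)

theory Defs
  imports
    "HOL-Analysis.Analysis"
    "HOL-Complex_Analysis.Complex_Analysis"
    "HOL-Probability.Essential_Supremum"
    "HOL-Library.Landau_Symbols"
    "HOL-Computational_Algebra.Polynomial"
begin

section \<open>Complex normed spaces\<close>

class scaleC =
  fixes scaleC :: "complex \<Rightarrow> 'a \<Rightarrow> 'a"  (infixr "*\<^sub>C" 75)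

class complex_normed_vector = real_normed_vector + scaleC +
  assumes scaleC_add_right: "c *\<^sub>C (x + y) = c *\<^sub>C x + c *\<^sub>C y"
    and scaleC_add_left: "(c + d) *\<^sub>C x = c *\<^sub>C x + d *\<^sub>C x"
    and scaleC_scaleC: "c *\<^sub>C (d *\<^sub>C x) = (c * d) *\<^sub>C x"
    and scaleC_of_real: "complex_of_real a *\<^sub>C x = a *\<^sub>R x"
    and norm_scaleC: "norm (c *\<^sub>C x) = cmod c * norm x"

lemma scaleC_one: "1 *\<^sub>C x = (x :: 'a::complex_normed_vector)"
  using scaleC_of_real[of 1 x] by simp

global_interpretation complex_vector:
  vector_space "scaleC :: complex \<Rightarrow> 'a \<Rightarrow> 'a::complex_normed_vector"
  defines cdim = complex_vector.dim
  by unfold_locales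
    (simp_all add: scaleC_add_right scaleC_add_left scaleC_scaleC scaleC_one)

lemma bounded_linear_scaleC_right:
  "bounded_linear (\<lambda>x. c *\<^sub>C x :: 'a::complex_normed_vector)"
proof (rule bounded_linear_intro[where K = "cmod c"])
  fix a :: real and x :: 'a
  show "c *\<^sub>C (a *\<^sub>R x) = a *\<^sub>R (c *\<^sub>C x)"
    by (simp add: scaleC_of_real[symmetric] scaleC_scaleC mult.commute)
qed (simp_all add: scaleC_add_right norm_scaleC mult.commute)

instantiation blinfun :: (real_normed_vector, complex_normed_vector) complex_normed_vector
begin

lift_definition scaleC_blinfun :: "complex \<Rightarrow> ('a \<Rightarrow>\<^sub>L 'b) \<Rightarrow> ('a \<Rightarrow>\<^sub>L 'b)"
  is "\<lambda>c A x. c *\<^sub>C A x"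
  by (rule bounded_linear_compose[OF bounded_linear_scaleC_right])

instance
proof
  fix c d :: complex and a :: real and x y :: "'a \<Rightarrow>\<^sub>L 'b"
  show "c *\<^sub>C (x + y) = c *\<^sub>C x + c *\<^sub>C y"
    by transfer (simp add: scaleC_add_right)
  show "(c + d) *\<^sub>C x = c *\<^sub>C x + d *\<^sub>C x"
    by transfer (simp add: scaleC_add_left)
  show "c *\<^sub>C (d *\<^sub>C x) = (c * d) *\<^sub>C x"
    by transfer (simp add: scaleC_scaleC)
  show "complex_of_real a *\<^sub>C x = a *\<^sub>R x"
    by transfer (simp add: scaleC_of_real)
  have le: "norm (c *\<^sub>C x) \<le> cmod c * norm x" for c and x :: "'a \<Rightarrow>\<^sub>L 'b"
    by (rule norm_blinfun_bound)
      (auto simp: scaleC_blinfun.rep_eq norm_scaleC mult.assoc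
        intro!: mult_left_mono norm_blinfun)
  show "norm (c *\<^sub>C x) = cmod c * norm x"
  proof (cases "c = 0")
    case True
    then show ?thesis using le[of c x] by simp
  next
    case False
    have "x = (1 / c) *\<^sub>C (c *\<^sub>C x)"
      using False by transfer (simp add: scaleC_scaleC scaleC_one)
    then have "norm x \<le> cmod (1 / c) * norm (c *\<^sub>C x)"
      using le[of "1 / c" "c *\<^sub>C x"] by simp
    then have "cmod c * norm x \<le> norm (c *\<^sub>C x)"
      using False by (simp add: norm_divide field_simps)
    then show ?thesis using le[of c x] by simp
  qed
qed

end


section \<open>Spectra and spectral projections\<close>

definition resolvent_set :: "('a::complex_normed_vector \<Rightarrow> 'a) \<Rightarrow> complex set" where
  "resolvent_set T =
     {z. bij (\<lambda>x. T x - z *\<^sub>C x) \<and> bounded_linear (inv (\<lambda>x. T x - z *\<^sub>C x))}"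

definition spectrum :: "('a::complex_normed_vector \<Rightarrow> 'a) \<Rightarrow> complex set" where
  "spectrum T = - resolvent_set T"

definition resolvent :: "('a::complex_normed_vector \<Rightarrow> 'a) \<Rightarrow> complex \<Rightarrow> ('a \<Rightarrow>\<^sub>L 'a)" where
  "resolvent T z = Blinfun (inv (\<lambda>x. T x - z *\<^sub>C x))"

definition eigenvalue :: "('a::complex_normed_vector \<Rightarrow> 'a) \<Rightarrow> complex \<Rightarrow> bool" where
  "eigenvalue T \<mu> \<longleftrightarrow> (\<exists>x. x \<noteq> 0 \<and> T x = \<mu> *\<^sub>C x)"

definition rectifiable_path :: "(real \<Rightarrow> complex) \<Rightarrow> bool" where
  "rectifiable_path \<gamma> \<longleftrightarrow> path \<gamma> \<and>
     (\<exists>L. \<forall>d. d division_of {0..1} \<longrightarrow> (\<Sum>k\<in>d. dist (\<gamma> (Inf k)) (\<gamma> (Sup k))) \<le> L)"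

text \<open>
  The contour integral of a vector-valued function along a rectifiable path is the
  Riemann--Stieltjes integral of \<open>F \<circ> \<gamma>\<close> with respect to \<open>\<gamma>\<close>.  As for the library's
  Henstock--Kurzweil integral, the limit is taken along gauge-fine tagged divisions; for
  \<open>F\<close> continuous on the image of a rectifiable \<open>\<gamma>\<close> this agrees with the limit as the
  mesh tends to \<open>0\<close>.  (The library's \<open>contour_integral\<close> is restricted to complex-valued
  integrands and, in effect, to piecewise differentiable paths.)
\<close>

definition curve_integral ::
  "(real \<Rightarrow> complex) \<Rightarrow> (complex \<Rightarrow> 'a::complex_normed_vector) \<Rightarrow> 'a" where
  "curve_integral \<gamma> F =
     Lim (division_filter {0..1})
       (\<lambda>p. \<Sum>(t, k)\<in>p. (\<gamma> (Sup k) - \<gamma> (Inf k)) *\<^sub>C F (\<gamma> t))"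

definition spectral_projection ::
  "(real \<Rightarrow> complex) \<Rightarrow> ('a::complex_normed_vector \<Rightarrow> 'a) \<Rightarrow> ('a \<Rightarrow>\<^sub>L 'a)" where
  "spectral_projection \<gamma> T =
     (- 1 / (2 * complex_of_real pi * \<i>)) *\<^sub>C curve_integral \<gamma> (resolvent T)"

definition simple_closed_rectifiable_pos :: "(real \<Rightarrow> complex) \<Rightarrow> bool" where
  "simple_closed_rectifiable_pos \<gamma> \<longleftrightarrow>
     simple_path \<gamma> \<and> pathfinish \<gamma> = pathstart \<gamma> \<and> rectifiable_path \<gamma> \<and>
     (\<forall>z \<in> inside (path_image \<gamma>). winding_number \<gamma> z = 1)"


section \<open>The complex space of essentially bounded functions on the unit interval\<close>

abbreviation leb01 :: "real measure" where
  "leb01 \<equiv> lebesgue_on {0..1}"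

definition ess_norm :: "(real \<Rightarrow> complex) \<Rightarrow> ereal" where
  "ess_norm f = esssup leb01 (\<lambda>t. ereal (cmod (f t)))"

definition ess_bounded :: "(real \<Rightarrow> complex) \<Rightarrow> bool" where
  "ess_bounded f \<longleftrightarrow> f \<in> borel_measurable leb01 \<and> ess_norm f < \<infinity>"

definition linf_rel :: "(real \<Rightarrow> complex) \<Rightarrow> (real \<Rightarrow> complex) \<Rightarrow> bool" where
  "linf_rel f g \<longleftrightarrow> ess_bounded f \<and> ess_bounded g \<and> (AE t in leb01. f t = g t)"

lemma ess_norm_le_iff:
  assumes "f \<in> borel_measurable leb01"
  shows "ess_norm f \<le> ereal c \<longleftrightarrow> (AE t in leb01. cmod (f t) \<le> c)"
proof
  assume *: "ess_norm f \<le> ereal c"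
  have "AE t in leb01. ereal (cmod (f t)) \<le> ess_norm f"
    unfolding ess_norm_def by (rule esssup_AE)
  then show "AE t in leb01. cmod (f t) \<le> c"
  proof eventually_elim
    case (elim t)
    then show ?case using * by (metis ereal_less_eq(3) order.trans)
  qed
next
  assume "AE t in leb01. cmod (f t) \<le> c"
  then show "ess_norm f \<le> ereal c"
    unfolding ess_norm_def using assms by (intro esssup_I) auto
qed

lemma ess_norm_nonneg: "ess_norm f \<ge> 0"
proof -
  have "esssup leb01 (\<lambda>t. 0 :: ereal) = 0"
    by (rule esssup_const) (simp add: emeasure_restrict_space)
  moreover have "esssup leb01 (\<lambda>t. 0 :: ereal) \<le> ess_norm f"
    unfolding ess_norm_def by (rule esssup_mono) auto
  ultimately show ?thesis by simp
qed

lemma ess_bounded_iff: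
  "ess_bounded f \<longleftrightarrow>
     f \<in> borel_measurable leb01 \<and> (\<exists>c. AE t in leb01. cmod (f t) \<le> c)"
proof -
  have "ess_norm f < \<infinity> \<longleftrightarrow> (\<exists>c. ess_norm f \<le> ereal c)"
    using ess_norm_nonneg[of f] by (cases "ess_norm f") auto
  then show ?thesis
    unfolding ess_bounded_def using ess_norm_le_iff by blast
qed

lemma ess_boundedI:
  "f \<in> borel_measurable leb01 \<Longrightarrow> AE t in leb01. cmod (f t) \<le> c \<Longrightarrow> ess_bounded f"
  by (auto simp: ess_bounded_iff)

lemma ess_bounded_add:
  assumes "ess_bounded f" "ess_bounded g"
  shows "ess_bounded (\<lambda>t. f t + g t)"
proof -
  obtain c d where "AE t in leb01. cmod (f t) \<le> c" "AE t in leb01. cmod (g t) \<le> d"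
    using assms by (auto simp: ess_bounded_iff)
  then have "AE t in leb01. cmod (f t + g t) \<le> c + d"
    by eventually_elim (rule norm_triangle_mono)
  then show ?thesis
    using assms by (intro ess_boundedI) (auto simp: ess_bounded_def)
qed

lemma ess_bounded_cmult:
  assumes "ess_bounded f"
  shows "ess_bounded (\<lambda>t. c * f t)"
proof -
  obtain d where "AE t in leb01. cmod (f t) \<le> d"
    using assms by (auto simp: ess_bounded_iff)
  then have "AE t in leb01. cmod (c * f t) \<le> cmod c * d"
    by eventually_elim (simp add: norm_mult mult_left_mono)
  then show ?thesis
    using assms by (intro ess_boundedI) (auto simp: ess_bounded_def)
qed

lemma ess_bounded_zero: "ess_bounded (\<lambda>t. 0)"
  by (rule ess_boundedI[where c = 0]) auto

quotient_type linf = "real \<Rightarrow> complex" / partial: linf_rel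
proof (rule part_equivpI)
  show "\<exists>f. linf_rel f f"
    by (rule exI[of _ "\<lambda>t. 0"]) (simp add: linf_rel_def ess_bounded_zero)
  show "symp linf_rel"
    by (auto simp: symp_def linf_rel_def elim: eventually_mono)
  show "transp linf_rel"
  proof (rule transpI)
    fix f g h assume *: "linf_rel f g" "linf_rel g h"
    then have "AE t in leb01. f t = g t" "AE t in leb01. g t = h t"
      by (auto simp: linf_rel_def)
    then have "AE t in leb01. f t = h t" by eventually_elim simp
    then show "linf_rel f h" using * by (auto simp: linf_rel_def)
  qed
qed

lemma linf_rel_AE: "linf_rel f g \<Longrightarrow> AE t in leb01. f t = g t"
  by (simp add: linf_rel_def)

instantiation linf :: ab_group_add
begin

lift_definition zero_linf :: linf is "\<lambda>t. 0"
  by (simp add: linf_rel_def ess_bounded_zero)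

lift_definition plus_linf :: "linf \<Rightarrow> linf \<Rightarrow> linf" is "\<lambda>f g t. f t + g t"
  subgoal premises prems for f f' g g'
    using linf_rel_AE[OF prems(1)] linf_rel_AE[OF prems(2)] prems
    by (auto simp: linf_rel_def intro!: ess_bounded_add elim: eventually_elim2)
  done

lift_definition uminus_linf :: "linf \<Rightarrow> linf" is "\<lambda>f t. - f t"
  subgoal for f g
    using ess_bounded_cmult[of f "-1"] ess_bounded_cmult[of g "-1"]
    by (auto simp: linf_rel_def elim: eventually_mono)
  done

definition minus_linf :: "linf \<Rightarrow> linf \<Rightarrow> linf" where
  "minus_linf x y = x + - y"

instance
proof
  fix x y z :: linf
  show "x + y + z = x + (y + z)"
    by transfer (auto simp: linf_rel_def add.assoc intro!: ess_bounded_add)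
  show "x + y = y + x"
    by transfer (auto simp: linf_rel_def add.commute intro!: ess_bounded_add)
  show "0 + x = x"
    by transfer (auto simp: linf_rel_def intro!: ess_bounded_add)
  show "- x + x = 0"
    by transfer (auto simp: linf_rel_def ess_bounded_zero)
qed (simp add: minus_linf_def)

end

instantiation linf :: complex_normed_vector
begin

lift_definition scaleC_linf :: "complex \<Rightarrow> linf \<Rightarrow> linf" is "\<lambda>c f t. c * f t"
  by (auto simp: linf_rel_def ess_bounded_cmult elim: eventually_mono)

definition scaleR_linf :: "real \<Rightarrow> linf \<Rightarrow> linf" where
  "scaleR_linf a x = complex_of_real a *\<^sub>C x"

lift_definition norm_linf :: "linf \<Rightarrow> real" is "\<lambda>f. real_of_ereal (ess_norm f)"
  unfolding ess_norm_def
  by (rule arg_cong[where f = real_of_ereal], rule esssup_AE_cong)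
    (auto simp: linf_rel_def ess_bounded_def elim: eventually_mono)

definition sgn_linf :: "linf \<Rightarrow> linf" where
  "sgn_linf x = inverse (norm x) *\<^sub>R x"

definition dist_linf :: "linf \<Rightarrow> linf \<Rightarrow> real" where
  "dist_linf x y = norm (x - y)"

definition uniformity_linf :: "(linf \<times> linf) filter" where
  "uniformity_linf = (INF e\<in>{0<..}. principal {(x, y). dist x y < e})"

definition open_linf :: "linf set \<Rightarrow> bool" where
  "open_linf U \<longleftrightarrow> (\<forall>x\<in>U. eventually (\<lambda>(x', y). x' = x \<longrightarrow> y \<in> U) uniformity)"

lemma ess_norm_le_real_iff:
  assumes "ess_bounded f"
  shows "real_of_ereal (ess_norm f) \<le> c \<longleftrightarrow> (AE t in leb01. cmod (f t) \<le> c)"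
proof -
  have "ess_norm f = ereal (real_of_ereal (ess_norm f))"
    using assms ess_norm_nonneg[of f] unfolding ess_bounded_def
    by (cases "ess_norm f") auto
  then have "real_of_ereal (ess_norm f) \<le> c \<longleftrightarrow> ess_norm f \<le> ereal c"
    by (metis ereal_less_eq(3))
  then show ?thesis
    using assms by (simp add: ess_norm_le_iff ess_bounded_def)
qed

lemma ess_norm_AE:
  "ess_bounded f \<Longrightarrow> AE t in leb01. cmod (f t) \<le> real_of_ereal (ess_norm f)"
  using ess_norm_le_real_iff by blast

instance
proof
  fix c d :: complex and a b :: real and x y :: linf
  show dist: "dist x y = norm (x - y)" by (rule dist_linf_def)
  show "sgn x = inverse (norm x) *\<^sub>R x" by (rule sgn_linf_def)
  show "uniformity = (INF e\<in>{0<..}. principal {(x, y :: linf). dist x y < e})"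
    by (rule uniformity_linf_def)
  show "open U \<longleftrightarrow> (\<forall>x\<in>U. \<forall>\<^sub>F (x', y) in uniformity. x' = x \<longrightarrow> y \<in> U)"
    for U :: "linf set"
    by (rule open_linf_def)
  show cr: "c *\<^sub>C (x + y) = c *\<^sub>C x + c *\<^sub>C y" for c
    by transfer (auto simp: linf_rel_def distrib_left
      intro!: ess_bounded_add ess_bounded_cmult)
  show cl: "(c + d) *\<^sub>C x = c *\<^sub>C x + d *\<^sub>C x" for c d
    by transfer (auto simp: linf_rel_def distrib_right
      intro!: ess_bounded_add ess_bounded_cmult)
  show cc: "c *\<^sub>C (d *\<^sub>C x) = (c * d) *\<^sub>C x" for c d
    by transfer (auto simp: linf_rel_def mult.assoc intro!: ess_bounded_cmult)
  show "complex_of_real a *\<^sub>C x = a *\<^sub>R x" by (simp add: scaleR_linf_def)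
  show "a *\<^sub>R (x + y) = a *\<^sub>R x + a *\<^sub>R y" by (simp add: scaleR_linf_def cr)
  show "(a + b) *\<^sub>R x = a *\<^sub>R x + b *\<^sub>R x" by (simp add: scaleR_linf_def cl)
  show "a *\<^sub>R b *\<^sub>R x = (a * b) *\<^sub>R x" by (simp add: scaleR_linf_def cc)
  have one: "1 *\<^sub>C x = x" for x :: linf
    by transfer (auto simp: linf_rel_def)
  show "1 *\<^sub>R x = x" by (simp add: scaleR_linf_def one)
  show nz: "norm x = 0 \<longleftrightarrow> x = 0" for x :: linf
  proof (transfer, goal_cases)
    case (1 f)
    then have f: "ess_bounded f" by (simp add: linf_rel_def)
    have "real_of_ereal (ess_norm f) \<ge> 0"
      by (simp add: ess_norm_nonneg real_of_ereal_pos)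
    then have "real_of_ereal (ess_norm f) = 0 \<longleftrightarrow> real_of_ereal (ess_norm f) \<le> 0"
      by linarith
    also have "\<dots> \<longleftrightarrow> (AE t in leb01. cmod (f t) \<le> 0)"
      using ess_norm_le_real_iff[OF f] .
    finally show ?case
      using f by (simp add: linf_rel_def ess_bounded_zero)
  qed
  show "norm (x + y) \<le> norm x + norm y"
  proof (transfer, goal_cases)
    case (1 f g)
    then have fg: "ess_bounded f" "ess_bounded g" by (simp_all add: linf_rel_def)
    have "AE t in leb01. cmod (f t + g t) \<le>
        real_of_ereal (ess_norm f) + real_of_ereal (ess_norm g)"
      using ess_norm_AE[OF fg(1)] ess_norm_AE[OF fg(2)]
      by eventually_elim (rule norm_triangle_mono)
    then show ?case
      using ess_norm_le_real_iff[OF ess_bounded_add[OF fg]] by blast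
  qed
  have le: "norm (c *\<^sub>C x) \<le> cmod c * norm x" for c and x :: linf
  proof (transfer fixing: c, goal_cases)
    case (1 f)
    then have f: "ess_bounded f" by (simp add: linf_rel_def)
    have "AE t in leb01. cmod (c * f t) \<le> cmod c * real_of_ereal (ess_norm f)"
      using ess_norm_AE[OF f] by eventually_elim (simp add: norm_mult mult_left_mono)
    then show ?case
      using ess_norm_le_real_iff[OF ess_bounded_cmult[OF f]] by blast
  qed
  show nc: "norm (c *\<^sub>C x) = cmod c * norm x" for c
  proof (cases "c = 0")
    case True
    moreover have "0 *\<^sub>C x = 0" using cl[of 0 0] by simp
    ultimately show ?thesis using nz[of 0] by simp
  next
    case False
    have "norm x \<le> cmod (1 / c) * norm (c *\<^sub>C x)"
      using le[of "1 / c" "c *\<^sub>C x"] False by (simp add: cc one)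
    then have "cmod c * norm x \<le> norm (c *\<^sub>C x)"
      using False by (simp add: norm_divide field_simps)
    then show ?thesis using le[of c x] by simp
  qed
  show "norm (a *\<^sub>R x) = \<bar>a\<bar> * norm x" by (simp add: scaleR_linf_def nc)
qed

end

lemma ess_bounded_rep: "ess_bounded (rep_linf x)"
  using Quotient3_rep_reflp[OF Quotient3_linf, of x] by (simp add: linf_rel_def)

lemma rep_abs_linf:
  "ess_bounded f \<Longrightarrow> AE t in leb01. rep_linf (abs_linf f) t = f t"
  using rep_abs_rsp_left[OF Quotient3_linf, of f f] by (simp add: linf_rel_def)

lemma rep_linf_minus: "AE t in leb01. rep_linf (x - y) t = rep_linf x t - rep_linf y t"
proof -
  have *: "abs_linf (rep_linf z) = z" for z
    by (rule Quotient3_abs_rep[OF Quotient3_linf])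
  have eq: "linf_rel (rep_linf z) (rep_linf z)" for z
    by (simp add: linf_rel_def ess_bounded_rep)
  have b: "ess_bounded (\<lambda>t. - rep_linf y t)"
    using ess_bounded_cmult[OF ess_bounded_rep, of "-1"] by simp
  have "- y = abs_linf (\<lambda>t. - rep_linf y t)"
    using uminus_linf.abs_eq[OF eq] by (simp add: *)
  moreover have "x + abs_linf (\<lambda>t. - rep_linf y t) =
      abs_linf (\<lambda>t. rep_linf x t + - rep_linf y t)"
    using plus_linf.abs_eq[OF eq, of "\<lambda>t. - rep_linf y t" x] b
    by (simp add: * linf_rel_def)
  ultimately have "x - y = abs_linf (\<lambda>t. rep_linf x t - rep_linf y t)"
    by (simp add: minus_linf_def)
  then show ?thesis
    using rep_abs_linf[OF ess_bounded_add[OF ess_bounded_rep[of x] b]] by simp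
qed

lemma norm_linf_le_iff: "norm x \<le> c \<longleftrightarrow> (AE t in leb01. cmod (rep_linf x t) \<le> c)"
  unfolding norm_linf.rep_eq by (rule ess_norm_le_real_iff[OF ess_bounded_rep])

instance linf :: banach
proof
  fix X :: "nat \<Rightarrow> linf"
  assume X: "Cauchy X"
  define f where "f n = rep_linf (X n)" for n
  have f: "ess_bounded (f n)" for n by (simp add: f_def ess_bounded_rep)
  then have [measurable]: "f n \<in> borel_measurable leb01" for n
    by (simp add: ess_bounded_def)
  define g where "g t = lim (\<lambda>n. f n t)" for t
  have g [measurable]: "g \<in> borel_measurable leb01"
    unfolding g_def by measurable
  have "AE t in leb01. cmod (f m t - f n t) \<le> norm (X m - X n)" for m n
    using rep_linf_minus[of "X m" "X n"] norm_linf_le_iff[of "X m - X n" "norm (X m - X n)"]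
    unfolding f_def by (auto elim: eventually_elim2)
  then have AE: "AE t in leb01. \<forall>m n. cmod (f m t - f n t) \<le> norm (X m - X n)"
    by (simp add: AE_all_countable)
  have lim: "AE t in leb01. (\<lambda>n. f n t) \<longlonglongrightarrow> g t"
    using AE
  proof eventually_elim
    case (elim t)
    have "Cauchy (\<lambda>n. f n t)"
      unfolding Cauchy_def
    proof (intro allI impI)
      fix e :: real assume "e > 0"
      then obtain N where "\<forall>m\<ge>N. \<forall>n\<ge>N. dist (X m) (X n) < e"
        using X by (auto simp: Cauchy_def)
      then show "\<exists>N. \<forall>m\<ge>N. \<forall>n\<ge>N. dist (f m t) (f n t) < e"
        using elim by (metis dist_norm order.strict_trans1)
    qed
    then show ?case
      unfolding g_def by (simp add: Cauchy_convergent_iff convergent_LIMSEQ_iff)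
  qed
  have close: "\<exists>N. \<forall>n\<ge>N. AE t in leb01. cmod (f n t - g t) \<le> e" if "e > 0" for e
  proof -
    obtain N where N: "\<And>m n. m \<ge> N \<Longrightarrow> n \<ge> N \<Longrightarrow> norm (X m - X n) < e"
      using X \<open>e > 0\<close> unfolding Cauchy_def dist_norm by metis
    have "AE t in leb01. cmod (f n t - g t) \<le> e" if "n \<ge> N" for n
      using AE lim
    proof eventually_elim
      case (elim t)
      have "(\<lambda>m. cmod (f n t - f m t)) \<longlonglongrightarrow> cmod (f n t - g t)"
        by (intro tendsto_intros elim)
      moreover have "\<exists>M. \<forall>m\<ge>M. cmod (f n t - f m t) \<le> e"
        using elim(1) N[OF \<open>n \<ge> N\<close>] by (meson less_imp_le order_trans)
      ultimately show ?case by (rule LIMSEQ_le_const2)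
    qed
    then show ?thesis by blast
  qed
  obtain N where "AE t in leb01. cmod (f N t - g t) \<le> 1"
    using close[of 1] by auto
  moreover obtain c where "AE t in leb01. cmod (f N t) \<le> c"
    using f[of N] by (auto simp: ess_bounded_iff)
  ultimately have "AE t in leb01. cmod (g t) \<le> c + 1"
  proof eventually_elim
    case (elim t)
    have "cmod (g t) \<le> cmod (f N t) + cmod (f N t - g t)"
      by (metis norm_minus_commute norm_triangle_sub)
    then show ?case using elim by linarith
  qed
  then have gb: "ess_bounded g" by (intro ess_boundedI) auto
  have "X \<longlonglongrightarrow> abs_linf g"
  proof (rule metric_LIMSEQ_I)
    fix e :: real assume "e > 0"
    then obtain N where N: "\<And>n. n \<ge> N \<Longrightarrow> AE t in leb01. cmod (f n t - g t) \<le> e / 2"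
      using close[of "e / 2"] by auto
    have "dist (X n) (abs_linf g) < e" if "n \<ge> N" for n
    proof -
      have "AE t in leb01. cmod (rep_linf (X n - abs_linf g) t) \<le> e / 2"
        using N[OF that] rep_linf_minus[of "X n" "abs_linf g"] rep_abs_linf[OF gb]
        by eventually_elim (simp add: f_def)
      then have "norm (X n - abs_linf g) \<le> e / 2"
        by (rule norm_linf_le_iff[THEN iffD2])
      then show ?thesis
        using \<open>e > 0\<close> by (simp add: dist_norm)
    qed
    then show "\<exists>no. \<forall>n\<ge>no. dist (X n) (abs_linf g) < e" by blast
  qed
  then show "convergent X" by (auto simp: convergent_def)
qed


section \<open>Green's kernels and integral operators\<close>

definition Omega1 :: "(real \<times> real) set" where
  "Omega1 = {(s, t). 0 \<le> t \<and> t \<le> s \<and> s \<le> 1}"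

definition Omega2 :: "(real \<times> real) set" where
  "Omega2 = {(s, t). 0 \<le> s \<and> s \<le> t \<and> t \<le> 1}"

text \<open>
  \<open>D j k\<close> is the partial derivative of \<open>f\<close> of order \<open>j\<close> in \<open>s\<close> and \<open>k\<close> in \<open>t\<close>.  As usual
  for a closed region, the derivatives are taken in the interior and are required to extend to
  continuous bounded functions on all of \<open>\<Omega>\<close> (at a corner of a triangle one of the two
  coordinate sections is a single point, so a pointwise derivative there is meaningless).
  \<open>I\<close> is the set of orders considered.
\<close>

definition has_cont_partials ::
  "(real \<times> real) set \<Rightarrow> (nat \<times> nat) set \<Rightarrow> (real \<Rightarrow> real \<Rightarrow> real) \<Rightarrow> bool" where
  "has_cont_partials \<Omega> I f \<longleftrightarrow> (\<exists>D :: nat \<Rightarrow> nat \<Rightarrow> real \<Rightarrow> real \<Rightarrow> real.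
     (\<forall>(s, t)\<in>\<Omega>. D 0 0 s t = f s t) \<and>
     (\<forall>(j, k)\<in>I. continuous_on \<Omega> (\<lambda>(s, t). D j k s t) \<and>
        bounded ((\<lambda>(s, t). D j k s t) ` \<Omega>)) \<and>
     (\<forall>(s, t)\<in>interior \<Omega>.
        (\<forall>j k. (Suc j, k) \<in> I \<longrightarrow>
           ((\<lambda>u. D j k u t) has_real_derivative D (Suc j) k s t) (at s)) \<and>
        (\<forall>j k. (j, Suc k) \<in> I \<longrightarrow>
           ((\<lambda>v. D j k s v) has_real_derivative D j (Suc k) s t) (at t))))"

definition C_on :: "nat \<Rightarrow> (real \<times> real) set \<Rightarrow> (real \<Rightarrow> real \<Rightarrow> real) \<Rightarrow> bool" where
  "C_on \<alpha> \<Omega> f \<longleftrightarrow> has_cont_partials \<Omega> {(j, k). j + k \<le> \<alpha>} f"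

definition greens_kernel :: "nat \<Rightarrow> (real \<Rightarrow> real \<Rightarrow> real) \<Rightarrow> bool" where
  "greens_kernel r \<kappa> \<longleftrightarrow>
     continuous_on ({0..1} \<times> {0..1}) (\<lambda>(s, t). \<kappa> s t) \<and>
     (\<exists>\<kappa>1 \<kappa>2 \<alpha>.
        (\<forall>(s, t)\<in>Omega1. \<kappa> s t = \<kappa>1 s t) \<and>
        (\<forall>(s, t)\<in>Omega2. \<kappa> s t = \<kappa>2 s t) \<and>
        (\<forall>s\<in>{0..1}. \<kappa>1 s s = \<kappa>2 s s) \<and>
        \<alpha> > r \<and> C_on \<alpha> Omega1 \<kappa>1 \<and> C_on \<alpha> Omega2 \<kappa>2 \<and>
        has_cont_partials Omega1 ({0..2 * r + 2} \<times> {0..2 * r + 2}) \<kappa>1 \<and>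
        has_cont_partials Omega2 ({0..2 * r + 2} \<times> {0..2 * r + 2}) \<kappa>2)"

definition integral_op :: "(real \<Rightarrow> real \<Rightarrow> real) \<Rightarrow> linf \<Rightarrow> linf" where
  "integral_op \<kappa> x =
     abs_linf (\<lambda>s. LINT t|leb01. complex_of_real (\<kappa> s t) * rep_linf x t)"


lemma integral_op_ess_bounded:
  assumes "continuous_on ({0..1} \<times> {0..1}) (\<lambda>(s, t). \<kappa> s t)"
  shows "ess_bounded (\<lambda>s. LINT t|leb01. complex_of_real (\<kappa> s t) * rep_linf x t)"
proof -
  define f where "f = rep_linf x"
  define F where "F s = (LINT t|leb01. complex_of_real (\<kappa> s t) * f t)" for s
  have f [measurable]: "f \<in> borel_measurable leb01"
    using ess_bounded_rep[of x] by (simp add: f_def ess_bounded_def)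
  obtain c where c: "AE t in leb01. cmod (f t) \<le> c"
    using ess_bounded_rep[of x] by (auto simp: f_def ess_bounded_iff)
  have "compact ((\<lambda>(s, t). \<kappa> s t) ` ({0..1} \<times> {0..1}))"
    by (rule compact_continuous_image[OF assms]) (intro compact_Times compact_Icc)
  then obtain M where M: "\<And>s t. s \<in> {0..1} \<Longrightarrow> t \<in> {0..1} \<Longrightarrow> \<bar>\<kappa> s t\<bar> \<le> M"
    unfolding bounded_iff compact_eq_bounded_closed by fastforce
  have sec: "continuous_on {0..1} (\<lambda>t. \<kappa> s t)" "continuous_on {0..1} (\<lambda>t. \<kappa> t s)"
    if "s \<in> {0..1}" for s
    using that
    by (auto intro!: continuous_on_compose2[OF assms, of "{0..1}" "\<lambda>t. (s, t)", simplified]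
        continuous_on_compose2[OF assms, of "{0..1}" "\<lambda>t. (t, s)", simplified] continuous_intros)
  have meas: "(\<lambda>t. complex_of_real (\<kappa> s t) * f t) \<in> borel_measurable leb01"
    if "s \<in> {0..1}" for s
  proof -
    have [measurable]: "(\<lambda>t. \<kappa> s t) \<in> borel_measurable leb01"
      by (rule continuous_imp_measurable_on_sets_lebesgue[OF sec(1)[OF that]]) simp
    show ?thesis by measurable
  qed
  have bound: "AE t in leb01. cmod (complex_of_real (\<kappa> s t) * f t) \<le> M * c"
    if "s \<in> {0..1}" for s
    using c AE_space[of leb01]
  proof eventually_elim
    case (elim t)
    then have "\<bar>\<kappa> s t\<bar> \<le> M" using M[OF that] by simp
    then show ?case
      using elim(1) by (simp add: norm_mult) (meson abs_ge_zero mult_mono norm_ge_zero order_trans)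
  qed
  have "continuous_on {0..1} F"
    unfolding continuous_on_sequentially
  proof (intro allI ballI impI, elim conjE)
    fix u and s :: real
    assume s: "s \<in> {0..1}" and u: "\<forall>n. u n \<in> {0..1}" "u \<longlonglongrightarrow> s"
    have "(\<lambda>n. LINT t|leb01. complex_of_real (\<kappa> (u n) t) * f t) \<longlonglongrightarrow>
        (LINT t|leb01. complex_of_real (\<kappa> s t) * f t)"
    proof (rule integral_dominated_convergence[where w = "\<lambda>t. M * c"])
      show "integrable leb01 (\<lambda>t. M * c)"
        by (intro finite_measure.integrable_const finite_measure_lebesgue_on) simp
      show "AE t in leb01. (\<lambda>n. complex_of_real (\<kappa> (u n) t) * f t) \<longlonglongrightarrow>
          complex_of_real (\<kappa> s t) * f t"
      proof (rule AE_I2)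
        fix t assume "t \<in> space leb01"
        then have "t \<in> {0..1}" by simp
        then have "(\<lambda>n. \<kappa> (u n) t) \<longlonglongrightarrow> \<kappa> s t"
          using sec(2)[of t] s u by (auto simp: continuous_on_sequentially o_def)
        then show "(\<lambda>n. complex_of_real (\<kappa> (u n) t) * f t) \<longlonglongrightarrow>
            complex_of_real (\<kappa> s t) * f t"
          by (intro tendsto_intros)
      qed
    qed (use meas bound s u in auto)
    then show "(F \<circ> u) \<longlonglongrightarrow> F s" by (simp add: F_def o_def)
  qed
  then have "F \<in> borel_measurable leb01" "compact (F ` {0..1})"
    by (auto intro: continuous_imp_measurable_on_sets_lebesgue compact_continuous_image)
  then obtain B where "\<And>s. s \<in> {0..1} \<Longrightarrow> cmod (F s) \<le> B"
    unfolding bounded_iff compact_eq_bounded_closed by fastforce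
  then have "AE s in leb01. cmod (F s) \<le> B" by (intro AE_I2) simp
  then have "ess_bounded F"
    by (rule ess_boundedI[OF \<open>F \<in> borel_measurable leb01\<close>])
  then show ?thesis by (simp add: F_def[abs_def] f_def)
qed

lemma rep_integral_op:
  assumes "continuous_on ({0..1} \<times> {0..1}) (\<lambda>(s, t). \<kappa> s t)"
  shows "AE s in leb01. rep_linf (integral_op \<kappa> x) s =
    (LINT t|leb01. complex_of_real (\<kappa> s t) * rep_linf x t)"
  unfolding integral_op_def by (rule rep_abs_linf[OF integral_op_ess_bounded[OF assms]])


section \<open>Piecewise polynomials and the orthogonal projection\<close>

definition pw_poly :: "nat \<Rightarrow> nat \<Rightarrow> linf set" where
  "pw_poly r n = {x. \<forall>j\<in>{1..n}. \<exists>p :: complex poly. degree p \<le> 2 * r \<and>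
     (AE t in lebesgue_on {(real j - 1) / real n .. real j / real n}.
        rep_linf x t = poly p (complex_of_real t))}"

text \<open>
  Since \<open>L\<^sup>\<infinity>[0,1]\<close> is contained in \<open>L\<^sup>2[0,1]\<close> and the piecewise polynomials are
  essentially bounded, the restriction of the orthogonal projection of \<open>L\<^sup>2[0,1]\<close> is
  determined by orthogonality of the error inside \<open>linf\<close>.
\<close>

definition L2_inner :: "linf \<Rightarrow> linf \<Rightarrow> complex" where
  "L2_inner x y = (LINT t|leb01. rep_linf x t * cnj (rep_linf y t))"

definition galerkin_proj :: "nat \<Rightarrow> nat \<Rightarrow> linf \<Rightarrow> linf" where
  "galerkin_proj r n x =
     (THE p. p \<in> pw_poly r n \<and> (\<forall>q\<in>pw_poly r n. L2_inner (x - p) q = 0))"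

end

theory Submission
  imports Defs
begin

text \<open>
  Everything is driven by two residuals, \<open>g = (I - P\<^sub>n) K \<phi>\<^sub>n\<close> and \<open>K g\<close>.

  The resolvent identity \<open>R(w) (K - z) x = x + (w - z) R(w) x\<close>, divided by \<open>w - z\<close> and
  integrated over \<open>\<Gamma>\<close>, expresses \<open>x - E x\<close> as a contour integral of \<open>R(w) (K - z) x / (w - z)\<close>.
  Hence \<open>\<parallel>x - E x\<parallel> \<le> C / dist(z, \<Gamma>) \<parallel>(K - z) x\<parallel>\<close> for every \<open>z\<close> inside \<open>\<Gamma>\<close>
  (\<open>spectral_projection_estimate\<close>).  The idea is to take for \<open>z\<close> the Galerkin eigenvalue
  \<open>\<lambda>\<^sub>n\<close>, which stays away from \<open>\<Gamma>\<close> because \<open>\<phi>\<^sub>n\<close> is an approximate eigenvector of \<open>K\<close> while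
  the resolvent of \<open>K\<close> is bounded on \<open>\<Gamma>\<close>.  For \<open>x = \<phi>\<^sub>n\<close> one has
  \<open>(K - \<lambda>\<^sub>n) \<phi>\<^sub>n = g\<close>, and for the iterated eigenvector \<open>x = \<phi>\<^sub>n\<^sup>S\<close> one has
  \<open>(K - \<lambda>\<^sub>n) \<phi>\<^sub>n\<^sup>S = K g / \<lambda>\<^sub>n\<close>.  Applying \<open>E\<close> to \<open>(K - \<lambda>\<^sub>n) \<phi>\<^sub>n = g\<close> and using \<open>E K = K E = \<lambda> E\<close>
  gives \<open>\<lambda> (\<lambda> - \<lambda>\<^sub>n) E \<phi>\<^sub>n = E K g\<close>.  So the first error is of the order of \<open>g\<close>, the
  other two are of the order of \<open>K g\<close>.

  The size of \<open>g\<close>: the \<open>L\<^sup>2\<close> projection acts separately on each cell, and is bounded on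
  \<open>L\<^sup>\<infinity>\<close> uniformly in \<open>n\<close>, so \<open>I - P\<^sub>n\<close> is controlled by local
  polynomial approximation (\<open>galerkin_error\<close>).  The eigenfunction is smooth, because
  \<open>K\<close> maps \<open>C\<^sup>m\<close> to \<open>C\<^sup>m\<^sup>+\<^sup>1\<close> (\<open>Ck_kernel_int\<close>); this gives \<open>h\<^sup>2\<^sup>r\<^sup>+\<^sup>1\<close> on the part
  \<open>K E \<phi>\<^sub>n\<close> of \<open>K \<phi>\<^sub>n\<close>.  On the rest, \<open>I - P\<^sub>n\<close> gains only one power of \<open>h\<close>, since \<open>K x\<close> is
  Lipschitz for any bounded \<open>x\<close>; but the rest is \<open>K (\<phi>\<^sub>n - E \<phi>\<^sub>n)\<close>, which is bounded by
  \<open>g\<close> itself, so for small \<open>h\<close> it is absorbed and \<open>\<parallel>g\<parallel> = O(h\<^sup>2\<^sup>r\<^sup>+\<^sup>1)\<close>.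

  The size of \<open>K g\<close>: on each cell \<open>g\<close> is orthogonal to polynomials of degree \<open>2 r\<close>, so
  \<open>\<kappa>(s, \<cdot>)\<close> may be replaced there by its distance from polynomials.  For \<open>r \<ge> 1\<close>
  linear polynomials are available and the distance is \<open>O(h\<^sup>2)\<close>, except on the cell that contains
  \<open>s\<close>, where the derivative of the kernel jumps and only \<open>O(h)\<close> holds; that cell has length
  \<open>h\<close>.  Hence \<open>\<parallel>K g\<parallel> \<le> C h\<^sup>2 \<parallel>g\<parallel>\<close>, and \<open>\<parallel>K g\<parallel> \<le> C h \<parallel>g\<parallel>\<close> when \<open>r = 0\<close>
  (\<open>integral_op_orthogonal_bound\<close>).
\<close>

section \<open>Riemann--Stieltjes integrals along rectifiable curves\<close>

text \<open>The value \<open>0\<close> at the empty set makes this an additive function of intervals, to which the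
  library's theory of operative functions on divisions applies.\<close>

definition path_incr :: "(real \<Rightarrow> complex) \<Rightarrow> real set \<Rightarrow> complex" where
  "path_incr \<gamma> k = (if k = {} then 0 else \<gamma> (Sup k) - \<gamma> (Inf k))"

definition variation_le :: "(real \<Rightarrow> complex) \<Rightarrow> real \<Rightarrow> bool" where
  "variation_le \<gamma> L \<longleftrightarrow>
     (\<forall>d. d division_of {0..1} \<longrightarrow> (\<Sum>k\<in>d. dist (\<gamma> (Inf k)) (\<gamma> (Sup k))) \<le> L)"

definition stieltjes_sum ::
  "(real \<Rightarrow> complex) \<Rightarrow> (complex \<Rightarrow> 'a::complex_normed_vector) \<Rightarrow> (real \<times> real set) set \<Rightarrow> 'a" where
  "stieltjes_sum \<gamma> F p = (\<Sum>(t, k)\<in>p. (\<gamma> (Sup k) - \<gamma> (Inf k)) *\<^sub>C F (\<gamma> t))"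

text \<open>The convergence behind \<open>curve_integral\<close>, which itself has an unspecified value when the
  Riemann--Stieltjes sums diverge.\<close>

definition has_curve_integral ::
  "(complex \<Rightarrow> 'a::complex_normed_vector) \<Rightarrow> 'a \<Rightarrow> (real \<Rightarrow> complex) \<Rightarrow> bool" where
  "has_curve_integral F I \<gamma> \<longleftrightarrow> (stieltjes_sum \<gamma> F \<longlongrightarrow> I) (division_filter {0..1})"

lemma division_filter_unit_not_bot: "division_filter {0..1::real} \<noteq> bot"
  using division_filter_not_empty[of "0::real" 1] by simp

lemma curve_integral_eqI: "has_curve_integral F I \<gamma> \<Longrightarrow> curve_integral \<gamma> F = I"
  unfolding has_curve_integral_def stieltjes_sum_def[abs_def] curve_integral_def
  by (rule tendsto_Lim[OF division_filter_unit_not_bot])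

lemma path_incr_Icc: "path_incr \<gamma> {a..b} = (if a \<le> b then \<gamma> b - \<gamma> a else 0)"
  by (simp add: path_incr_def)

lemma sum_path_incr_tagged_division:
  assumes p: "p tagged_division_of {0..1}" and k: "{a..b} \<subseteq> {0..1}"
  shows "(\<Sum>(t, l)\<in>p. path_incr \<gamma> ({a..b} \<inter> l)) = path_incr \<gamma> {a..b}"
proof -
  let ?g = "\<lambda>l. path_incr \<gamma> ({a..b} \<inter> l)"
  interpret operative_real plus 0 ?g
    rewrites "comm_monoid_set.F (+) 0 = sum"
    by standard[1] (auto simp add: sum_def path_incr_Icc max_def min_def dest: order.antisym)
  have "(\<Sum>(t, l)\<in>p. ?g l) = ?g {0..1}"
    using tagged_division[of p 0 1] p by simp
  moreover have "{a..b} \<inter> {0..1} = {a..b}" using k by (rule Int_absorb2)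
  ultimately show ?thesis by (simp only:)
qed

lemma tagged_division_memD:
  assumes "p tagged_division_of {0..1::real}" "(t, k) \<in> p"
  obtains a b where "k = {a..b}" "a \<le> b" "{a..b} \<subseteq> {0..1}" "t \<in> {a..b}"
proof -
  obtain a b where "k = cbox a b" using tagged_division_ofD(4)[OF assms] by blast
  moreover have "t \<in> k" "k \<subseteq> {0..1}"
    using tagged_division_ofD(2,3)[OF assms] by blast+
  ultimately show ?thesis using that[of a b] by auto
qed

lemma tagged_division_tagD:
  assumes "p tagged_division_of {0..1::real}" "(t, k) \<in> p"
  shows "t \<in> {0..1}"
  by (rule tagged_division_memD[OF assms]) auto

text \<open>The nonempty sets \<open>k \<inter> l\<close> form a division, the common refinement.  Pairs whose intersection is a
  single point could be counted repeatedly, but \<open>\<gamma>\<close> has increment \<open>0\<close> on them.\<close>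

lemma sum_refinement_variation:
  assumes p: "p tagged_division_of {0..1}" and q: "q tagged_division_of {0..1}"
    and L: "variation_le \<gamma> L"
  shows "(\<Sum>(t, k)\<in>p. \<Sum>(u, l)\<in>q. cmod (path_incr \<gamma> (k \<inter> l))) \<le> L"
proof -
  define P where "P = {x \<in> p \<times> q. interior (snd (fst x) \<inter> snd (snd x)) \<noteq> {}}"
  define d where "d = {k \<inter> l |k l. k \<in> snd ` p \<and> l \<in> snd ` q \<and> k \<inter> l \<noteq> {}}"
  have fin: "finite p" "finite q" using p q by auto
  have d: "d division_of {0..1}"
    using division_inter[OF division_of_tagged_division[OF p] division_of_tagged_division[OF q]]
    by (simp add: d_def)
  have zero: "path_incr \<gamma> (k \<inter> l) = 0"
    if mem: "(t, k) \<in> p" "(u, l) \<in> q" "interior (k \<inter> l) = {}" for t k u l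
  proof -
    obtain a b where k: "k = {a..b}" by (rule tagged_division_memD[OF p mem(1)])
    obtain a' b' where l: "l = {a'..b'}" by (rule tagged_division_memD[OF q mem(2)])
    show ?thesis using mem(3) unfolding k l
      by (auto simp: path_incr_Icc min_def max_def split: if_splits dest: order.antisym)
  qed
  have inj: "inj_on (\<lambda>x. snd (fst x) \<inter> snd (snd x)) P"
  proof (rule inj_onI)
    fix x y assume xy: "x \<in> P" "y \<in> P" "snd (fst x) \<inter> snd (snd x) = snd (fst y) \<inter> snd (snd y)"
    obtain t k u l where x: "x = ((t, k), (u, l))" by (metis prod.exhaust)
    obtain t' k' u' l' where y: "y = ((t', k'), (u', l'))" by (metis prod.exhaust)
    have ne: "interior (k \<inter> l) \<noteq> {}" "k \<inter> l = k' \<inter> l'"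
      and mem: "(t, k) \<in> p" "(t', k') \<in> p" "(u, l) \<in> q" "(u', l') \<in> q"
      using xy by (auto simp: P_def x y)
    have "interior (k \<inter> l) \<subseteq> interior k \<inter> interior k'"
      "interior (k \<inter> l) \<subseteq> interior l \<inter> interior l'"
      using interior_mono[of "k \<inter> l" k] interior_mono[of "k \<inter> l" k']
        interior_mono[of "k \<inter> l" l] interior_mono[of "k \<inter> l" l'] ne(2) by auto
    then have "interior k \<inter> interior k' \<noteq> {}" "interior l \<inter> interior l' \<noteq> {}"
      using ne(1) by blast+
    then show "x = y"
      using tagged_division_ofD(5)[OF p mem(1,2)] tagged_division_ofD(5)[OF q mem(3,4)]
      by (auto simp: x y)
  qed
  have "(\<Sum>(t, k)\<in>p. \<Sum>(u, l)\<in>q. cmod (path_incr \<gamma> (k \<inter> l))) =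
      (\<Sum>x\<in>p \<times> q. cmod (path_incr \<gamma> (snd (fst x) \<inter> snd (snd x))))"
    by (simp add: sum.cartesian_product case_prod_unfold)
  also have "\<dots> = (\<Sum>x\<in>P. cmod (path_incr \<gamma> (snd (fst x) \<inter> snd (snd x))))"
    using fin zero by (intro sum.mono_neutral_right) (auto simp: P_def)
  also have "\<dots> = (\<Sum>k\<in>(\<lambda>x. snd (fst x) \<inter> snd (snd x)) ` P. cmod (path_incr \<gamma> k))"
    by (simp add: sum.reindex[OF inj])
  also have "\<dots> \<le> (\<Sum>k\<in>d. cmod (path_incr \<gamma> k))"
  proof (rule sum_mono2)
    show "finite d" using d by auto
    show "(\<lambda>x. snd (fst x) \<inter> snd (snd x)) ` P \<subseteq> d"
    proof (rule image_subsetI)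
      fix x assume x: "x \<in> P"
      then have "interior (snd (fst x) \<inter> snd (snd x)) \<noteq> {}" by (simp add: P_def)
      then have "snd (fst x) \<inter> snd (snd x) \<noteq> {}" by (metis interior_empty)
      moreover have "snd (fst x) \<in> snd ` p" "snd (snd x) \<in> snd ` q"
        using x by (auto simp: P_def image_iff)
      ultimately show "snd (fst x) \<inter> snd (snd x) \<in> d" unfolding d_def by blast
    qed
  qed simp
  also have "\<dots> = (\<Sum>k\<in>d. dist (\<gamma> (Inf k)) (\<gamma> (Sup k)))"
    using division_ofD(3)[OF d]
    by (intro sum.cong) (auto simp: path_incr_def dist_norm norm_minus_commute)
  also have "\<dots> \<le> L" using L d by (simp add: variation_le_def)
  finally show ?thesis .
qed

lemma norm_sum_scaleC_le:
  fixes v :: "'i \<Rightarrow> 'a::complex_normed_vector"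
  assumes "\<And>i. i \<in> S \<Longrightarrow> c i \<noteq> 0 \<Longrightarrow> norm (v i) \<le> B"
  shows "norm (\<Sum>i\<in>S. c i *\<^sub>C v i) \<le> (\<Sum>i\<in>S. cmod (c i)) * B"
proof -
  have "norm (\<Sum>i\<in>S. c i *\<^sub>C v i) \<le> (\<Sum>i\<in>S. cmod (c i) * B)"
  proof (rule sum_norm_le)
    fix i assume i: "i \<in> S"
    show "norm (c i *\<^sub>C v i) \<le> cmod (c i) * B"
      using assms[OF i] by (cases "c i = 0") (auto simp: norm_scaleC mult_left_mono)
  qed
  then show ?thesis by (simp add: sum_distrib_right)
qed

lemma scaleC_sum_left: "(\<Sum>i\<in>S. c i) *\<^sub>C (v :: 'a::complex_normed_vector) = (\<Sum>i\<in>S. c i *\<^sub>C v)"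
  by (rule complex_vector.scale_sum_left)

lemma scaleC_diff_right: "c *\<^sub>C (x - y) = c *\<^sub>C x - c *\<^sub>C (y :: 'a::complex_normed_vector)"
  by (rule complex_vector.scale_right_diff_distrib)

lemma stieltjes_sum_path_incr:
  assumes "p tagged_division_of {0..1}"
  shows "stieltjes_sum \<gamma> F p = (\<Sum>(t, k)\<in>p. path_incr \<gamma> k *\<^sub>C F (\<gamma> t))"
  unfolding stieltjes_sum_def
proof (rule sum.cong[OF refl], clarify)
  fix t k assume "(t, k) \<in> p"
  then have "k \<noteq> {}" using tagged_division_ofD(2)[OF assms] by blast
  then show "(\<gamma> (Sup k) - \<gamma> (Inf k)) *\<^sub>C F (\<gamma> t) = path_incr \<gamma> k *\<^sub>C F (\<gamma> t)"
    by (simp add: path_incr_def)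
qed

text \<open>Both sums can be written over the common refinement, where they differ only in the point at which
  \<open>F\<close> is evaluated.\<close>

lemma stieltjes_sum_diff_le:
  assumes p: "p tagged_division_of {0..1}" and q: "q tagged_division_of {0..1}"
    and L: "variation_le \<gamma> L"
    and close: "\<And>t k u l. (t, k) \<in> p \<Longrightarrow> (u, l) \<in> q \<Longrightarrow> k \<inter> l \<noteq> {} \<Longrightarrow>
      norm (F (\<gamma> t) - F (\<gamma> u)) \<le> e" and e: "e \<ge> 0"
  shows "norm (stieltjes_sum \<gamma> F p - stieltjes_sum \<gamma> F q) \<le> L * e"
proof -
  have fin: "finite p" "finite q" using p q by auto
  have *: "stieltjes_sum \<gamma> F p = (\<Sum>x\<in>p. \<Sum>y\<in>q. path_incr \<gamma> (snd x \<inter> snd y) *\<^sub>C F (\<gamma> (fst x)))"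
    if p: "p tagged_division_of {0..1}" and q: "q tagged_division_of {0..1}" for p q
    unfolding stieltjes_sum_path_incr[OF p]
  proof (rule sum.cong[OF refl], clarify)
    fix t k assume tk: "(t, k) \<in> p"
    obtain a b where k: "k = {a..b}" "{a..b} \<subseteq> {0..1}" by (rule tagged_division_memD[OF p tk])
    have "path_incr \<gamma> k = (\<Sum>y\<in>q. path_incr \<gamma> (k \<inter> snd y))"
      using sum_path_incr_tagged_division[OF q k(2), of \<gamma>] by (simp add: k(1) case_prod_unfold)
    then show "path_incr \<gamma> k *\<^sub>C F (\<gamma> t) =
        (\<Sum>y\<in>q. path_incr \<gamma> (snd (t, k) \<inter> snd y) *\<^sub>C F (\<gamma> (fst (t, k))))"
      by (simp add: scaleC_sum_left)
  qed
  have 1: "stieltjes_sum \<gamma> F p =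
      (\<Sum>z\<in>p \<times> q. path_incr \<gamma> (snd (fst z) \<inter> snd (snd z)) *\<^sub>C F (\<gamma> (fst (fst z))))"
    unfolding *[OF p q] by (subst sum.cartesian_product) (simp add: case_prod_unfold)
  have 2: "stieltjes_sum \<gamma> F q =
      (\<Sum>z\<in>p \<times> q. path_incr \<gamma> (snd (fst z) \<inter> snd (snd z)) *\<^sub>C F (\<gamma> (fst (snd z))))"
    unfolding *[OF q p]
    by (subst sum.swap, subst sum.cartesian_product) (simp add: case_prod_unfold Int_commute)
  have "norm (stieltjes_sum \<gamma> F p - stieltjes_sum \<gamma> F q) =
    norm (\<Sum>z\<in>p \<times> q. path_incr \<gamma> (snd (fst z) \<inter> snd (snd z)) *\<^sub>C
      (F (\<gamma> (fst (fst z))) - F (\<gamma> (fst (snd z)))))"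
    unfolding 1 2 by (simp add: sum_subtractf[symmetric] scaleC_diff_right)
  also have "\<dots> \<le> (\<Sum>z\<in>p \<times> q. cmod (path_incr \<gamma> (snd (fst z) \<inter> snd (snd z)))) * e"
  proof (rule norm_sum_scaleC_le)
    fix z assume z: "z \<in> p \<times> q" "path_incr \<gamma> (snd (fst z) \<inter> snd (snd z)) \<noteq> 0"
    then have "snd (fst z) \<inter> snd (snd z) \<noteq> {}" by (auto simp: path_incr_def)
    then show "norm (F (\<gamma> (fst (fst z))) - F (\<gamma> (fst (snd z)))) \<le> e"
      using z(1) by (intro close[of _ "snd (fst z)" _ "snd (snd z)"]) auto
  qed
  also have "(\<Sum>z\<in>p \<times> q. cmod (path_incr \<gamma> (snd (fst z) \<inter> snd (snd z)))) =
      (\<Sum>(t, k)\<in>p. \<Sum>(u, l)\<in>q. cmod (path_incr \<gamma> (k \<inter> l)))"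
    by (simp add: sum.cartesian_product case_prod_unfold)
  also have "(\<Sum>(t, k)\<in>p. \<Sum>(u, l)\<in>q. cmod (path_incr \<gamma> (k \<inter> l))) * e \<le> L * e"
    by (intro mult_right_mono sum_refinement_variation[OF p q L] e)
  finally show ?thesis .
qed

text \<open>By uniform continuity of \<open>F \<circ> \<gamma>\<close> the sums over fine divisions form a Cauchy filter.\<close>

lemma has_curve_integral_exists:
  fixes F :: "complex \<Rightarrow> 'a::{complex_normed_vector, banach}"
  assumes "rectifiable_path \<gamma>" and F: "continuous_on (path_image \<gamma>) F"
  shows "\<exists>I. has_curve_integral F I \<gamma>"
proof -
  obtain L where L: "variation_le \<gamma> L" and "path \<gamma>"
    using assms(1) by (auto simp: rectifiable_path_def variation_le_def)
  have uc: "uniformly_continuous_on {0..1} (\<lambda>t. F (\<gamma> t))"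
    using \<open>path \<gamma>\<close> F
    by (intro compact_uniformly_continuous[OF continuous_on_compose2[OF F]] compact_Icc)
      (auto simp: path_def path_image_def)
  have L0: "0 \<le> L"
  proof -
    have "{{0..1::real}} division_of {0..1}" using division_of_self[of "0::real" 1] by simp
    from L[unfolded variation_le_def, rule_format, OF this]
    have "dist (\<gamma> (Inf {0..1})) (\<gamma> (Sup {0..1})) \<le> L" by (simp del: Inf_atLeastAtMost)
    then show ?thesis by (rule order_trans[OF zero_le_dist])
  qed
  have "cauchy_filter (filtermap (stieltjes_sum \<gamma> F) (division_filter {0..1}))"
    unfolding cauchy_filter_metric_filtermap
  proof (intro allI impI)
    fix e :: real assume e: "e > 0"
    define e' where "e' = e / (L + 1)"
    have e': "e' > 0" using e L0 by (simp add: e'_def)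
    have "(L + 1) * e' = e" using L0 by (simp add: e'_def)
    then have Le': "L * e' < e" using e' by (simp add: distrib_right)
    obtain d where d: "d > 0" "\<And>s t. s \<in> {0..1} \<Longrightarrow> t \<in> {0..1} \<Longrightarrow> dist t s < d \<Longrightarrow>
        dist (F (\<gamma> t)) (F (\<gamma> s)) < e'"
      by (rule uniformly_continuous_onE[OF uc e']) blast
    let ?P = "\<lambda>p. p tagged_division_of {0..1::real} \<and> (\<lambda>x. ball x (d / 2)) fine p"
    have "eventually ?P (division_filter {0..1})"
      unfolding eventually_division_filter using d(1) by (intro exI[of _ "\<lambda>x. ball x (d / 2)"]) auto
    moreover have dist: "dist (stieltjes_sum \<gamma> F p) (stieltjes_sum \<gamma> F q) < e" if pq: "?P p" "?P q" for p q
    proof -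
      have "norm (stieltjes_sum \<gamma> F p - stieltjes_sum \<gamma> F q) \<le> L * e'"
      proof (rule stieltjes_sum_diff_le[OF _ _ L])
        fix t k u l assume tk: "(t, k) \<in> p" and ul: "(u, l) \<in> q" and ne: "k \<inter> l \<noteq> {}"
        obtain x where x: "x \<in> k" "x \<in> l" using ne by blast
        have "x \<in> ball t (d / 2)" "x \<in> ball u (d / 2)"
          using fineD[of "\<lambda>x. ball x (d / 2)" p t k] fineD[of "\<lambda>x. ball x (d / 2)" q u l] pq tk ul x by blast+
        then have "dist t u < d" using dist_triangle_half_r[of x t d u] by (simp add: dist_commute)
        moreover have "t \<in> {0..1}" "u \<in> {0..1}"
          using tagged_division_tagD[of p t k] tagged_division_tagD[of q u l] pq tk ul by simp_all
        ultimately show "norm (F (\<gamma> t) - F (\<gamma> u)) \<le> e'"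
          using d(2)[of u t] by (simp add: dist_norm)
      qed (use pq e' in auto)
      then show ?thesis using Le' by (simp add: dist_norm)
    qed
    ultimately show "\<exists>P. eventually P (division_filter {0..1}) \<and>
        (\<forall>x y. P x \<and> P y \<longrightarrow> dist (stieltjes_sum \<gamma> F x) (stieltjes_sum \<gamma> F y) < e)"
      by (intro exI[of _ ?P] conjI allI impI) (assumption, elim conjE, intro dist conjI)
  qed
  from cauchy_filter_complete_converges[OF this complete_UNIV]
  obtain I where "filtermap (stieltjes_sum \<gamma> F) (division_filter {0..1}) \<le> nhds I"
    using division_filter_unit_not_bot by (auto simp: filtermap_bot_iff simp del: Inf_atLeastAtMost)
  then show ?thesis by (auto simp: has_curve_integral_def filterlim_def)
qed

lemma has_curve_integral_linear:
  assumes "has_curve_integral F I \<gamma>" and T: "bounded_linear T" "\<And>c x. T (c *\<^sub>C x) = c *\<^sub>C T x"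
  shows "has_curve_integral (\<lambda>w. T (F w)) (T I) \<gamma>"
proof -
  have "T (stieltjes_sum \<gamma> F p) = stieltjes_sum \<gamma> (\<lambda>w. T (F w)) p" for p
  proof -
    interpret bounded_linear T by (rule T)
    show ?thesis by (simp add: stieltjes_sum_def sum T case_prod_unfold)
  qed
  then show ?thesis
    using bounded_linear.tendsto[OF T(1) assms(1)[unfolded has_curve_integral_def]]
    by (simp add: has_curve_integral_def)
qed

lemma has_curve_integral_add:
  assumes "has_curve_integral F I \<gamma>" "has_curve_integral G J \<gamma>"
  shows "has_curve_integral (\<lambda>w. F w + G w) (I + J) \<gamma>"
proof -
  have "stieltjes_sum \<gamma> (\<lambda>w. F w + G w) = (\<lambda>p. stieltjes_sum \<gamma> F p + stieltjes_sum \<gamma> G p)"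
    by (rule ext) (simp add: stieltjes_sum_def scaleC_add_right case_prod_unfold sum.distrib)
  then show ?thesis
    using tendsto_add[OF assms[unfolded has_curve_integral_def]]
    by (simp add: has_curve_integral_def)
qed

lemma has_curve_integral_cong:
  assumes "\<And>w. w \<in> path_image \<gamma> \<Longrightarrow> F w = G w" "has_curve_integral F I \<gamma>"
  shows "has_curve_integral G I \<gamma>"
proof -
  have "\<forall>\<^sub>F p in division_filter {0..1}. stieltjes_sum \<gamma> F p = stieltjes_sum \<gamma> G p"
    using eventually_division_filter_tagged_division
  proof eventually_elim
    case (elim p)
    show ?case
      unfolding stieltjes_sum_def
    proof (rule sum.cong[OF refl], clarify)
      fix t k assume "(t, k) \<in> p"
      then have "\<gamma> t \<in> path_image \<gamma>"
        using tagged_division_tagD[OF elim] unfolding path_image_def by blast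
      then show "(\<gamma> (Sup k) - \<gamma> (Inf k)) *\<^sub>C F (\<gamma> t) = (\<gamma> (Sup k) - \<gamma> (Inf k)) *\<^sub>C G (\<gamma> t)"
        by (simp only: assms(1))
    qed
  qed
  from tendsto_cong[OF this] show ?thesis
    using assms(2) by (simp add: has_curve_integral_def)
qed

lemma sum_path_incr_le:
  assumes p: "p tagged_division_of {0..1}" and L: "variation_le \<gamma> L"
  shows "(\<Sum>x\<in>p. cmod (path_incr \<gamma> (snd x))) \<le> L"
proof -
  have u: "{(0, {0..1})} tagged_division_of {0..1::real}"
    by (rule tagged_division_of_self_real) simp
  have "(\<Sum>x\<in>p. cmod (path_incr \<gamma> (snd x))) =
      (\<Sum>(t, k)\<in>p. \<Sum>(u, l)\<in>{(0::real, {0..1})}. cmod (path_incr \<gamma> (k \<inter> l)))"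
    using tagged_division_ofD(3)[OF p] by (intro sum.cong) (auto simp: Int_absorb2)
  also have "\<dots> \<le> L"
    by (rule sum_refinement_variation[OF p u L])
  finally show ?thesis .
qed

lemma has_curve_integral_bound:
  assumes "has_curve_integral F I \<gamma>" "variation_le \<gamma> L"
    and "\<And>w. w \<in> path_image \<gamma> \<Longrightarrow> norm (F w) \<le> B"
  shows "norm I \<le> L * B"
proof -
  have "B \<ge> 0"
    using assms(3)[of "\<gamma> 0"] by (intro order_trans[OF norm_ge_zero]) (simp add: path_image_def)
  have "\<forall>\<^sub>F p in division_filter {0..1}. norm (stieltjes_sum \<gamma> F p) \<le> L * B"
    using eventually_division_filter_tagged_division
  proof eventually_elim
    case (elim p)
    have t: "norm (F (\<gamma> t)) \<le> B" if "(t, k) \<in> p" for t k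
      using assms(3) tagged_division_tagD[OF elim that] unfolding path_image_def by blast
    have "norm (stieltjes_sum \<gamma> F p) \<le> (\<Sum>x\<in>p. cmod (path_incr \<gamma> (snd x))) * B"
      unfolding stieltjes_sum_path_incr[OF elim] case_prod_unfold
      by (rule norm_sum_scaleC_le) (use t in auto)
    also have "\<dots> \<le> L * B"
      by (rule mult_right_mono[OF sum_path_incr_le[OF elim assms(2)] \<open>B \<ge> 0\<close>])
    finally show ?case .
  qed
  then show ?thesis
    using assms(1) unfolding has_curve_integral_def
    by (intro tendsto_upperbound[OF tendsto_norm _ division_filter_unit_not_bot])
qed

section \<open>Resolvents and spectral projections\<close>

lemma bounded_linear_scaleC_left:
  "bounded_linear (\<lambda>c. c *\<^sub>C (x :: 'a::complex_normed_vector))"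
  by (rule bounded_linear_intro[where K = "norm x"])
    (simp_all add: scaleC_add_left scaleC_of_real[symmetric] scaleC_scaleC norm_scaleC
      scaleR_conv_of_real)

text \<open>Near \<open>0\<close> the exponential differs from a translation by a small relative error, because the
  derivative of \<open>exp u - u\<close> vanishes at \<open>0\<close>.\<close>

lemma exp_diff_estimate:
  fixes e :: real
  assumes "e > 0"
  obtains h where "h > 0" "\<And>u v :: complex. norm u < h \<Longrightarrow> norm v < h \<Longrightarrow>
    norm (exp u - exp v - (u - v)) \<le> e * norm (u - v)"
proof -
  have "continuous (at (0::complex)) exp" by (intro continuous_intros)
  then obtain h where h: "h > 0" "\<And>u :: complex. norm u < h \<Longrightarrow> norm (exp u - 1) < e"
    unfolding continuous_at_eps_delta using \<open>e > 0\<close> by (auto simp: dist_norm)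
  have "norm ((exp u - u) - (exp v - v)) \<le> e * norm (u - v)"
    if "norm u < h" "norm v < h" for u v :: complex
  proof (rule field_differentiable_bound[where S = "ball 0 h" and f' = "\<lambda>u. exp u - 1"])
    show "((\<lambda>u. exp u - u) has_field_derivative exp z - 1) (at z within ball 0 h)" for z :: complex
      by (auto intro!: derivative_eq_intros)
  qed (use h that in \<open>auto simp: less_imp_le\<close>)
  then show ?thesis
    using h(1) by (intro that[of h]) (auto simp: algebra_simps)
qed

text \<open>The winding number of a path is defined through nearby piecewise smooth paths, not as this integral.
  Write \<open>\<gamma> = z + exp q\<close> with a continuous logarithm \<open>q\<close>.  On a fine division
  \<open>(\<gamma> b - \<gamma> a) / (\<gamma> t - z) = exp (q b - q t) - exp (q a - q t)\<close> equals \<open>q b - q a\<close> up to a small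
  relative error, the increments of \<open>q\<close> telescope to \<open>2 \<pi> i\<close> times the winding number, and the
  errors add up to a small multiple of the variation of \<open>\<gamma>\<close>.\<close>

lemma winding_number_stieltjes:
  assumes \<gamma>: "rectifiable_path \<gamma>" and z: "z \<notin> path_image \<gamma>"
  shows "((\<lambda>p. \<Sum>(t, k)\<in>p. (\<gamma> (Sup k) - \<gamma> (Inf k)) / (\<gamma> t - z)) \<longlongrightarrow>
    2 * of_real pi * \<i> * winding_number \<gamma> z) (division_filter {0..1})"
proof -
  obtain L where L: "variation_le \<gamma> L" and path: "path \<gamma>"
    using \<gamma> by (auto simp: rectifiable_path_def variation_le_def)
  obtain q where q: "path q"
      "pathfinish q - pathstart q = 2 * of_real pi * \<i> * winding_number \<gamma> z"
      "\<And>t. t \<in> {0..1} \<Longrightarrow> \<gamma> t = z + exp (q t)"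
    using winding_number_as_continuous_log[OF path z] by blast
  have "closed (path_image \<gamma>)" by (rule closed_path_image[OF path])
  then obtain d where d: "d > 0" "\<And>w. w \<in> path_image \<gamma> \<Longrightarrow> d \<le> dist z w"
    using separate_point_closed[OF _ z] by blast
  have L0: "L \<ge> 0"
  proof -
    obtain p where "p tagged_division_of {0..1::real}"
      by (rule fine_division_exists_real[of "\<lambda>x. UNIV" 0 1]) (auto simp: gauge_def)
    from sum_path_incr_le[OF this L] show ?thesis
      by (rule order_trans[rotated]) (simp add: sum_nonneg)
  qed
  have uc: "uniformly_continuous_on {0..1} q"
    using q(1) by (intro compact_uniformly_continuous) (auto simp: path_def)
  show ?thesis
  proof (rule tendstoI)
    fix \<epsilon> :: real assume "\<epsilon> > 0"
    define e where "e = min (1/2) (\<epsilon> * d / (2 * (L + 1)))"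
    have e: "e > 0" using \<open>\<epsilon> > 0\<close> d(1) L0 by (simp add: e_def)
    have e2: "e \<le> 1/2" unfolding e_def by (rule min.cobounded1)
    have "e \<le> \<epsilon> * d / (2 * (L + 1))" unfolding e_def by (rule min.cobounded2)
    then have "e * (2 * (L + 1)) \<le> \<epsilon> * d" using L0 by (simp add: pos_le_divide_eq)
    then have eL: "2 * e * L / d < \<epsilon>"
      using e d(1) by (simp add: pos_divide_less_eq algebra_simps)
    obtain h where h: "h > 0" "\<And>u v :: complex. norm u < h \<Longrightarrow> norm v < h \<Longrightarrow>
        norm (exp u - exp v - (u - v)) \<le> e * norm (u - v)"
      using exp_diff_estimate[OF e] by blast
    obtain \<delta> where \<delta>: "\<delta> > 0" "\<And>s t. s \<in> {0..1} \<Longrightarrow> t \<in> {0..1} \<Longrightarrow> dist t s < \<delta> \<Longrightarrow> dist (q t) (q s) < h"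
      by (rule uniformly_continuous_onE[OF uc h(1)]) blast
    have "\<forall>\<^sub>F p in division_filter {0..1}. p tagged_division_of {0..1} \<and> (\<lambda>x. ball x \<delta>) fine p"
      unfolding eventually_division_filter using \<delta>(1) by (intro exI[of _ "\<lambda>x. ball x \<delta>"]) auto
    then show "\<forall>\<^sub>F p in division_filter {0..1}.
        dist (\<Sum>(t, k)\<in>p. (\<gamma> (Sup k) - \<gamma> (Inf k)) / (\<gamma> t - z))
          (2 * of_real pi * \<i> * winding_number \<gamma> z) < \<epsilon>"
    proof eventually_elim
      case (elim p)
      then have p: "p tagged_division_of {0..1}" and fine: "(\<lambda>x. ball x \<delta>) fine p" by auto
      \<comment> \<open>the increments of the logarithm \<open>q\<close> are themselves controlled by those of \<open>\<gamma>\<close>, since \<open>e \<le> 1/2\<close>\<close>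
      have piece: "norm ((\<gamma> (Sup k) - \<gamma> (Inf k)) / (\<gamma> t - z) - (q (Sup k) - q (Inf k)))
          \<le> (2 * e / d) * cmod (path_incr \<gamma> k)" if tk: "(t, k) \<in> p" for t k
      proof -
        obtain a b where k: "k = {a..b}" "a \<le> b" "{a..b} \<subseteq> {0..1}" "t \<in> {a..b}"
          by (rule tagged_division_memD[OF p tk])
        have "{a..b} \<subseteq> ball t \<delta>" using fine tk k(1) by (auto dest!: fineD)
        then have ab: "dist a t < \<delta>" "dist b t < \<delta>"
          using k(2) by (auto simp: subset_iff dist_commute)
        have mem: "a \<in> {0..1}" "b \<in> {0..1}" "t \<in> {0..1}" using k by auto
        define u v where "u = q b - q t" and "v = q a - q t"
        have uv: "norm u < h" "norm v < h"
          using \<delta>(2)[OF mem(3) mem(1) ab(1)] \<delta>(2)[OF mem(3) mem(2) ab(2)]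
          by (auto simp: u_def v_def dist_norm)
        have quot: "(\<gamma> b - \<gamma> a) / (\<gamma> t - z) = exp u - exp v"
          using mem by (simp add: q(3) u_def v_def exp_diff diff_divide_distrib)
        have le: "norm (exp u - exp v - (u - v)) \<le> e * norm (u - v)" by (rule h(2)[OF uv])
        have "norm (u - v) \<le> norm (exp u - exp v) + norm (exp u - exp v - (u - v))"
          using norm_triangle_ineq4[of "exp u - exp v" "exp u - exp v - (u - v)"] by simp
        also have "\<dots> \<le> norm (exp u - exp v) + (1/2) * norm (u - v)"
          using le mult_right_mono[OF e2 norm_ge_zero[of "u - v"]] by linarith
        finally have "norm (u - v) \<le> 2 * norm (exp u - exp v)" by simp
        also have "norm (exp u - exp v) = norm (\<gamma> b - \<gamma> a) / norm (\<gamma> t - z)"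
          by (simp add: quot[symmetric] norm_divide)
        also have "\<dots> \<le> norm (\<gamma> b - \<gamma> a) / d"
        proof (rule frac_le[OF _ order_refl d(1)])
          have "\<gamma> t \<in> path_image \<gamma>" using mem(3) by (auto simp: path_image_def)
          from d(2)[OF this] show "d \<le> norm (\<gamma> t - z)" by (simp add: dist_norm norm_minus_commute)
        qed simp
        finally have "norm (u - v) \<le> 2 * (norm (\<gamma> b - \<gamma> a) / d)" by simp
        from mult_left_mono[OF this, of e]
        have "e * norm (u - v) \<le> e * (2 * (norm (\<gamma> b - \<gamma> a) / d))"
          using e by simp
        then have "norm (exp u - exp v - (u - v)) \<le> (2 * e / d) * norm (\<gamma> b - \<gamma> a)"
          using le by (simp add: mult_ac)
        moreover have "u - v = q b - q a" by (simp add: u_def v_def)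
        ultimately show ?thesis
          using k by (simp add: quot path_incr_def)
      qed
      have "(\<Sum>(t, k)\<in>p. q (Sup k) - q (Inf k)) = q 1 - q 0"
        by (rule additive_tagged_division_1[OF _ p]) simp
      then have "(\<Sum>x\<in>p. q (Sup (snd x)) - q (Inf (snd x))) = 2 * of_real pi * \<i> * winding_number \<gamma> z"
        using q(2) by (simp add: pathfinish_def pathstart_def case_prod_unfold)
      then have "norm ((\<Sum>(t, k)\<in>p. (\<gamma> (Sup k) - \<gamma> (Inf k)) / (\<gamma> t - z)) -
          2 * of_real pi * \<i> * winding_number \<gamma> z) =
        norm (\<Sum>x\<in>p. (\<gamma> (Sup (snd x)) - \<gamma> (Inf (snd x))) / (\<gamma> (fst x) - z)
          - (q (Sup (snd x)) - q (Inf (snd x))))"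
        by (simp add: sum_subtractf case_prod_unfold)
      also have "\<dots> \<le> (\<Sum>x\<in>p. (2 * e / d) * cmod (path_incr \<gamma> (snd x)))"
        by (rule sum_norm_le) (use piece in auto)
      also have "\<dots> = (2 * e / d) * (\<Sum>x\<in>p. cmod (path_incr \<gamma> (snd x)))"
        by (simp add: sum_distrib_left)
      also have "\<dots> \<le> (2 * e / d) * L"
        using e d(1) by (intro mult_left_mono[OF sum_path_incr_le[OF p L]]) simp
      also have "\<dots> < \<epsilon>" using eL by simp
      finally show ?case by (simp add: dist_norm)
    qed
  qed
qed

lemma has_curve_integral_Cauchy_kernel:
  assumes "rectifiable_path \<gamma>" "z \<notin> path_image \<gamma>"
  shows "has_curve_integral (\<lambda>w. (1 / (w - z)) *\<^sub>C (x :: 'a::complex_normed_vector))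
    ((2 * of_real pi * \<i> * winding_number \<gamma> z) *\<^sub>C x) \<gamma>"
proof -
  have "stieltjes_sum \<gamma> (\<lambda>w. (1 / (w - z)) *\<^sub>C x) =
      (\<lambda>p. (\<Sum>(t, k)\<in>p. (\<gamma> (Sup k) - \<gamma> (Inf k)) / (\<gamma> t - z)) *\<^sub>C x)"
    by (rule ext) (simp add: stieltjes_sum_def scaleC_sum_left scaleC_scaleC case_prod_unfold)
  then show ?thesis
    using bounded_linear.tendsto[OF bounded_linear_scaleC_left winding_number_stieltjes[OF assms]]
    by (simp add: has_curve_integral_def)
qed

definition complex_linear :: "('a::complex_normed_vector \<Rightarrow> 'b::complex_normed_vector) \<Rightarrow> bool" where
  "complex_linear T \<longleftrightarrow> bounded_linear T \<and> (\<forall>c x. T (c *\<^sub>C x) = c *\<^sub>C T x)"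

context
  fixes T :: "'a::complex_normed_vector \<Rightarrow> 'a"
  assumes T: "complex_linear T"
begin

lemma complex_linearD: "bounded_linear T" "T (x + y) = T x + T y" "T (x - y) = T x - T y"
  "T (- x) = - T x" "T (c *\<^sub>C x) = c *\<^sub>C T x"
  using T by (simp_all add: complex_linear_def linear_simps)

lemma resolvent_inverse:
  assumes "z \<in> resolvent_set T"
  shows "T (resolvent T z y) - z *\<^sub>C resolvent T z y = y"
    and "resolvent T z (T x - z *\<^sub>C x) = x"
proof -
  have b: "bij (\<lambda>x. T x - z *\<^sub>C x)" and l: "bounded_linear (inv (\<lambda>x. T x - z *\<^sub>C x))"
    using assms by (auto simp: resolvent_set_def)
  have r: "blinfun_apply (resolvent T z) = inv (\<lambda>x. T x - z *\<^sub>C x)"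
    unfolding resolvent_def by (rule bounded_linear_Blinfun_apply[OF l])
  show "T (resolvent T z y) - z *\<^sub>C resolvent T z y = y"
    unfolding r by (rule surj_f_inv_f[OF bij_is_surj[OF b]])
  show "resolvent T z (T x - z *\<^sub>C x) = x"
    unfolding r by (rule inv_f_f[OF bij_is_inj[OF b]])
qed

lemma resolvent_bound:
  "z \<in> resolvent_set T \<Longrightarrow> norm x \<le> norm (resolvent T z) * norm (T x - z *\<^sub>C x)"
  using norm_blinfun[of "resolvent T z" "T x - z *\<^sub>C x"] by (simp add: resolvent_inverse)

lemma resolvent_commute:
  assumes z: "z \<in> resolvent_set T"
  shows "resolvent T z (T x) = T (resolvent T z x)"
proof -
  have "T x = T (T (resolvent T z x)) - z *\<^sub>C T (resolvent T z x)"
    by (metis resolvent_inverse(1)[OF z, of x] complex_linearD(3,5))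
  then show ?thesis using resolvent_inverse(2)[OF z, of "T (resolvent T z x)"] by simp
qed

lemma resolvent_scaleC:
  assumes z: "z \<in> resolvent_set T"
  shows "resolvent T z (c *\<^sub>C y) = c *\<^sub>C resolvent T z y"
proof -
  have "T (c *\<^sub>C resolvent T z y) - z *\<^sub>C (c *\<^sub>C resolvent T z y) =
      c *\<^sub>C (T (resolvent T z y) - z *\<^sub>C resolvent T z y)"
    by (simp add: complex_linearD scaleC_diff_right scaleC_scaleC mult.commute)
  also have "\<dots> = c *\<^sub>C y" by (simp add: resolvent_inverse(1)[OF z])
  finally show ?thesis
    using resolvent_inverse(2)[OF z, of "c *\<^sub>C resolvent T z y"] by simp
qed

text \<open>The resolvent at \<open>z\<close> bounds those at nearby points \<open>w\<close> of the resolvent set, and then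
  \<open>R(w) - R(z) = (w - z) R(z) R(w)\<close> is small.\<close>

lemma continuous_on_resolvent: "continuous_on (resolvent_set T) (resolvent T)"
  unfolding continuous_on_iff
proof (intro ballI allI impI)
  fix z and e :: real assume z: "z \<in> resolvent_set T" and e: "e > 0"
  define M where "M = norm (resolvent T z) + 1"
  have M: "M > 0" by (simp add: M_def add_nonneg_pos)
  define d where "d = min (1 / (2 * M)) (e / (4 * M * M))"
  have d: "d > 0" using M e by (simp add: d_def)
  have "dist (resolvent T w) (resolvent T z) < e"
    if w: "w \<in> resolvent_set T" and wz: "dist w z < d" for w
  proof -
    have c: "cmod (w - z) * M \<le> 1/2" "cmod (w - z) * (2 * M * M) \<le> e / 2"
    proof -
      have "cmod (w - z) \<le> 1 / (2 * M)" "cmod (w - z) \<le> e / (4 * M * M)"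
        using wz by (auto simp: d_def dist_norm)
      then show "cmod (w - z) * M \<le> 1/2" "cmod (w - z) * (2 * M * M) \<le> e / 2"
        using M by (auto simp: field_simps)
    qed
    have Mb: "norm x \<le> M * norm (T x - z *\<^sub>C x)" for x
      using resolvent_bound[OF z, of x] mult_right_mono[of "norm (resolvent T z)" M "norm (T x - z *\<^sub>C x)"]
      by (simp add: M_def)
    have "norm (resolvent T w - resolvent T z) \<le> e / 2"
    proof (rule norm_blinfun_bound)
      fix y
      define x where "x = resolvent T w y"
      have x: "T x - w *\<^sub>C x = y" unfolding x_def by (rule resolvent_inverse(1)[OF w])
      have Tx: "T x - z *\<^sub>C x = y + (w - z) *\<^sub>C x"
        using x by (simp add: complex_vector.scale_left_diff_distrib algebra_simps)
      have "norm (T x - z *\<^sub>C x) \<le> norm y + cmod (w - z) * norm x"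
        unfolding Tx by (rule order_trans[OF norm_triangle_ineq]) (simp add: norm_scaleC)
      from mult_left_mono[OF this, of M] Mb[of x]
      have "norm x \<le> M * norm y + (cmod (w - z) * M) * norm x"
        using M by (simp add: distrib_left mult_ac)
      also have "\<dots> \<le> M * norm y + (1/2) * norm x"
        using c(1) by (intro add_left_mono mult_right_mono) auto
      finally have xb: "norm x \<le> 2 * M * norm y" by simp
      define x0 where "x0 = resolvent T z y"
      have x0: "T x0 - z *\<^sub>C x0 = y" unfolding x0_def by (rule resolvent_inverse(1)[OF z])
      have "T (x - x0) - z *\<^sub>C (x - x0) = (T x - z *\<^sub>C x) - (T x0 - z *\<^sub>C x0)"
        by (simp add: complex_linearD scaleC_diff_right)
      also have "\<dots> = (w - z) *\<^sub>C x" by (simp add: Tx x0)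
      finally have "norm (x - x0) \<le> M * (cmod (w - z) * norm x)"
        using Mb[of "x - x0"] by (simp add: norm_scaleC)
      also have "\<dots> \<le> M * (cmod (w - z) * (2 * M * norm y))"
        using xb M by (intro mult_left_mono) auto
      also have "\<dots> = (cmod (w - z) * (2 * M * M)) * norm y" by (simp add: mult_ac)
      also have "\<dots> \<le> (e / 2) * norm y" by (intro mult_right_mono c) simp
      finally show "norm ((resolvent T w - resolvent T z) y) \<le> e / 2 * norm y"
        by (simp add: x_def x0_def minus_blinfun.rep_eq)
    qed (use e in simp)
    then show ?thesis using e by (simp add: dist_norm)
  qed
  then show "\<exists>d>0. \<forall>w\<in>resolvent_set T. dist w z < d \<longrightarrow> dist (resolvent T w) (resolvent T z) < e"
    using d by blast
qed

end

context
  fixes T :: "'a::{complex_normed_vector, banach} \<Rightarrow> 'a" and \<gamma> :: "real \<Rightarrow> complex"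
  assumes T: "complex_linear T"
    and \<gamma>: "simple_closed_rectifiable_pos \<gamma>"
    and res: "path_image \<gamma> \<subseteq> resolvent_set T"
begin

lemma curve_rectifiable: "rectifiable_path \<gamma>" "path \<gamma>"
  using \<gamma> by (auto simp: simple_closed_rectifiable_pos_def rectifiable_path_def)

lemma resolvent_bounded_on_curve:
  "\<exists>M>0. \<forall>w\<in>path_image \<gamma>. norm (resolvent T w) \<le> M"
proof -
  have "compact (resolvent T ` path_image \<gamma>)"
    by (intro compact_continuous_image compact_path_image curve_rectifiable
        continuous_on_subset[OF continuous_on_resolvent[OF T] res])
  then have "bounded (resolvent T ` path_image \<gamma>)" by (rule compact_imp_bounded)
  then show ?thesis by (auto simp: bounded_pos)
qed

lemma spectral_projection_integral:
  "has_curve_integral (\<lambda>w. resolvent T w x)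
     (- (2 * of_real pi * \<i>) *\<^sub>C spectral_projection \<gamma> T x) \<gamma>"
proof -
  obtain I where I: "has_curve_integral (resolvent T) I \<gamma>"
    using has_curve_integral_exists[OF curve_rectifiable(1)
        continuous_on_subset[OF continuous_on_resolvent[OF T] res]] by blast
  have "has_curve_integral (\<lambda>w. resolvent T w x) (blinfun_apply I x) \<gamma>"
    by (rule has_curve_integral_linear[OF I]) (auto simp: scaleC_blinfun.rep_eq)
  moreover have "- (2 * of_real pi * \<i>) *\<^sub>C spectral_projection \<gamma> T x = blinfun_apply I x"
    by (simp add: spectral_projection_def curve_integral_eqI[OF I] scaleC_blinfun.rep_eq
        uminus_blinfun.rep_eq scaleC_scaleC scaleC_one)
  ultimately show ?thesis by simp
qed

text \<open>Used with \<open>S = T\<close> and with \<open>S\<close> a scalar multiplication.\<close>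

lemma spectral_projection_commutes_with:
  assumes S: "complex_linear S"
    and comm: "\<And>w. w \<in> path_image \<gamma> \<Longrightarrow> resolvent T w (S x) = S (resolvent T w x)"
  shows "spectral_projection \<gamma> T (S x) = S (spectral_projection \<gamma> T x)"
proof -
  have "has_curve_integral (\<lambda>w. S (resolvent T w x))
      (S (- (2 * of_real pi * \<i>) *\<^sub>C spectral_projection \<gamma> T x)) \<gamma>"
    by (rule has_curve_integral_linear[OF spectral_projection_integral])
      (use S in \<open>auto simp: complex_linear_def\<close>)
  then have "has_curve_integral (\<lambda>w. resolvent T w (S x))
      (S (- (2 * of_real pi * \<i>) *\<^sub>C spectral_projection \<gamma> T x)) \<gamma>"
    by (rule has_curve_integral_cong[rotated]) (simp add: comm)
  from curve_integral_eqI[OF this] curve_integral_eqI[OF spectral_projection_integral[of "S x"]]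
  have "- (2 * of_real pi * \<i>) *\<^sub>C spectral_projection \<gamma> T (S x) =
      - (2 * of_real pi * \<i>) *\<^sub>C S (spectral_projection \<gamma> T x)"
    using S unfolding complex_linear_def by metis
  then show ?thesis by (subst (asm) complex_vector.scale_cancel_left) simp
qed

lemma spectral_projection_commute: "spectral_projection \<gamma> T (T x) = T (spectral_projection \<gamma> T x)"
  by (rule spectral_projection_commutes_with[OF T]) (use res resolvent_commute[OF T] in auto)

lemma spectral_projection_scaleC:
  "spectral_projection \<gamma> T (c *\<^sub>C x) = c *\<^sub>C spectral_projection \<gamma> T x"
proof (rule spectral_projection_commutes_with)
  show "complex_linear (\<lambda>x :: 'a. c *\<^sub>C x)"
    by (simp add: complex_linear_def bounded_linear_scaleC_right scaleC_scaleC mult.commute)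
qed (use res resolvent_scaleC[OF T] in auto)

text \<open>An approximate eigenvector lies near the range of the spectral projection: the winding number is
  \<open>1\<close> at \<open>z\<close>, so integrating \<open>x / (w - z) + R(w) x = R(w) (T x - z x) / (w - z)\<close> along the curve gives
  \<open>2 \<pi> i (x - E x)\<close> on the left, while the right-hand side is bounded by the variation of the curve.\<close>

lemma spectral_projection_estimate:
  obtains C where "C \<ge> 0" "\<And>z d x. z \<in> inside (path_image \<gamma>) \<Longrightarrow> d > 0 \<Longrightarrow>
    (\<And>w. w \<in> path_image \<gamma> \<Longrightarrow> d \<le> cmod (w - z)) \<Longrightarrow>
    norm (x - spectral_projection \<gamma> T x) \<le> C / d * norm (T x - z *\<^sub>C x)"
proof -
  obtain M where M: "M > 0" "\<And>w. w \<in> path_image \<gamma> \<Longrightarrow> norm (resolvent T w) \<le> M"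
    using resolvent_bounded_on_curve by blast
  obtain L where L: "variation_le \<gamma> L"
    using curve_rectifiable(1) by (auto simp: rectifiable_path_def variation_le_def)
  show ?thesis
  proof (rule that[of "\<bar>L\<bar> * M"])
    fix z d x
    assume z: "z \<in> inside (path_image \<gamma>)" and d: "(d::real) > 0"
      and dist: "\<And>w. w \<in> path_image \<gamma> \<Longrightarrow> d \<le> cmod (w - z)"
    let ?E = "spectral_projection \<gamma> T" and ?c = "2 * of_real pi * \<i> :: complex"
    let ?y = "T x - z *\<^sub>C x"
    have zn: "z \<notin> path_image \<gamma>" using z by (auto simp: inside_def)
    have wn: "winding_number \<gamma> z = 1"
      using \<gamma> z by (simp add: simple_closed_rectifiable_pos_def)
    have "has_curve_integral (\<lambda>w. (1 / (w - z)) *\<^sub>C x + resolvent T w x) (?c *\<^sub>C x + - ?c *\<^sub>C ?E x) \<gamma>"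
      using has_curve_integral_add[OF has_curve_integral_Cauchy_kernel[OF curve_rectifiable(1) zn, of x]
          spectral_projection_integral[of x]] by (simp add: wn)
    also have "?c *\<^sub>C x + - ?c *\<^sub>C ?E x = ?c *\<^sub>C (x - ?E x)"
      by (simp add: scaleC_diff_right)
    finally have int: "has_curve_integral (\<lambda>w. (1 / (w - z)) *\<^sub>C resolvent T w ?y) (?c *\<^sub>C (x - ?E x)) \<gamma>"
    proof (rule has_curve_integral_cong[rotated])
      fix w assume w: "w \<in> path_image \<gamma>"
      then have wz: "w \<noteq> z" using zn by auto
      have rw: "w \<in> resolvent_set T" using res w by blast
      define R where "R = resolvent T w"
      have "?y = (T x - w *\<^sub>C x) + (w - z) *\<^sub>C x"
        by (simp add: complex_vector.scale_left_diff_distrib)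
      moreover have "R ((w - z) *\<^sub>C x) = (w - z) *\<^sub>C R x"
        unfolding R_def by (rule resolvent_scaleC[OF T rw])
      ultimately have "R ?y = x + (w - z) *\<^sub>C R x"
        using resolvent_inverse(2)[OF T rw, of x] by (metis R_def blinfun.add_right)
      then show "(1 / (w - z)) *\<^sub>C x + resolvent T w x = (1 / (w - z)) *\<^sub>C resolvent T w ?y"
        using wz by (simp add: R_def scaleC_add_right scaleC_scaleC scaleC_one)
    qed
    have "norm (?c *\<^sub>C (x - ?E x)) \<le> L * (M / d * norm ?y)"
    proof (rule has_curve_integral_bound[OF int L])
      fix w assume w: "w \<in> path_image \<gamma>"
      have "norm ((1 / (w - z)) *\<^sub>C resolvent T w ?y) = norm (resolvent T w ?y) / cmod (w - z)"
        by (simp add: norm_scaleC norm_divide)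
      also have "\<dots> \<le> (M * norm ?y) / d"
      proof (rule frac_le[OF _ _ d dist[OF w]])
        show "norm (resolvent T w ?y) \<le> M * norm ?y"
          by (rule order_trans[OF norm_blinfun]) (intro mult_right_mono M w norm_ge_zero)
      qed (use M in auto)
      finally show "norm ((1 / (w - z)) *\<^sub>C resolvent T w ?y) \<le> M / d * norm ?y" by simp
    qed
    also have "\<dots> \<le> \<bar>L\<bar> * (M / d * norm ?y)"
      using M d by (intro mult_right_mono) auto
    finally have "2 * pi * norm (x - ?E x) \<le> \<bar>L\<bar> * M / d * norm ?y"
      by (simp add: norm_scaleC norm_mult)
    moreover have "1 * norm (x - ?E x) \<le> 2 * pi * norm (x - ?E x)"
      using pi_gt3 by (intro mult_right_mono) auto
    ultimately show "norm (x - ?E x) \<le> \<bar>L\<bar> * M / d * norm ?y" by linarith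
  qed (use M in simp)
qed

end

section \<open>Integrals of essentially bounded functions\<close>

lemma AE_leb01_iff: "(AE t in leb01. P t) \<longleftrightarrow> (AE t in lebesgue. t \<in> {0..1} \<longrightarrow> P t)"
  by (subst AE_restrict_space_iff) auto

lemma AE_lebesgue_on_mono:
  assumes "AE t in lebesgue_on {c..d}. P t" "{a..b} \<subseteq> {c..d::real}"
  shows "AE t in lebesgue_on {a..b}. P t"
proof -
  have "AE t in lebesgue. t \<in> {c..d} \<longrightarrow> P t"
    using assms(1) by (subst (asm) AE_restrict_space_iff) auto
  then have "AE t in lebesgue. t \<in> {a..b} \<longrightarrow> P t"
  proof eventually_elim
    case (elim t)
    then show ?case using assms(2) by auto
  qed
  then show ?thesis by (subst AE_restrict_space_iff) auto
qed

lemma ess_bounded_mult: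
  assumes "ess_bounded f" "ess_bounded g"
  shows "ess_bounded (\<lambda>t. f t * g t)"
proof -
  obtain c d where "AE t in leb01. cmod (f t) \<le> c" "AE t in leb01. cmod (g t) \<le> d"
    using assms by (auto simp: ess_bounded_iff)
  then have "AE t in leb01. cmod (f t * g t) \<le> c * d"
  proof eventually_elim
    case (elim t)
    have "0 \<le> c" using norm_ge_zero elim(1) by (rule order_trans)
    then show ?case using elim by (simp add: norm_mult mult_mono)
  qed
  then show ?thesis
    using assms by (intro ess_boundedI) (auto simp: ess_bounded_def)
qed

lemma ess_bounded_diff: "ess_bounded f \<Longrightarrow> ess_bounded g \<Longrightarrow> ess_bounded (\<lambda>t. f t - g t)"
  using ess_bounded_add[of f "\<lambda>t. -1 * g t"] ess_bounded_cmult[of g "-1"] by simp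

lemma ess_bounded_cnj:
  assumes "ess_bounded f"
  shows "ess_bounded (\<lambda>t. cnj (f t))"
proof -
  have "(\<lambda>t. cnj (f t)) \<in> borel_measurable leb01"
    using assms by (intro measurable_compose[OF _ borel_measurable_continuous_onI[OF continuous_on_cnj]])
        (auto simp: ess_bounded_def intro: continuous_intros)
  moreover obtain c where "AE t in leb01. cmod (f t) \<le> c"
    using assms by (auto simp: ess_bounded_iff)
  ultimately show ?thesis by (intro ess_boundedI[where c = c]) auto
qed

lemma ess_bounded_continuous:
  assumes "continuous_on {0..1} f"
  shows "ess_bounded f"
proof -
  have "compact (f ` {0..1})" by (rule compact_continuous_image[OF assms compact_Icc])
  then obtain B where "\<And>t. t \<in> {0..1} \<Longrightarrow> cmod (f t) \<le> B"
    unfolding bounded_iff compact_eq_bounded_closed by fastforce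
  then have "AE t in leb01. cmod (f t) \<le> B" by (intro AE_I2) simp
  then show ?thesis
    by (rule ess_boundedI[rotated]) (rule continuous_imp_measurable_on_sets_lebesgue[OF assms], simp)
qed

lemma ess_bounded_integrable:
  assumes f: "ess_bounded f" and ab: "{a..b} \<subseteq> {0..1}"
  shows "integrable (lebesgue_on {a..b}) f"
proof -
  obtain c where "AE t in leb01. cmod (f t) \<le> c" using f by (auto simp: ess_bounded_iff)
  then have "AE t in lebesgue_on {a..b}. cmod (f t) \<le> c" by (rule AE_lebesgue_on_mono[OF _ ab])
  moreover have "f \<in> borel_measurable (lebesgue_on {a..b})"
    using f ab unfolding ess_bounded_def by (blast intro: measurable_restrict_mono)
  moreover have "finite_measure (lebesgue_on {a..b})" by (rule finite_measure_lebesgue_on) simp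
  ultimately show ?thesis by (rule finite_measure.integrable_const_bound[rotated 1])
qed

lemma ess_bounded_integrable_on:
  assumes "ess_bounded f" "{a..b} \<subseteq> {0..1}"
  shows "f integrable_on {a..b}"
  by (rule integrable_on_lebesgue_on[OF ess_bounded_integrable[OF assms]]) simp

lemma LINT_eq_integral:
  assumes "ess_bounded f" "{a..b} \<subseteq> {0..1}"
  shows "(LINT t|lebesgue_on {a..b}. f t) = integral {a..b} f"
  by (rule lebesgue_integral_eq_integral[OF ess_bounded_integrable[OF assms]]) simp

lemma ess_bounded_integral_cong:
  assumes f: "ess_bounded f" and g: "ess_bounded g" and ab: "{a..b} \<subseteq> {0..1}"
    and eq: "AE t in lebesgue_on {a..b}. f t = g t"
  shows "integral {a..b} f = integral {a..b} g"
proof -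
  have "(LINT t|lebesgue_on {a..b}. f t) = (LINT t|lebesgue_on {a..b}. g t)"
    using ess_bounded_integrable[OF f ab] ess_bounded_integrable[OF g ab] eq
    by (intro integral_cong_AE) auto
  then show ?thesis by (simp only: LINT_eq_integral[OF f ab] LINT_eq_integral[OF g ab])
qed

lemma ess_bounded_integral_bound:
  assumes f: "ess_bounded f" and ab: "{a..b} \<subseteq> {0..1}" "a \<le> b"
    and le: "AE t in lebesgue_on {a..b}. cmod (f t) \<le> c"
  shows "cmod (integral {a..b} f) \<le> c * (b - a)"
proof -
  have fin: "finite_measure (lebesgue_on {a..b})" by (rule finite_measure_lebesgue_on) simp
  have int: "integrable (lebesgue_on {a..b}) f" by (rule ess_bounded_integrable[OF f ab(1)])
  have "cmod (LINT t|lebesgue_on {a..b}. f t) \<le> (LINT t|lebesgue_on {a..b}. cmod (f t))"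
    by (rule integral_norm_bound)
  also have "\<dots> \<le> (LINT t|lebesgue_on {a..b}. c)"
    by (rule integral_mono_AE[OF integrable_norm[OF int] finite_measure.integrable_const[OF fin] le])
  also have "\<dots> = c * (b - a)"
    using ab(2) by (simp add: measure_restrict_space)
  finally show ?thesis by (simp only: LINT_eq_integral[OF f ab(1)])
qed

lemma integral_uniform_partition:
  fixes f :: "real \<Rightarrow> complex"
  assumes f: "f integrable_on {0..1}" and n: "n \<ge> (1::nat)"
  shows "integral {0..1} f = (\<Sum>j=1..n. integral {(real j - 1) / real n..real j / real n} f)"
proof -
  have "integral {0..real k / real n} f = (\<Sum>j=1..k. integral {(real j - 1) / real n..real j / real n} f)"
    if "k \<le> n" for k
    using that
  proof (induction k)
    case (Suc k)
    have le: "real k / real n \<le> real (Suc k) / real n" "real (Suc k) / real n \<le> 1"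
      using Suc n by (auto simp: divide_simps)
    have "f integrable_on {0..real (Suc k) / real n}"
      using le by (intro integrable_on_subinterval[OF f]) auto
    then have "integral {0..real k / real n} f + integral {real k / real n..real (Suc k) / real n} f =
        integral {0..real (Suc k) / real n} f"
      using le by (intro Henstock_Kurzweil_Integration.integral_combine) auto
    then show ?case using Suc by simp
  qed simp
  from this[of n] show ?thesis using n by simp
qed

section \<open>Orthogonal projection onto polynomials on one interval\<close>

definition poly_inner :: "real poly \<Rightarrow> real poly \<Rightarrow> real" where
  "poly_inner p q = integral {0..1} (\<lambda>x. poly p x * poly q x)"

lemma poly_integrable [simp, intro]:
  fixes p q :: "real poly"
  shows "(\<lambda>x. poly p x) integrable_on {a..b}" "(\<lambda>x. poly p x * poly q x) integrable_on {a..b}"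
  by (intro integrable_continuous_interval continuous_intros)+

lemma poly_inner_simps:
  "poly_inner (p + q) s = poly_inner p s + poly_inner q s"
  "poly_inner (p - q) s = poly_inner p s - poly_inner q s"
  "poly_inner (smult c p) s = c * poly_inner p s"
  "poly_inner 0 s = 0"
  by (simp_all add: poly_inner_def distrib_right left_diff_distrib
      Henstock_Kurzweil_Integration.integral_add Henstock_Kurzweil_Integration.integral_diff
      mult.assoc)

lemma poly_inner_commute: "poly_inner p q = poly_inner q p"
  by (simp add: poly_inner_def mult.commute)

lemma poly_inner_sum: "poly_inner (\<Sum>i\<in>I. f i) s = (\<Sum>i\<in>I. poly_inner (f i) s)"
  by (induction I rule: infinite_finite_induct) (simp_all add: poly_inner_simps)

lemma poly_inner_pos:
  assumes "p \<noteq> 0"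
  shows "poly_inner p p > 0"
proof -
  have ge: "poly_inner p p \<ge> 0"
    unfolding poly_inner_def by (rule integral_nonneg) auto
  have "poly_inner p p \<noteq> 0"
  proof
    assume "poly_inner p p = 0"
    then have "((\<lambda>x. poly p x * poly p x) has_integral 0) (cbox 0 1)"
      unfolding poly_inner_def using integrable_integral[OF poly_integrable(2)[of p p 0 1]]
      by simp
    then have "\<And>x. x \<in> {0..1} \<Longrightarrow> poly p x * poly p x = 0"
      by (intro has_integral_0_cbox_imp_0[of 0 1 "\<lambda>x. poly p x * poly p x"])
        (auto intro!: continuous_intros)
    then have "{0..1} \<subseteq> {x. poly p x = 0}" by auto
    moreover have "infinite {0..1::real}" by (simp add: infinite_Icc)
    ultimately show False using poly_roots_finite[OF assms] finite_subset by blast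
  qed
  then show ?thesis using ge by simp
qed

text \<open>Gram--Schmidt.  The induction carries the orthonormality along because the step needs it to see
  that the new polynomial is orthogonal to the old ones.\<close>

lemma orthonormal_polys:
  "\<exists>e :: nat \<Rightarrow> real poly. (\<forall>i\<le>m. degree (e i) \<le> m) \<and>
     (\<forall>i\<le>m. \<forall>j\<le>m. poly_inner (e i) (e j) = (if i = j then 1 else 0)) \<and>
     (\<forall>p. degree p \<le> m \<longrightarrow> p = (\<Sum>i\<le>m. smult (poly_inner p (e i)) (e i)))"
proof (induction m)
  case 0
  have "p = smult (poly_inner p 1) 1" if dp: "degree p = 0" for p
  proof -
    obtain c where "p = [:c:]" by (rule degree_eq_zeroE[OF dp])
    then show ?thesis by (simp add: poly_inner_def one_pCons)
  qed
  then show ?case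
    by (intro exI[of _ "\<lambda>_. 1"]) (auto simp: poly_inner_def)
next
  case (Suc m)
  then obtain e where e: "\<And>i. i \<le> m \<Longrightarrow> degree (e i) \<le> m"
      "\<And>i j. i \<le> m \<Longrightarrow> j \<le> m \<Longrightarrow> poly_inner (e i) (e j) = (if i = j then 1 else 0)"
      "\<And>p. degree p \<le> m \<Longrightarrow> p = (\<Sum>i\<le>m. smult (poly_inner p (e i)) (e i))"
    by blast
  define x where "x = monom (1::real) (Suc m)"
  define s where "s = (\<Sum>i\<le>m. smult (poly_inner x (e i)) (e i))"
  define q where "q = x - s"
  have ds: "degree s \<le> m"
    unfolding s_def using e(1) by (intro degree_sum_le) (auto intro: order_trans[OF degree_smult_le])
  have cq: "coeff q (Suc m) = 1"
    using ds by (simp add: q_def x_def coeff_eq_0)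
  then have q0: "q \<noteq> 0" by auto
  have dq: "degree q \<le> Suc m"
    unfolding q_def x_def using ds degree_monom_le[of "1::real" "Suc m"] by (intro degree_diff_le) auto
  have orth: "poly_inner q (e i) = 0" if "i \<le> m" for i
  proof -
    have "poly_inner s (e i) = (\<Sum>j\<le>m. if j = i then poly_inner x (e i) else 0)"
      unfolding s_def poly_inner_sum using e(2) that
      by (intro sum.cong) (auto simp: poly_inner_simps)
    then show ?thesis using that by (simp add: q_def poly_inner_simps)
  qed
  then have orth': "poly_inner (e i) q = 0" if "i \<le> m" for i
    using that by (simp add: poly_inner_commute[of "e i"])
  define N where "N = poly_inner q q"
  have N: "N > 0" unfolding N_def by (rule poly_inner_pos[OF q0])
  define e' where "e' = e(Suc m := smult (1 / sqrt N) q)"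
  have e'm: "e' i = e i" if "i \<le> m" for i using that by (simp add: e'_def)
  have e'S: "e' (Suc m) = smult (1 / sqrt N) q" by (simp add: e'_def)
  have 1: "degree (e' i) \<le> Suc m" if "i \<le> Suc m" for i
    using e(1)[of i] dq that by (cases "i = Suc m") (auto simp: e'_def)
  have 2: "poly_inner (e' i) (e' j) = (if i = j then 1 else 0)" if "i \<le> Suc m" "j \<le> Suc m" for i j
  proof -
    have NN: "poly_inner (e' (Suc m)) (e' (Suc m)) = 1"
    proof -
      have "poly_inner (smult (1 / sqrt N) q) (smult (1 / sqrt N) q) = (1 / sqrt N) * ((1 / sqrt N) * N)"
        by (simp only: poly_inner_simps poly_inner_commute[of q "smult _ _"] N_def[symmetric])
      also have "\<dots> = 1" using N by (simp add: field_simps)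
      finally show ?thesis by (simp add: e'S)
    qed
    have z: "poly_inner (e' (Suc m)) (e' k) = 0" "poly_inner (e' k) (e' (Suc m)) = 0" if "k \<le> m" for k
      using orth[OF that] by (simp_all add: e'S e'm[OF that] poly_inner_simps poly_inner_commute[of "e k"])
    show ?thesis
      using that NN z e(2)[of i j] e'm by (cases "i = Suc m"; cases "j = Suc m") (auto simp: le_Suc_eq)
  qed
  have 3: "p = (\<Sum>i\<le>Suc m. smult (poly_inner p (e' i)) (e' i))" if dp: "degree p \<le> Suc m" for p
  proof -
    define c where "c = coeff p (Suc m)"
    \<comment> \<open>\<open>q\<close> is monic of degree \<open>Suc m\<close>, so this lowers the degree\<close>
    define p' where "p' = p - smult c q"
    have "degree p' \<le> m"
    proof (rule degree_le, intro allI impI)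
      fix i assume "m < i"
      then consider "i = Suc m" | "Suc m < i" by linarith
      then show "coeff p' i = 0"
        using cq dp dq by cases (auto simp: p'_def c_def coeff_eq_0)
    qed
    then have p': "p' = (\<Sum>i\<le>m. smult (poly_inner p' (e i)) (e i))" by (rule e(3))
    have pe: "poly_inner p (e i) = poly_inner p' (e i)" if "i \<le> m" for i
      using that by (simp add: p'_def poly_inner_simps orth)
    have "poly_inner p' q = 0"
      by (subst p') (simp add: poly_inner_sum poly_inner_simps orth')
    then have "poly_inner p q = c * N"
      by (simp add: p'_def poly_inner_simps N_def)
    then have "poly_inner p (e' (Suc m)) = c * N / sqrt N"
      by (simp add: e'S poly_inner_commute[of p] poly_inner_simps)
    then have "smult (poly_inner p (e' (Suc m))) (e' (Suc m)) = smult c q"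
      using N by (simp add: e'S)
    moreover have "(\<Sum>i\<le>m. smult (poly_inner p (e' i)) (e' i)) = p'"
      by (subst p') (auto intro!: sum.cong simp: pe e'm)
    ultimately show ?thesis by (simp add: p'_def)
  qed
  show ?case using 1 2 3 by (intro exI[of _ e']) blast
qed

abbreviation cpoly :: "real poly \<Rightarrow> complex poly" where
  "cpoly \<equiv> map_poly of_real"

lemma poly_cpoly: "poly (cpoly p) (of_real t) = of_real (poly p t)"
  by (induction p) (simp_all add: map_poly_pCons)

lemma continuous_on_cpoly: "continuous_on S (\<lambda>t::real. poly p (complex_of_real t))"
  by (intro continuous_intros)

lemma ess_bounded_poly: "ess_bounded (\<lambda>t. poly p (complex_of_real t))"
  by (rule ess_bounded_continuous[OF continuous_on_cpoly])

text \<open>The orthonormal basis of the unit interval, transplanted to an arbitrary interval by an affine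
  map.  The map does not change the supremum \<open>B\<close> of the basis functions; this is what makes
  the projections bounded uniformly in the cell size.  The basis is real, but it reproduces complex
  polynomials, by linearity in their coefficients.\<close>

lemma reproducing_polys:
  "\<exists>B\<ge>0. \<forall>a b. a < b \<longrightarrow> (\<exists>w :: nat \<Rightarrow> real poly.
     (\<forall>i\<le>m. degree (w i) \<le> m \<and> (\<forall>t\<in>{a..b}. \<bar>poly (w i) t\<bar> \<le> B)) \<and>
     (\<forall>p :: complex poly. degree p \<le> m \<longrightarrow> (\<forall>t. poly p (of_real t) =
        (\<Sum>i\<le>m. of_real (1 / (b - a)) *
          integral {a..b} (\<lambda>u. poly p (of_real u) * of_real (poly (w i) u)) *
          of_real (poly (w i) t)))))"
proof -
  obtain e :: "nat \<Rightarrow> real poly" where e: "\<And>i. i \<le> m \<Longrightarrow> degree (e i) \<le> m"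
      "\<And>p. degree p \<le> m \<Longrightarrow> p = (\<Sum>i\<le>m. smult (poly_inner p (e i)) (e i))"
    using orthonormal_polys[of m] by blast
  have "\<forall>i. \<exists>B. \<forall>x\<in>{0..1}. \<bar>poly (e i) x\<bar> \<le> B"
  proof
    fix i
    have "compact (poly (e i) ` {0..1})"
      by (intro compact_continuous_image continuous_intros compact_Icc)
    then show "\<exists>B. \<forall>x\<in>{0..1}. \<bar>poly (e i) x\<bar> \<le> B"
      unfolding compact_eq_bounded_closed bounded_iff by auto
  qed
  then obtain B' where B': "\<And>i x. x \<in> {0..1} \<Longrightarrow> \<bar>poly (e i) x\<bar> \<le> B' i" by metis
  define B where "B = (\<Sum>i\<le>m. \<bar>B' i\<bar>)"
  have B: "\<bar>poly (e i) x\<bar> \<le> B" if "i \<le> m" "x \<in> {0..1}" for i x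
  proof -
    have "\<bar>poly (e i) x\<bar> \<le> \<bar>B' i\<bar>" using B'[OF that(2), of i] by linarith
    also have "\<dots> \<le> B" unfolding B_def using that by (intro member_le_sum) auto
    finally show ?thesis .
  qed
  have "\<exists>w :: nat \<Rightarrow> real poly.
     (\<forall>i\<le>m. degree (w i) \<le> m \<and> (\<forall>t\<in>{a..b}. \<bar>poly (w i) t\<bar> \<le> B)) \<and>
     (\<forall>p :: complex poly. degree p \<le> m \<longrightarrow> (\<forall>t. poly p (of_real t) =
        (\<Sum>i\<le>m. of_real (1 / (b - a)) *
          integral {a..b} (\<lambda>u. poly p (of_real u) * of_real (poly (w i) u)) *
          of_real (poly (w i) t))))" if "a < b" for a b :: real
  proof -
    define l where "l = [:- a / (b - a), 1 / (b - a):]"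
    define l' where "l' = [:a, b - a:]"
    define w where "w i = pcompose (e i) l" for i
    have pw: "poly (w i) t = poly (e i) ((t - a) / (b - a))" for i t
      by (simp add: w_def l_def poly_pcompose diff_divide_distrib add.commute)
    have "degree (w i) \<le> m \<and> (\<forall>t\<in>{a..b}. \<bar>poly (w i) t\<bar> \<le> B)" if i: "i \<le> m" for i
    proof
      have "degree l \<le> 1" by (simp add: l_def)
      then show "degree (w i) \<le> m"
        unfolding w_def by (metis degree_pcompose_le e(1)[OF i] mult.right_neutral mult_le_mono order_trans)
      show "\<forall>t\<in>{a..b}. \<bar>poly (w i) t\<bar> \<le> B"
        using \<open>a < b\<close> by (auto simp: pw intro!: B[OF i])
    qed
    moreover have real: "poly q t = (\<Sum>i\<le>m. (1 / (b - a)) *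
        integral {a..b} (\<lambda>u. poly q u * poly (w i) u) * poly (w i) t)"
      if q: "degree q \<le> m" for q t
    proof -
      define q' where "q' = pcompose q l'"
      have "degree q' \<le> m"
        using q \<open>a < b\<close> by (simp add: q'_def l'_def degree_pcompose)
      note dq' = this
      have inner: "poly_inner q' (e i) = (1 / (b - a)) * integral {a..b} (\<lambda>u. poly q u * poly (w i) u)" for i
      proof -
        let ?f = "\<lambda>v. poly q' v * poly (e i) v"
        have ends: "(0 - - a / (b - a)) /\<^sub>R (1 / (b - a)) = a" "(1 - - a / (b - a)) /\<^sub>R (1 / (b - a)) = b"
          using \<open>a < b\<close> by (simp_all add: divide_simps)
        have "(?f has_integral poly_inner q' (e i)) (cbox 0 1)"
          unfolding poly_inner_def using integrable_integral[OF poly_integrable(2)[of q' "e i" 0 1]] by simp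
        from has_integral_affinity'[OF this, of "1 / (b - a)" "- a / (b - a)"]
        have "((\<lambda>u. ?f ((1 / (b - a)) *\<^sub>R u + - a / (b - a))) has_integral poly_inner q' (e i) /\<^sub>R (1 / (b - a))) {a..b}"
          unfolding ends using \<open>a < b\<close> by simp
        moreover have "?f ((1 / (b - a)) *\<^sub>R u + - a / (b - a)) = poly q u * poly (w i) u" for u
        proof -
          have "(1 / (b - a)) *\<^sub>R u + - a / (b - a) = (u - a) / (b - a)"
            by (simp add: diff_divide_distrib)
          then show ?thesis using \<open>a < b\<close> by (simp add: q'_def l'_def poly_pcompose pw)
        qed
        ultimately have "integral {a..b} (\<lambda>u. poly q u * poly (w i) u) = poly_inner q' (e i) /\<^sub>R (1 / (b - a))"
          by (simp only: integral_unique)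
        then show ?thesis using \<open>a < b\<close> by simp
      qed
      have "poly q t = poly q' ((t - a) / (b - a))"
        using \<open>a < b\<close> by (simp add: q'_def l'_def poly_pcompose)
      also have "\<dots> = poly (\<Sum>i\<le>m. smult (poly_inner q' (e i)) (e i)) ((t - a) / (b - a))"
        by (rule arg_cong[of q' _ "\<lambda>p. poly p ((t - a) / (b - a))", OF e(2)[OF dq']])
      also have "\<dots> = (\<Sum>i\<le>m. poly_inner q' (e i) * poly (w i) t)"
        by (simp only: poly_sum poly_smult pw)
      finally show ?thesis by (simp only: inner)
    qed
    moreover have "poly p (of_real t) =
        (\<Sum>i\<le>m. of_real (1 / (b - a)) *
          integral {a..b} (\<lambda>u. poly p (of_real u) * of_real (poly (w i) u)) *
          of_real (poly (w i) t))" if p: "degree p \<le> m" for p :: "complex poly" and t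
    proof -
      let ?I = "\<lambda>k i. integral {a..b} (\<lambda>u. u ^ k * poly (w i) u)"
      have mono: "t ^ k = (\<Sum>i\<le>m. (1 / (b - a)) * ?I k i * poly (w i) t)" if "k \<le> m" for k
      proof -
        have "degree (monom (1::real) k) \<le> m" using that by (simp add: degree_monom_eq)
        from real[OF this, of t] show ?thesis by (simp only: poly_monom mult_1)
      qed
      have int: "integral {a..b} (\<lambda>u. poly p (of_real u) * of_real (poly (w i) u)) =
          (\<Sum>k\<le>degree p. coeff p k * of_real (?I k i))" for i
      proof -
        have "((\<lambda>u. \<Sum>k\<le>degree p. coeff p k * complex_of_real (u ^ k * poly (w i) u)) has_integral
            (\<Sum>k\<le>degree p. coeff p k * of_real (?I k i))) {a..b}"
          by (intro has_integral_sum finite_atMost has_integral_mult_right has_integral_of_real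
              integrable_integral integrable_continuous_interval continuous_intros)
        moreover have "(\<Sum>k\<le>degree p. coeff p k * complex_of_real (u ^ k * poly (w i) u)) =
            poly p (of_real u) * of_real (poly (w i) u)" for u
          by (simp add: poly_altdef sum_distrib_right mult.assoc)
        ultimately show ?thesis by (simp add: integral_unique)
      qed
      have "poly p (of_real t) = (\<Sum>k\<le>degree p. coeff p k * of_real (t ^ k))"
        by (simp add: poly_altdef)
      also have "\<dots> = (\<Sum>k\<le>degree p. coeff p k *
          of_real (\<Sum>i\<le>m. (1 / (b - a)) * ?I k i * poly (w i) t))"
      proof (rule sum.cong[OF refl])
        fix k assume "k \<in> {..degree p}"
        then have "k \<le> m" using p by simp
        from mono[OF this]
        show "coeff p k * of_real (t ^ k) =
            coeff p k * of_real (\<Sum>i\<le>m. (1 / (b - a)) * ?I k i * poly (w i) t)"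
          by (rule arg_cong)
      qed
      also have "\<dots> = (\<Sum>k\<le>degree p. \<Sum>i\<le>m. of_real (1 / (b - a)) * (coeff p k * of_real (?I k i)) *
          of_real (poly (w i) t))"
      proof (rule sum.cong[OF refl])
        fix k
        have "coeff p k * of_real ((1 / (b - a)) * ?I k i * poly (w i) t) =
            of_real (1 / (b - a)) * (coeff p k * of_real (?I k i)) * of_real (poly (w i) t)" for i
          unfolding of_real_mult by (simp only: mult_ac)
        then show "coeff p k * of_real (\<Sum>i\<le>m. (1 / (b - a)) * ?I k i * poly (w i) t) =
            (\<Sum>i\<le>m. of_real (1 / (b - a)) * (coeff p k * of_real (?I k i)) * of_real (poly (w i) t))"
          by (simp only: of_real_sum sum_distrib_left)
      qed
      also have "\<dots> = (\<Sum>i\<le>m. \<Sum>k\<le>degree p. of_real (1 / (b - a)) * (coeff p k * of_real (?I k i)) *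
          of_real (poly (w i) t))"
        by (rule sum.swap)
      also have "\<dots> = (\<Sum>i\<le>m. of_real (1 / (b - a)) *
          integral {a..b} (\<lambda>u. poly p (of_real u) * of_real (poly (w i) u)) * of_real (poly (w i) t))"
        by (simp only: int sum_distrib_left sum_distrib_right)
      finally show ?thesis .
    qed
    ultimately show ?thesis by (intro exI[of _ w]) blast
  qed
  moreover have "B \<ge> 0" by (simp add: B_def sum_nonneg)
  ultimately show ?thesis by blast
qed

text \<open>The last clause says that \<open>Q\<close> is within a factor of \<open>C + 1\<close> of the best uniform approximation
  of \<open>f\<close> on the interval.\<close>

definition local_proj ::
  "nat \<Rightarrow> real \<Rightarrow> real \<Rightarrow> real \<Rightarrow> (real \<Rightarrow> complex) \<Rightarrow> complex poly \<Rightarrow> bool" where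
  "local_proj m C a b f Q \<longleftrightarrow> degree Q \<le> m \<and>
     (\<forall>p. degree p \<le> m \<longrightarrow>
        integral {a..b} (\<lambda>t. (f t - poly Q (of_real t)) * poly p (of_real t)) = 0) \<and>
     (\<forall>p c. degree p \<le> m \<longrightarrow>
        (AE t in lebesgue_on {a..b}. cmod (f t - poly p (of_real t)) \<le> c) \<longrightarrow> 0 \<le> c \<longrightarrow>
        (\<forall>t\<in>{a..b}. cmod (poly p (of_real t) - poly Q (of_real t)) \<le> C * c))"

text \<open>The projection is the integral operator with kernel \<open>(b - a)\<^sup>-\<^sup>1 \<Sum> w\<^sub>i(u) w\<^sub>i(t)\<close>.
  It reproduces polynomials, so \<open>p - Q\<close> is the projection of \<open>p - f\<close>; the factor \<open>(b - a)\<^sup>-\<^sup>1\<close> cancels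
  against the length of the interval.\<close>

lemma local_projection:
  "\<exists>C\<ge>0. \<forall>a b f. a < b \<longrightarrow> {a..b} \<subseteq> {0..1} \<longrightarrow> ess_bounded f \<longrightarrow>
     (\<exists>Q. local_proj m C a b f Q)"
proof -
  obtain B where B0: "B \<ge> 0" and B: "\<And>a b. a < b \<Longrightarrow> (\<exists>w :: nat \<Rightarrow> real poly.
     (\<forall>i\<le>m. degree (w i) \<le> m \<and> (\<forall>t\<in>{a..b}. \<bar>poly (w i) t\<bar> \<le> B)) \<and>
     (\<forall>p :: complex poly. degree p \<le> m \<longrightarrow> (\<forall>t. poly p (of_real t) =
        (\<Sum>i\<le>m. of_real (1 / (b - a)) *
          integral {a..b} (\<lambda>u. poly p (of_real u) * of_real (poly (w i) u)) *
          of_real (poly (w i) t)))))"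
    using reproducing_polys[of m] by blast
  define C where "C = real (Suc m) * (B * B)"
  have "\<exists>Q. local_proj m C a b f Q"
    if ab: "a < b" "{a..b} \<subseteq> {0..1}" and f: "ess_bounded f" for a b :: real and f :: "real \<Rightarrow> complex"
  proof -
    obtain w where w: "\<And>i. i \<le> m \<Longrightarrow> degree (w i) \<le> m"
        "\<And>i t. i \<le> m \<Longrightarrow> t \<in> {a..b} \<Longrightarrow> \<bar>poly (w i) t\<bar> \<le> B"
      and rep: "\<And>(p :: complex poly) t. degree p \<le> m \<Longrightarrow> poly p (of_real t) =
        (\<Sum>i\<le>m. of_real (1 / (b - a)) *
          integral {a..b} (\<lambda>u. poly p (of_real u) * of_real (poly (w i) u)) *
          of_real (poly (w i) t))"
      using B[OF ab(1)] by blast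
    define L where "L g i = integral {a..b} (\<lambda>u. g u * of_real (poly (w i) u))" for g :: "real \<Rightarrow> complex" and i
    define k where "k = complex_of_real (1 / (b - a))"
    have ebw: "ess_bounded (\<lambda>u. complex_of_real (poly (w i) u))" for i
      using ess_bounded_poly[of "cpoly (w i)"] by (simp add: poly_cpoly)
    have ib: "(\<lambda>u. g u * h u) integrable_on {a..b}" if "ess_bounded g" "ess_bounded h" for g h
      by (rule ess_bounded_integrable_on[OF ess_bounded_mult[OF that] ab(2)])
    have isum: "integral {a..b} (\<lambda>t. \<Sum>i\<le>m. c i * (g t * of_real (poly (w i) t))) = (\<Sum>i\<le>m. c i * L g i)"
      if g: "ess_bounded g" for g c
      unfolding L_def
      by (intro integral_unique has_integral_sum finite_atMost has_integral_mult_right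
          integrable_integral ib g ebw)
    define Q where "Q = (\<Sum>i\<le>m. smult (k * L f i) (cpoly (w i)))"
    have Q: "poly Q (of_real t) = (\<Sum>i\<le>m. k * L f i * of_real (poly (w i) t))" for t
      by (simp add: Q_def poly_sum poly_cpoly)
    have rep': "poly p (of_real t) = (\<Sum>i\<le>m. k * L (\<lambda>u. poly p (of_real u)) i * of_real (poly (w i) t))"
      if "degree p \<le> m" for p t
      unfolding L_def k_def by (rule rep[OF that])
    have "degree Q \<le> m"
      unfolding Q_def
    proof (rule degree_sum_le)
      show "degree (smult (k * L f i) (cpoly (w i))) \<le> m" if "i \<in> {..m}" for i
        using that w(1)[of i] by (intro order_trans[OF degree_smult_le]) (simp add: degree_map_poly)
    qed simp
    moreover have "integral {a..b} (\<lambda>t. (f t - poly Q (of_real t)) * poly p (of_real t)) = 0"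
      if p: "degree p \<le> m" for p
    proof -
      let ?p = "\<lambda>t. poly p (of_real t) :: complex"
      have "integral {a..b} (\<lambda>t. f t * ?p t) =
          integral {a..b} (\<lambda>t. \<Sum>i\<le>m. k * L ?p i * (f t * of_real (poly (w i) t)))"
        by (subst rep'[OF p]) (simp add: sum_distrib_left mult_ac)
      also have "\<dots> = (\<Sum>i\<le>m. k * L ?p i * L f i)"
        by (rule isum[OF f])
      also have "\<dots> = (\<Sum>i\<le>m. k * L f i * L ?p i)"
        by (simp add: mult_ac)
      also have "\<dots> = integral {a..b} (\<lambda>t. \<Sum>i\<le>m. k * L f i * (?p t * of_real (poly (w i) t)))"
        by (rule isum[OF ess_bounded_poly, symmetric])
      also have "\<dots> = integral {a..b} (\<lambda>t. poly Q (of_real t) * ?p t)"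
        by (simp add: Q sum_distrib_left sum_distrib_right mult_ac)
      finally show ?thesis
        by (simp add: left_diff_distrib Henstock_Kurzweil_Integration.integral_diff
            ib f ess_bounded_poly)
    qed
    moreover have "cmod (poly p (of_real t) - poly Q (of_real t)) \<le> C * c"
      if p: "degree p \<le> m" and t: "t \<in> {a..b}" and c: "0 \<le> c"
        and close: "AE t in lebesgue_on {a..b}. cmod (f t - poly p (of_real t)) \<le> c" for p c t
    proof -
      let ?p = "\<lambda>t. poly p (of_real t) :: complex"
      have Ld: "L ?p i - L f i = L (\<lambda>u. ?p u - f u) i" for i
        unfolding L_def
        by (simp add: left_diff_distrib Henstock_Kurzweil_Integration.integral_diff
            ib f ess_bounded_poly ebw)
      have Lb: "cmod (k * L (\<lambda>u. ?p u - f u) i) \<le> B * c" if i: "i \<le> m" for i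
      proof -
        have "AE u in lebesgue_on {a..b}. cmod ((?p u - f u) * of_real (poly (w i) u)) \<le> B * c"
          using close AE_space[of "lebesgue_on {a..b}"]
        proof eventually_elim
          case (elim u)
          then show ?case
            using mult_mono[OF elim(1) w(2)[OF i, of u]] c
            by (simp add: norm_mult norm_minus_commute mult.commute)
        qed
        then have "cmod (L (\<lambda>u. ?p u - f u) i) \<le> B * c * (b - a)"
          unfolding L_def using ab f
          by (intro ess_bounded_integral_bound ess_bounded_mult ess_bounded_diff ess_bounded_poly ebw) auto
        then show ?thesis using ab(1)
          by (simp add: k_def norm_mult norm_divide divide_simps del: of_real_diff of_real_divide)
      qed
      have "?p t - poly Q (of_real t) = (\<Sum>i\<le>m. k * L (\<lambda>u. ?p u - f u) i * of_real (poly (w i) t))"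
        unfolding rep'[OF p, of t] Q
        by (simp add: sum_subtractf[symmetric] Ld[symmetric] algebra_simps)
      also have "cmod \<dots> \<le> (\<Sum>i\<le>m. B * c * B)"
      proof (rule sum_norm_le)
        fix i assume "i \<in> {..m}"
        then have "i \<le> m" by simp
        from mult_mono[OF Lb[OF this] w(2)[OF this t]] B0 c
        show "cmod (k * L (\<lambda>u. ?p u - f u) i * of_real (poly (w i) t)) \<le> B * c * B"
          by (simp only: norm_mult[of "k * _"] norm_of_real) simp
      qed
      also have "\<dots> = C * c" by (simp add: C_def)
      finally show ?thesis .
    qed
    ultimately show ?thesis unfolding local_proj_def by (intro exI[of _ Q]) blast
  qed
  moreover have "C \<ge> 0" using B0 by (simp add: C_def)
  ultimately show ?thesis by blast
qed

section \<open>The Galerkin projection\<close>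

abbreviation cell :: "nat \<Rightarrow> nat \<Rightarrow> real set" where
  "cell n j \<equiv> {(real j - 1) / real n..real j / real n}"

lemma cell_subset: "1 \<le> n \<Longrightarrow> j \<in> {1..n} \<Longrightarrow> cell n j \<subseteq> {0..1}"
  by (auto simp: divide_simps)

lemma cell_length: "real j / real n - (real j - 1) / real n = 1 / real n"
  by (simp add: diff_divide_distrib)

lemma AE_cellsI:
  assumes n: "1 \<le> n" and AE: "\<And>j. j \<in> {1..n} \<Longrightarrow> AE t in lebesgue_on (cell n j). P t"
  shows "AE t in leb01. P t"
proof -
  have "AE t in lebesgue. \<forall>j\<in>{1..n}. t \<in> cell n j \<longrightarrow> P t"
  proof (rule AE_finite_allI)
    show "AE t in lebesgue. t \<in> cell n j \<longrightarrow> P t" if "j \<in> {1..n}" for j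
      using AE[OF that] by (subst (asm) AE_restrict_space_iff) auto
  qed simp
  then have "AE t in lebesgue. t \<in> {0..1} \<longrightarrow> P t"
  proof eventually_elim
    case (elim t)
    show ?case
    proof
      assume t: "t \<in> {0..1}"
      define j where "j = max 1 (nat \<lceil>real n * t\<rceil>)"
      have nt: "0 \<le> real n * t" "real n * t \<le> real n"
        using t n by (auto simp: mult_left_le)
      have "\<lceil>real n * t\<rceil> \<le> int n" using nt(2) by (simp add: ceiling_le_iff)
      then have j: "j \<in> {1..n}" using n t by (auto simp: j_def)
      have "real j - 1 \<le> real n * t" "real n * t \<le> real j"
        using nt by (auto simp: j_def max_def split: if_splits) linarith+
      then have "t \<in> cell n j" using n by (auto simp: field_simps)
      then show "P t" using elim j by blast
    qed
  qed
  then show ?thesis by (simp add: AE_leb01_iff)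
qed

text \<open>Half-open cells make the pieces disjoint; they cover the unit interval up to the null set \<open>{0}\<close>.\<close>

definition glue :: "nat \<Rightarrow> (nat \<Rightarrow> complex poly) \<Rightarrow> real \<Rightarrow> complex" where
  "glue n Q t = (\<Sum>j=1..n. indicator {(real j - 1) / real n<..real j / real n} t * poly (Q j) (of_real t))"

lemma ess_bounded_glue: "ess_bounded (glue n Q)"
proof -
  have ind: "ess_bounded (indicator A)" if "A \<in> sets borel" for A :: "real set"
  proof (rule ess_boundedI[where c = 1])
    have "(indicator A :: real \<Rightarrow> complex) \<in> borel_measurable lebesgue"
      using that by (intro borel_measurable_indicator) (auto)
    then show "(indicator A :: real \<Rightarrow> complex) \<in> borel_measurable leb01"
      by (rule measurable_restrict_space1)
  qed (auto simp: indicator_def)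
  have sum: "ess_bounded (\<lambda>t. \<Sum>j\<in>J. g j t)" if "\<And>j. ess_bounded (g j)" for J :: "nat set" and g
    by (induction J rule: infinite_finite_induct) (auto intro!: ess_bounded_add ess_bounded_zero that)
  show ?thesis
    unfolding glue_def[abs_def] by (intro sum ess_bounded_mult ind ess_bounded_poly) auto
qed

lemma glue_on_cell:
  assumes n: "1 \<le> n" and j: "j \<in> {1..n}"
  shows "AE t in lebesgue_on (cell n j). glue n Q t = poly (Q j) (of_real t)"
proof -
  have "AE t in lebesgue. t \<noteq> (real j - 1) / real n"
    by (rule AE_I'[of "{(real j - 1) / real n}"]) auto
  then have "AE t in lebesgue. t \<in> cell n j \<longrightarrow> glue n Q t = poly (Q j) (of_real t)"
  proof eventually_elim
    case (elim t)
    show ?case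
    proof
      assume "t \<in> cell n j"
      then have t: "t \<in> {(real j - 1) / real n<..real j / real n}" using elim by auto
      have ne: "t \<notin> {(real i - 1) / real n<..real i / real n}" if "i \<noteq> j" for i
      proof
        assume "t \<in> {(real i - 1) / real n<..real i / real n}"
        then have "real i - 1 < real n * t" "real n * t \<le> real i"
            "real j - 1 < real n * t" "real n * t \<le> real j"
          using t n by (auto simp: field_simps)
        then have "i = j" by linarith
        then show False using that by simp
      qed
      have "glue n Q t = (\<Sum>i=1..n. if i = j then poly (Q j) (of_real t) else 0)"
        unfolding glue_def using t ne by (intro sum.cong) (auto simp: indicator_def)
      then show "glue n Q t = poly (Q j) (of_real t)" using j by simp
    qed
  qed
  then show ?thesis by (subst AE_restrict_space_iff) auto
qed

lemma abs_rep_linf: "abs_linf (rep_linf x) = x"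
  by (rule Quotient3_abs_rep[OF Quotient3_linf])

lemma pw_poly_iff:
  "x \<in> pw_poly r n \<longleftrightarrow> (\<forall>j\<in>{1..n}. \<exists>p. degree p \<le> 2 * r \<and>
     (AE t in lebesgue_on (cell n j). rep_linf x t = poly p (complex_of_real t)))"
  by (simp add: pw_poly_def)

lemma pw_polyE:
  assumes "x \<in> pw_poly r n" "j \<in> {1..n}"
  obtains p where "degree p \<le> 2 * r"
    "AE t in lebesgue_on (cell n j). rep_linf x t = poly p (complex_of_real t)"
  using bspec[OF assms(1)[unfolded pw_poly_iff] assms(2)] by blast

lemma pw_poly_diff:
  assumes n: "1 \<le> n" and x: "x \<in> pw_poly r n" and y: "y \<in> pw_poly r n"
  shows "x - y \<in> pw_poly r n"
  unfolding pw_poly_iff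
proof
  fix j assume j: "j \<in> {1..n}"
  obtain p where p: "degree p \<le> 2 * r"
      "AE t in lebesgue_on (cell n j). rep_linf x t = poly p (complex_of_real t)"
    by (rule pw_polyE[OF x j])
  obtain q where q: "degree q \<le> 2 * r"
      "AE t in lebesgue_on (cell n j). rep_linf y t = poly q (complex_of_real t)"
    by (rule pw_polyE[OF y j])
  have "AE t in lebesgue_on (cell n j). rep_linf (x - y) t = rep_linf x t - rep_linf y t"
    by (rule AE_lebesgue_on_mono[OF rep_linf_minus cell_subset[OF n j]])
  then have "AE t in lebesgue_on (cell n j). rep_linf (x - y) t = poly (p - q) (complex_of_real t)"
    using p(2) q(2) by eventually_elim simp
  moreover have "degree (p - q) \<le> 2 * r" using p(1) q(1) by (rule degree_diff_le)
  ultimately show "\<exists>p. degree p \<le> 2 * r \<and>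
      (AE t in lebesgue_on (cell n j). rep_linf (x - y) t = poly p (complex_of_real t))" by blast
qed

lemma L2_inner_cells:
  assumes n: "1 \<le> n"
  shows "L2_inner y q = (\<Sum>j=1..n. integral (cell n j) (\<lambda>t. rep_linf y t * cnj (rep_linf q t)))"
proof -
  have eb: "ess_bounded (\<lambda>t. rep_linf y t * cnj (rep_linf q t))"
    by (rule ess_bounded_mult[OF ess_bounded_rep ess_bounded_cnj[OF ess_bounded_rep]])
  show ?thesis
    unfolding L2_inner_def LINT_eq_integral[OF eb order_refl]
    by (rule integral_uniform_partition[OF ess_bounded_integrable_on[OF eb order_refl] n])
qed

lemma L2_inner_diff: "L2_inner (x - y) q = L2_inner x q - L2_inner y q"
proof -
  have int: "integrable leb01 (\<lambda>t. rep_linf z t * cnj (rep_linf q t))" for z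
    by (rule ess_bounded_integrable[OF ess_bounded_mult[OF ess_bounded_rep ess_bounded_cnj[OF ess_bounded_rep]] order_refl])
  have "L2_inner (x - y) q =
      (LINT t|leb01. rep_linf x t * cnj (rep_linf q t) - rep_linf y t * cnj (rep_linf q t))"
    unfolding L2_inner_def
  proof (rule integral_cong_AE)
    show "AE t in leb01. rep_linf (x - y) t * cnj (rep_linf q t) =
        rep_linf x t * cnj (rep_linf q t) - rep_linf y t * cnj (rep_linf q t)"
      using rep_linf_minus[of x y] by eventually_elim (simp add: left_diff_distrib)
  qed (use int in auto)
  then show ?thesis by (simp add: L2_inner_def int)
qed

lemma L2_inner_self_zero:
  assumes "L2_inner d d = 0"
  shows "d = 0"
proof -
  have int: "integrable leb01 (\<lambda>t. rep_linf d t * cnj (rep_linf d t))"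
    by (rule ess_bounded_integrable[OF ess_bounded_mult[OF ess_bounded_rep ess_bounded_cnj[OF ess_bounded_rep]] order_refl])
  have eq: "rep_linf d t * cnj (rep_linf d t) = of_real ((cmod (rep_linf d t))\<^sup>2)" for t
    by (simp add: complex_norm_square[symmetric])
  have "integrable leb01 (\<lambda>t. (cmod (rep_linf d t))\<^sup>2)"
    using int unfolding eq by (simp only: complex_of_real_integrable_eq)
  moreover have "(LINT t|leb01. (cmod (rep_linf d t))\<^sup>2) = 0"
    using assms unfolding L2_inner_def eq by (simp only: integral_complex_of_real of_real_eq_0_iff)
  ultimately have "AE t in leb01. (cmod (rep_linf d t))\<^sup>2 = 0"
    by (subst (asm) integral_nonneg_eq_0_iff_AE) auto
  then have "AE t in leb01. cmod (rep_linf d t) \<le> 0" by eventually_elim simp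
  then show "d = 0" using norm_linf_le_iff[of d 0] by simp
qed

lemma galerkin_proj_eqI:
  assumes n: "1 \<le> n" and p: "p \<in> pw_poly r n" "\<And>q. q \<in> pw_poly r n \<Longrightarrow> L2_inner (x - p) q = 0"
  shows "galerkin_proj r n x = p"
  unfolding galerkin_proj_def
proof (rule the_equality)
  fix p' assume p': "p' \<in> pw_poly r n \<and> (\<forall>q\<in>pw_poly r n. L2_inner (x - p') q = 0)"
  have d: "p' - p \<in> pw_poly r n" using p' p n by (intro pw_poly_diff) auto
  have "L2_inner (p' - p) (p' - p) = L2_inner (x - p) (p' - p) - L2_inner (x - p') (p' - p)"
    by (simp add: L2_inner_diff)
  also have "\<dots> = 0" using p p' d by simp
  finally have "p' - p = 0" by (rule L2_inner_self_zero)
  then show "p' = p" by simp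
qed (use p in auto)

text \<open>The two properties of the Galerkin projection that the convergence proof uses: the error is
  orthogonal to polynomials on every cell, and it is bounded by the error of the best local polynomial
  approximation, with a constant that does not depend on \<open>n\<close>.\<close>

lemma galerkin_error:
  "\<exists>C\<ge>0. \<forall>n\<ge>1. \<forall>x.
     (\<forall>j\<in>{1..n}. \<forall>p. degree p \<le> 2 * r \<longrightarrow>
        integral (cell n j) (\<lambda>t. rep_linf (x - galerkin_proj r n x) t * poly p (of_real t)) = 0) \<and>
     (\<forall>c\<ge>0. (\<forall>j\<in>{1..n}. \<exists>p. degree p \<le> 2 * r \<and>
          (AE t in lebesgue_on (cell n j). cmod (rep_linf x t - poly p (of_real t)) \<le> c)) \<longrightarrow>
        norm (x - galerkin_proj r n x) \<le> C * c)"
proof -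
  obtain C where C: "C \<ge> 0" and loc: "\<And>a b f. a < b \<Longrightarrow> {a..b} \<subseteq> {0..1} \<Longrightarrow> ess_bounded f \<Longrightarrow>
      \<exists>Q. local_proj (2 * r) C a b f Q"
    using local_projection[of "2 * r"] by blast
  have "(\<forall>j\<in>{1..n}. \<forall>p. degree p \<le> 2 * r \<longrightarrow>
        integral (cell n j) (\<lambda>t. rep_linf (x - galerkin_proj r n x) t * poly p (of_real t)) = 0) \<and>
     (\<forall>c\<ge>0. (\<forall>j\<in>{1..n}. \<exists>p. degree p \<le> 2 * r \<and>
          (AE t in lebesgue_on (cell n j). cmod (rep_linf x t - poly p (of_real t)) \<le> c)) \<longrightarrow>
        norm (x - galerkin_proj r n x) \<le> (1 + C) * c)" if n: "1 \<le> n" for n x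
  proof -
    have "\<forall>j\<in>{1..n}. \<exists>Q. local_proj (2 * r) C ((real j - 1) / real n) (real j / real n) (rep_linf x) Q"
      using n by (intro ballI loc cell_subset ess_bounded_rep) (auto simp: divide_strict_right_mono)
    from bchoice[OF this] obtain Q where proj: "\<And>j. j \<in> {1..n} \<Longrightarrow>
        local_proj (2 * r) C ((real j - 1) / real n) (real j / real n) (rep_linf x) (Q j)"
      by blast
    note Q = proj[unfolded local_proj_def]
    have Q1: "degree (Q j) \<le> 2 * r" if "j \<in> {1..n}" for j using Q[OF that] by blast
    define P where "P = abs_linf (glue n Q)"
    have P: "AE t in lebesgue_on (cell n j). rep_linf P t = poly (Q j) (of_real t)" if j: "j \<in> {1..n}" for j
      using AE_lebesgue_on_mono[OF rep_abs_linf[OF ess_bounded_glue] cell_subset[OF n j], of n Q]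
        glue_on_cell[OF n j, of Q]
      unfolding P_def by eventually_elim simp
    have P_mem: "P \<in> pw_poly r n" unfolding pw_poly_iff using P Q1 by blast
    have err: "AE t in lebesgue_on (cell n j). rep_linf (x - P) t = rep_linf x t - poly (Q j) (of_real t)"
      if j: "j \<in> {1..n}" for j
      using AE_lebesgue_on_mono[OF rep_linf_minus cell_subset[OF n j], of x P] P[OF j]
      by eventually_elim simp
    have orth: "integral (cell n j) (\<lambda>t. rep_linf (x - P) t * poly p (of_real t)) = 0"
      if j: "j \<in> {1..n}" and p: "degree p \<le> 2 * r" for j p
    proof -
      have "integral (cell n j) (\<lambda>t. rep_linf (x - P) t * poly p (of_real t)) =
          integral (cell n j) (\<lambda>t. (rep_linf x t - poly (Q j) (of_real t)) * poly p (of_real t))"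
        by (rule ess_bounded_integral_cong[OF _ _ cell_subset[OF n j]])
          (use err[OF j] in \<open>auto intro!: ess_bounded_mult ess_bounded_diff ess_bounded_rep ess_bounded_poly
             elim: eventually_mono\<close>)
      then show ?thesis using Q[OF j] p by simp
    qed
    have "L2_inner (x - P) q = 0" if q: "q \<in> pw_poly r n" for q
    proof -
      have "integral (cell n j) (\<lambda>t. rep_linf (x - P) t * cnj (rep_linf q t)) = 0" if j: "j \<in> {1..n}" for j
      proof -
        obtain p where p: "degree p \<le> 2 * r"
            "AE t in lebesgue_on (cell n j). rep_linf q t = poly p (of_real t)"
          by (rule pw_polyE[OF q j])
        define p' where "p' = map_poly cnj p"
        have cnj_p: "cnj (poly p (of_real t)) = poly p' (of_real t)" for t
          using poly_cnj[of p "of_real t"] by (simp only: p'_def complex_cnj_complex_of_real)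
        have "integral (cell n j) (\<lambda>t. rep_linf (x - P) t * cnj (rep_linf q t)) =
            integral (cell n j) (\<lambda>t. rep_linf (x - P) t * poly p' (of_real t))"
        proof (rule ess_bounded_integral_cong[OF _ _ cell_subset[OF n j]])
          show "AE t in lebesgue_on (cell n j). rep_linf (x - P) t * cnj (rep_linf q t) =
              rep_linf (x - P) t * poly p' (of_real t)"
            using p(2) by eventually_elim (simp only: cnj_p)
        qed (intro ess_bounded_mult ess_bounded_rep ess_bounded_poly ess_bounded_cnj)+
        also have "\<dots> = 0" using p(1) by (intro orth j) (simp add: p'_def degree_map_poly)
        finally show ?thesis .
      qed
      then show ?thesis by (subst L2_inner_cells[OF n]) (rule sum.neutral, blast)
    qed
    then have eq: "galerkin_proj r n x = P" by (rule galerkin_proj_eqI[OF n P_mem])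
    have "norm (x - P) \<le> (1 + C) * c" if c: "c \<ge> 0" and
      ap: "\<forall>j\<in>{1..n}. \<exists>p. degree p \<le> 2 * r \<and>
          (AE t in lebesgue_on (cell n j). cmod (rep_linf x t - poly p (of_real t)) \<le> c)" for c
      unfolding norm_linf_le_iff
    proof (rule AE_cellsI[OF n])
      fix j assume j: "j \<in> {1..n}"
      obtain p where p: "degree p \<le> 2 * r"
          "AE t in lebesgue_on (cell n j). cmod (rep_linf x t - poly p (of_real t)) \<le> c"
        using ap j by blast
      show "AE t in lebesgue_on (cell n j). cmod (rep_linf (x - P) t) \<le> (1 + C) * c"
        using err[OF j] p(2) AE_space[of "lebesgue_on (cell n j)"]
      proof eventually_elim
        case (elim t)
        then have "t \<in> cell n j" by simp
        then have "cmod (poly p (of_real t) - poly (Q j) (of_real t)) \<le> C * c"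
          using Q[OF j] p c by blast
        then have "cmod ((rep_linf x t - poly p (of_real t)) + (poly p (of_real t) - poly (Q j) (of_real t))) \<le> c + C * c"
          using elim(2) by (intro norm_triangle_le add_mono)
        then show ?case by (simp add: elim(1) distrib_right)
      qed
    qed
    then show ?thesis using orth by (simp add: eq)
  qed
  then show ?thesis using C by (intro exI[of _ "1 + C"]) auto
qed

section \<open>Smooth functions and their local approximation by polynomials\<close>

text \<open>\<open>Ck k f\<close>: all derivatives of \<open>f\<close> up to order \<open>k\<close> exist in the open unit interval and extend continuously
  to the closed one.  They are taken in the open interval because those of a Green's kernel are given
  only in the interior of the triangles.\<close>

fun Ck :: "nat \<Rightarrow> (real \<Rightarrow> complex) \<Rightarrow> bool" where
  "Ck 0 f \<longleftrightarrow> continuous_on {0..1} f"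
| "Ck (Suc k) f \<longleftrightarrow> continuous_on {0..1} f \<and>
     (\<exists>g. Ck k g \<and> (\<forall>x\<in>{0<..<1}. (f has_vector_derivative g x) (at x)))"

lemma Ck_continuous: "Ck k f \<Longrightarrow> continuous_on {0..1} f"
  by (cases k) auto

lemma Ck_SucI:
  assumes "continuous_on {0..1} f" "Ck k g" "\<And>x. x \<in> {0<..<1} \<Longrightarrow> (f has_vector_derivative g x) (at x)"
  shows "Ck (Suc k) f"
  using assms by auto

lemma Ck_SucD: "Ck (Suc k) f \<Longrightarrow> Ck k f"
proof (induction k arbitrary: f)
  case (Suc k)
  obtain g where g: "continuous_on {0..1} f" "Ck (Suc k) g"
      "\<And>x. x \<in> {0<..<1} \<Longrightarrow> (f has_vector_derivative g x) (at x)"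
    using Suc.prems unfolding Ck.simps(2)[of "Suc k" f] by blast
  show ?case by (rule Ck_SucI[OF g(1) Suc.IH[OF g(2)] g(3)])
qed auto

lemma Ck_cong:
  assumes f: "Ck k f" and eq: "\<And>x. x \<in> {0..1} \<Longrightarrow> f x = g x"
  shows "Ck k g"
proof (cases k)
  case 0
  then show ?thesis using continuous_on_eq[OF Ck_continuous[OF f] eq] by simp
next
  case (Suc m)
  obtain f' where f': "continuous_on {0..1} f" "Ck m f'"
      "\<And>x. x \<in> {0<..<1} \<Longrightarrow> (f has_vector_derivative f' x) (at x)"
    using f by (auto simp: Suc)
  have "(g has_vector_derivative f' x) (at x)" if "x \<in> {0<..<1}" for x
    by (rule has_vector_derivative_transform_within_open[OF f'(3)[OF that], of "{0<..<1}"])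
      (use that eq in auto)
  moreover have "continuous_on {0..1} g" by (rule continuous_on_eq[OF f'(1) eq])
  ultimately show ?thesis unfolding Suc using f'(2) by (intro Ck_SucI)
qed

lemma Ck_add: "Ck k f \<Longrightarrow> Ck k g \<Longrightarrow> Ck k (\<lambda>x. f x + g x)"
proof (induction k arbitrary: f g)
  case 0
  then show ?case by (auto intro: continuous_on_add)
next
  case (Suc k)
  obtain f' where f': "continuous_on {0..1} f" "Ck k f'"
      "\<And>x. x \<in> {0<..<1} \<Longrightarrow> (f has_vector_derivative f' x) (at x)"
    using Suc.prems(1) by auto
  obtain g' where g': "continuous_on {0..1} g" "Ck k g'"
      "\<And>x. x \<in> {0<..<1} \<Longrightarrow> (g has_vector_derivative g' x) (at x)"
    using Suc.prems(2) by auto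
  show ?case
    by (rule Ck_SucI[OF continuous_on_add[OF f'(1) g'(1)] Suc.IH[OF f'(2) g'(2)]])
      (intro has_vector_derivative_add f' g')
qed

lemma Ck_mult: "Ck k f \<Longrightarrow> Ck k g \<Longrightarrow> Ck k (\<lambda>x. f x * g x)"
proof (induction k arbitrary: f g)
  case 0
  then show ?case by (auto intro: continuous_on_mult)
next
  case (Suc k)
  obtain f' where f': "continuous_on {0..1} f" "Ck k f'"
      "\<And>x. x \<in> {0<..<1} \<Longrightarrow> (f has_vector_derivative f' x) (at x)"
    using Suc.prems(1) by auto
  obtain g' where g': "continuous_on {0..1} g" "Ck k g'"
      "\<And>x. x \<in> {0<..<1} \<Longrightarrow> (g has_vector_derivative g' x) (at x)"
    using Suc.prems(2) by auto
  have "Ck k (\<lambda>x. f x * g' x + f' x * g x)"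
    by (intro Ck_add Suc.IH Ck_SucD[OF Suc.prems(1)] Ck_SucD[OF Suc.prems(2)] f' g')
  then show ?case
    by (rule Ck_SucI[OF continuous_on_mult[OF f'(1) g'(1)]])
      (intro has_vector_derivative_mult f' g')
qed

lemma Ck_const: "Ck k (\<lambda>x. c)"
proof (induction k arbitrary: c)
  case (Suc k)
  show ?case by (rule Ck_SucI[OF continuous_on_const Suc.IH[of 0]]) simp
qed auto

lemma Ck_reflect: "Ck k f \<Longrightarrow> Ck k (\<lambda>x. f (1 - x))"
proof (induction k arbitrary: f)
  case 0
  then have "continuous_on {0..1} f" by simp
  then show ?case
    by (auto intro!: continuous_on_compose2[of "{0..1}" f] continuous_intros)
next
  case (Suc k)
  obtain f' where f': "continuous_on {0..1} f" "Ck k f'"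
      "\<And>x. x \<in> {0<..<1} \<Longrightarrow> (f has_vector_derivative f' x) (at x)"
    using Suc.prems by auto
  have c: "continuous_on {0..1} (\<lambda>x. f (1 - x))"
    by (rule continuous_on_compose2[OF f'(1)]) (auto intro!: continuous_intros)
  have d: "Ck k (\<lambda>x. -1 * f' (1 - x))" by (rule Ck_mult[OF Ck_const Suc.IH[OF f'(2)]])
  show ?case
  proof (rule Ck_SucI[OF c d])
    fix x :: real assume x: "x \<in> {0<..<1}"
    have 1: "((\<lambda>x. 1 - x) has_vector_derivative -1) (at x)"
      by (auto intro!: derivative_eq_intros)
    have 2: "(f has_vector_derivative f' (1 - x)) (at (1 - x))" using x by (intro f'(3)) auto
    from vector_diff_chain_at[OF 1 2]
    show "((\<lambda>x. f (1 - x)) has_vector_derivative -1 * f' (1 - x)) (at x)" by (simp add: o_def)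
  qed
qed

lemma Ck_family:
  assumes "Ck m f"
  shows "\<exists>F. F 0 = f \<and> (\<forall>i\<le>m. continuous_on {0..1} (F i)) \<and>
    (\<forall>i<m. \<forall>x\<in>{0<..<1}. (F i has_vector_derivative F (Suc i) x) (at x))"
  using assms
proof (induction m arbitrary: f)
  case 0
  then show ?case by (intro exI[of _ "\<lambda>_. f"]) auto
next
  case (Suc m)
  obtain f' where f': "continuous_on {0..1} f" "Ck m f'"
      "\<And>x. x \<in> {0<..<1} \<Longrightarrow> (f has_vector_derivative f' x) (at x)"
    using Suc.prems by auto
  obtain F where F: "F 0 = f'" "\<forall>i\<le>m. continuous_on {0..1} (F i)"
      "\<forall>i<m. \<forall>x\<in>{0<..<1}. (F i has_vector_derivative F (Suc i) x) (at x)"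
    using Suc.IH[OF f'(2)] by blast
  show ?case
    by (rule exI[of _ "case_nat f F"])
      (use f' F in \<open>auto split: nat.splits simp: less_Suc_eq_0_disj\<close>)
qed

lemma pderiv_sum: "pderiv (\<Sum>i\<in>I. f i) = (\<Sum>i\<in>I. pderiv (f i))"
  by (induction I rule: infinite_finite_induct) (simp_all add: pderiv_add)

lemma poly_antiderivative:
  fixes p :: "complex poly"
  obtains P where "pderiv P = p" "degree P \<le> Suc (degree p)"
proof
  let ?P = "\<Sum>i\<le>degree p. monom (coeff p i / of_nat (Suc i)) (Suc i)"
  have "pderiv ?P = (\<Sum>i\<le>degree p. monom (coeff p i) i)"
    by (simp add: pderiv_sum pderiv_monom del: of_nat_Suc)
  also have "\<dots> = p" by (rule poly_as_sum_of_monoms)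
  finally show "pderiv ?P = p" .
  show "degree ?P \<le> Suc (degree p)"
    by (intro degree_sum_le) (auto intro: order_trans[OF degree_monom_le])
qed

text \<open>Induction on the order: an approximation of the derivative is integrated, with the value at the
  left endpoint as constant of integration, and the mean value inequality yields one more power of
  \<open>b - a\<close>.  The case \<open>p = 0\<close> covers order \<open>0\<close>, where no degree is small enough.\<close>

lemma local_polynomial_approximation:
  fixes F :: "nat \<Rightarrow> real \<Rightarrow> complex"
  assumes "a < b" "0 \<le> B"
    and "\<And>i. i < m \<Longrightarrow> continuous_on {a..b} (F i)"
    and "\<And>i x. i < m \<Longrightarrow> x \<in> {a<..<b} \<Longrightarrow> (F i has_vector_derivative F (Suc i) x) (at x)"
    and "\<And>x. x \<in> {a<..<b} \<Longrightarrow> cmod (F m x) \<le> B"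
  shows "\<exists>p. (p = 0 \<or> degree p < m) \<and>
    (\<forall>x\<in>{a<..<b}. cmod (F 0 x - poly p (of_real x)) \<le> B * (b - a) ^ m)"
  using assms(3-)
proof (induction m arbitrary: F)
  case 0
  then show ?case by (intro exI[of _ 0]) auto
next
  case (Suc m)
  have "\<exists>p. (p = 0 \<or> degree p < m) \<and>
      (\<forall>x\<in>{a<..<b}. cmod (F (Suc 0) x - poly p (of_real x)) \<le> B * (b - a) ^ m)"
    by (rule Suc.IH[of "\<lambda>i. F (Suc i)"]) (use Suc.prems in auto)
  then obtain p where p: "p = 0 \<or> degree p < m"
      "\<And>x. x \<in> {a<..<b} \<Longrightarrow> cmod (F (Suc 0) x - poly p (of_real x)) \<le> B * (b - a) ^ m"
    by blast
  obtain P where P: "pderiv P = p" "degree P \<le> Suc (degree p)" by (rule poly_antiderivative)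
  define R where "R = (if p = 0 then [:F 0 a:] else P + [:F 0 a - poly P (of_real a):])"
  have R: "pderiv R = p" "poly R (of_real a) = F 0 a"
    using P(1) by (auto simp: R_def pderiv_add pderiv_pCons)
  have "degree R < Suc m"
    using p(1) P(2) by (auto simp: R_def intro!: degree_add_less)
  moreover have "cmod (F 0 x - poly R (of_real x)) \<le> B * (b - a) ^ Suc m" if x: "x \<in> {a<..<b}" for x
  proof -
    define g where "g t = F 0 t - poly R (of_real t)" for t :: real
    have "\<exists>y\<in>{a<..<x}. norm (g x - g a) \<le> norm ((x - a) *\<^sub>R (F (Suc 0) y - poly p (of_real y)))"
    proof (rule mvt_general)
      have "continuous_on {a..x} (F 0)"
        by (rule continuous_on_subset[OF Suc.prems(1)[of 0]]) (use x in auto)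
      then show "continuous_on {a..x} g" unfolding g_def by (intro continuous_intros)
      fix y assume y: "a < y" "y < x"
      have "((\<lambda>t. poly R (complex_of_real t)) has_vector_derivative poly (pderiv R) (of_real y)) (at y)"
        by (rule has_vector_derivative_real_field) (rule poly_DERIV)
      moreover have "(F 0 has_vector_derivative F (Suc 0) y) (at y)"
        using x y by (intro Suc.prems(2)) auto
      ultimately have "(g has_vector_derivative (F (Suc 0) y - poly p (of_real y))) (at y)"
        unfolding g_def R(1)[symmetric] by (intro has_vector_derivative_diff)
      then show "(g has_derivative (\<lambda>h. h *\<^sub>R (F (Suc 0) y - poly p (of_real y)))) (at y)"
        by (simp add: has_vector_derivative_def)
    qed (use x in auto)
    then obtain y where y: "y \<in> {a<..<x}"
        "norm (g x - g a) \<le> (x - a) * cmod (F (Suc 0) y - poly p (of_real y))"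
      using x by auto
    note y(2)
    also have "(x - a) * cmod (F (Suc 0) y - poly p (of_real y)) \<le> (b - a) * (B * (b - a) ^ m)"
      using x y(1) \<open>0 \<le> B\<close> by (intro mult_mono p(2)) auto
    finally show ?thesis by (simp add: g_def R(2) mult_ac)
  qed
  ultimately show ?case by blast
qed

lemma Ck_approximation:
  assumes "Ck m f"
  obtains B where "B \<ge> 0" "\<And>a b. a < b \<Longrightarrow> {a..b} \<subseteq> {0..1} \<Longrightarrow>
    \<exists>p. (p = 0 \<or> degree p < m) \<and>
      (\<forall>x\<in>{a<..<b}. cmod (f x - poly p (of_real x)) \<le> B * (b - a) ^ m)"
proof -
  obtain F where F: "F 0 = f" "\<And>i. i \<le> m \<Longrightarrow> continuous_on {0..1} (F i)"
    "\<And>i x. i < m \<Longrightarrow> x \<in> {0<..<1} \<Longrightarrow> (F i has_vector_derivative F (Suc i) x) (at x)"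
    using Ck_family[OF assms] by blast
  have "compact (F m ` {0..1})" by (rule compact_continuous_image[OF F(2) compact_Icc]) simp
  then obtain B where B: "\<And>x. x \<in> {0..1} \<Longrightarrow> cmod (F m x) \<le> B"
    unfolding compact_eq_bounded_closed bounded_iff by fastforce
  have "0 \<le> B" using B[of 0] norm_ge_zero[of "F m 0"] by (intro order_trans[OF norm_ge_zero]) auto
  moreover have "\<exists>p. (p = 0 \<or> degree p < m) \<and>
      (\<forall>x\<in>{a<..<b}. cmod (F 0 x - poly p (of_real x)) \<le> B * (b - a) ^ m)"
    if ab: "a < b" "{a..b} \<subseteq> {0..1}" for a b
  proof (rule local_polynomial_approximation[OF ab(1) \<open>0 \<le> B\<close>])
    have "0 \<le> a" "b \<le> 1" using ab by auto
    then show "(F i has_vector_derivative F (Suc i) x) (at x)" if "i < m" "x \<in> {a<..<b}" for i x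
      using that by (intro F(3)) auto
    show "cmod (F m x) \<le> B" if "x \<in> {a<..<b}" for x
      using that \<open>0 \<le> a\<close> \<open>b \<le> 1\<close> by (intro B) auto
    show "continuous_on {a..b} (F i)" if "i < m" for i
      using that by (intro continuous_on_subset[OF F(2) ab(2)]) simp
  qed
  ultimately show ?thesis using that[of B] unfolding F(1) by blast
qed

section \<open>Volterra integrals with a kernel that is smooth on a triangle\<close>

definition volterra :: "(real \<Rightarrow> real \<Rightarrow> real) \<Rightarrow> (real \<Rightarrow> complex) \<Rightarrow> real \<Rightarrow> complex" where
  "volterra a v s = integral {0..s} (\<lambda>t. of_real (a s t) * v t)"

lemma Omega1_compact: "compact Omega1"
proof -
  have "Omega1 = {x. snd x \<ge> 0} \<inter> {x. snd x \<le> fst x} \<inter> {x. fst x \<le> 1}"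
    by (auto simp: Omega1_def)
  moreover have "closed ({x :: real \<times> real. snd x \<ge> 0} \<inter> {x. snd x \<le> fst x} \<inter> {x. fst x \<le> 1})"
    by (intro closed_Int closed_Collect_le continuous_intros)
  moreover have "Omega1 \<subseteq> {0..1} \<times> {0..1}" by (auto simp: Omega1_def)
  ultimately show ?thesis
    using compact_Int_closed[OF compact_Times[OF compact_Icc[of 0 "1::real"] compact_Icc[of 0 "1::real"]], of Omega1]
    by (metis inf.absorb_iff2)
qed

lemma Omega1_bounded:
  assumes "continuous_on Omega1 (\<lambda>(s, t). a s t :: real)"
  obtains M where "M \<ge> 0" "\<And>s t. (s, t) \<in> Omega1 \<Longrightarrow> \<bar>a s t\<bar> \<le> M"
proof -
  have "compact ((\<lambda>(s, t). a s t) ` Omega1)"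
    by (rule compact_continuous_image[OF assms Omega1_compact])
  then obtain M where M: "\<forall>x\<in>(\<lambda>(s, t). a s t) ` Omega1. norm x \<le> M"
    unfolding compact_eq_bounded_closed bounded_iff by auto
  have "\<bar>a s t\<bar> \<le> \<bar>M\<bar>" if "(s, t) \<in> Omega1" for s t
    using M that by force
  then show ?thesis using that[of "\<bar>M\<bar>"] by simp
qed

lemma Omega1_sections:
  assumes "continuous_on Omega1 (\<lambda>(s, t). a s t :: real)"
  shows "0 \<le> t \<Longrightarrow> continuous_on {t..1} (\<lambda>s. a s t)"
    and "s \<le> 1 \<Longrightarrow> continuous_on {0..s} (\<lambda>t. a s t)"
    and "continuous_on {0..1} (\<lambda>s. a s s)"
proof -
  have comp: "continuous_on S (\<lambda>x. a (f x) (g x))"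
    if "continuous_on S f" "continuous_on S g" "\<And>x. x \<in> S \<Longrightarrow> (f x, g x) \<in> Omega1"
    for S :: "real set" and f g
    using continuous_on_compose2[OF assms, of S "\<lambda>x. (f x, g x)"] that
    by (auto intro: continuous_on_Pair)
  show "0 \<le> t \<Longrightarrow> continuous_on {t..1} (\<lambda>s. a s t)"
    "s \<le> 1 \<Longrightarrow> continuous_on {0..s} (\<lambda>t. a s t)"
    "continuous_on {0..1} (\<lambda>s. a s s)"
    by (auto intro!: comp continuous_intros simp: Omega1_def)
qed

lemma lipschitz_of_derivative:
  fixes f f' :: "real \<Rightarrow> real"
  assumes "p \<le> q" "continuous_on {p..q} f"
    and "\<And>x. x \<in> {p<..<q} \<Longrightarrow> (f has_real_derivative f' x) (at x)"
    and "\<And>x. x \<in> {p<..<q} \<Longrightarrow> \<bar>f' x\<bar> \<le> M"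
  shows "\<bar>f q - f p\<bar> \<le> M * (q - p)"
proof (cases "p = q")
  case False
  then have pq: "p < q" using assms(1) by simp
  have diff: "f differentiable (at x)" if "p < x" "x < q" for x
    using assms(3)[of x] that by (auto simp: real_differentiable_def)
  have "\<exists>l x. p < x \<and> x < q \<and> DERIV f x :> l \<and> f q - f p = (q - p) * l"
    by (rule MVT[OF pq assms(2)]) (rule diff)
  then obtain l x where x: "p < x" "x < q" "DERIV f x :> l" "f q - f p = (q - p) * l"
    by blast
  have "l = f' x" using DERIV_unique[OF x(3) assms(3)] x by simp
  then have "\<bar>l\<bar> \<le> M" using assms(4)[of x] x by simp
  then show ?thesis using pq mult_right_mono[of "\<bar>l\<bar>" M "q - p"] by (simp add: x(4) abs_mult mult.commute)
qed simp

text \<open>The quotient form of the derivative, to which dominated convergence can be applied.\<close>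

lemma has_vector_derivativeI_slope:
  fixes f :: "real \<Rightarrow> complex"
  assumes "((\<lambda>y. (f y - f x) / of_real (y - x)) \<longlongrightarrow> d) (at x)"
  shows "(f has_vector_derivative d) (at x)"
  unfolding has_vector_derivative_def has_derivative_iff_norm
proof
  have "((\<lambda>y. norm ((f y - f x) / of_real (y - x) - d)) \<longlongrightarrow> 0) (at x)"
    by (rule tendsto_norm_zero[OF LIM_zero[OF assms]])
  then show "((\<lambda>y. norm (f y - f x - (y - x) *\<^sub>R d) / norm (y - x)) \<longlongrightarrow> 0) (at x)"
  proof (rule Lim_transform_eventually)
    show "\<forall>\<^sub>F y in at x. norm ((f y - f x) / of_real (y - x) - d) = norm (f y - f x - (y - x) *\<^sub>R d) / norm (y - x)"
      unfolding eventually_at_filter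
    proof (rule always_eventually, intro allI impI)
      fix y assume "y \<noteq> x"
      then have "(f y - f x) / of_real (y - x) - d = (f y - f x - (y - x) *\<^sub>R d) / of_real (y - x)"
        by (simp add: scaleR_conv_of_real diff_divide_distrib)
      then show "norm ((f y - f x) / of_real (y - x) - d) = norm (f y - f x - (y - x) *\<^sub>R d) / norm (y - x)"
        by (simp only: norm_divide norm_of_real real_norm_def)
    qed
  qed
qed (rule bounded_linear_scaleR_left)

text \<open>The function \<open>a (max s t) t\<close> extends \<open>a\<close> from the triangle to the square by constants in the first
  variable.  Unlike the extension by \<open>0\<close> it has no jump across the diagonal, so its difference quotients in
  \<open>s\<close> stay bounded.\<close>

lemma volterra_split:
  assumes a: "continuous_on Omega1 (\<lambda>(s, t). a s t)" and v: "continuous_on {0..1} v"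
    and s: "s \<in> {0..1}"
  shows "volterra a v s = integral {0..1} (\<lambda>t. of_real (a (max s t) t) * v t)
    - integral {s..1} (\<lambda>t. of_real (a t t) * v t)"
proof -
  have c: "continuous_on {0..1} (\<lambda>t. of_real (a (max s t) t) * v t)"
    using s by (intro continuous_intros v continuous_on_compose2[OF a, of "{0..1}" "\<lambda>t. (max s t, t)", simplified])
      (auto simp: Omega1_def)
  have "integral {0..s} (\<lambda>t. of_real (a (max s t) t) * v t) + integral {s..1} (\<lambda>t. of_real (a (max s t) t) * v t)
      = integral {0..1} (\<lambda>t. of_real (a (max s t) t) * v t)"
    using s by (intro Henstock_Kurzweil_Integration.integral_combine integrable_continuous_interval c) auto
  moreover have "integral {0..s} (\<lambda>t. of_real (a (max s t) t) * v t) = volterra a v s"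
    unfolding volterra_def by (rule integral_cong) (auto simp: max_def)
  moreover have "integral {s..1} (\<lambda>t. of_real (a (max s t) t) * v t) = integral {s..1} (\<lambda>t. of_real (a t t) * v t)"
    by (rule integral_cong) (auto simp: max_def)
  ultimately show ?thesis by (simp add: algebra_simps)
qed

lemma continuous_on_volterra:
  assumes a: "continuous_on Omega1 (\<lambda>(s, t). a s t)" and v: "continuous_on {0..1} v"
  shows "continuous_on {0..1} (volterra a v)"
proof -
  have "continuous_on {0..1} (\<lambda>s. integral (cbox 0 1) (\<lambda>t. of_real (a (max s t) t) * v t))"
  proof (rule integral_continuous_on_param)
    have "continuous_on ({0..1} \<times> {0..1}) (\<lambda>x. of_real (a (max (fst x) (snd x)) (snd x)) * v (snd x))"
      by (intro continuous_intros continuous_on_compose2[OF v]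
          continuous_on_compose2[OF a, of "{0..1} \<times> {0..1}" "\<lambda>x. (max (fst x) (snd x), snd x)", simplified])
        (auto simp: Omega1_def)
    then show "continuous_on ({0..1} \<times> cbox 0 1) (\<lambda>(s, t). of_real (a (max s t) t) * v t)"
      by (simp add: case_prod_unfold)
  qed
  moreover have "continuous_on {0..1} (\<lambda>s. integral {s..1} (\<lambda>t. of_real (a t t) * v t))"
    by (intro indefinite_integral_continuous_1' integrable_continuous_interval continuous_intros v Omega1_sections(3)[OF a])
  ultimately have "continuous_on {0..1} (\<lambda>s. integral {0..1} (\<lambda>t. of_real (a (max s t) t) * v t)
    - integral {s..1} (\<lambda>t. of_real (a t t) * v t))"
    by (intro continuous_on_diff) auto
  then show ?thesis
    by (rule continuous_on_eq) (rule volterra_split[OF a v, symmetric])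
qed

text \<open>In the decomposition above, the integral over the fixed interval may be differentiated under the
  integral sign by dominated convergence, and gives the integral of \<open>b\<close> over \<open>t < s\<close>; the fundamental
  theorem of calculus handles the other one and gives the value on the diagonal.\<close>

lemma volterra_derivative:
  assumes a: "continuous_on Omega1 (\<lambda>(s, t). a s t)" and b: "continuous_on Omega1 (\<lambda>(s, t). b s t)"
    and ab: "\<And>s t. 0 < t \<Longrightarrow> t < s \<Longrightarrow> s < 1 \<Longrightarrow> ((\<lambda>u. a u t) has_real_derivative b s t) (at s)"
    and v: "continuous_on {0..1} v" and s0: "s0 \<in> {0<..<1}"
  shows "(volterra a v has_vector_derivative of_real (a s0 s0) * v s0 + volterra b v s0) (at s0)"
proof -
  \<comment> \<open>\<open>W\<close> and \<open>U\<close> are the two terms of \<open>volterra_split\<close>\<close>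
  define A where "A s t = complex_of_real (a (max s t) t) * v t" for s t
  define W where "W s = integral {0..1} (A s)" for s
  define U where "U s = integral {s..1} (\<lambda>t. of_real (a t t) * v t)" for s
  obtain M where M: "M \<ge> 0" "\<And>s t. (s, t) \<in> Omega1 \<Longrightarrow> \<bar>b s t\<bar> \<le> M" using Omega1_bounded[OF b] by blast
  have "compact (v ` {0..1})" by (rule compact_continuous_image[OF v compact_Icc])
  then obtain Bv where Bv: "\<And>t. t \<in> {0..1} \<Longrightarrow> cmod (v t) \<le> Bv"
    unfolding compact_eq_bounded_closed bounded_iff by fastforce
  have Ai: "A s integrable_on {0..1}" if "s \<in> {0..1}" for s
    unfolding A_def using that
    by (intro integrable_continuous_interval continuous_intros v
        continuous_on_compose2[OF a, of "{0..1}" "\<lambda>t. (max s t, t)", simplified])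
      (auto simp: Omega1_def)
  have lip: "\<bar>a q t - a p t\<bar> \<le> M * \<bar>q - p\<bar>" if "0 < t" "t \<le> p" "t \<le> q" "p \<le> 1" "q \<le> 1" for p q t
  proof -
    have *: "\<bar>a q t - a p t\<bar> \<le> M * (q - p)" if "t \<le> p" "p \<le> q" "q \<le> 1" for p q
    proof (rule lipschitz_of_derivative[where f' = "\<lambda>s. b s t"])
      show "continuous_on {p..q} (\<lambda>s. a s t)"
        by (rule continuous_on_subset[OF Omega1_sections(1)[OF a]]) (use that \<open>0 < t\<close> in auto)
    qed (use that \<open>0 < t\<close> in \<open>auto intro!: ab M(2) simp: Omega1_def\<close>)
    show ?thesis
      using *[of p q] *[of q p] that by (cases "p \<le> q") (auto simp: abs_minus_commute)
  qed
  \<comment> \<open>two points without information on the derivative of the extended kernel, removed from the integration\<close>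
  define N where "N = {0, s0}"
  define S where "S = {0..1} - N"
  have neg: "negligible (sym_diff S {0..1})"
    by (rule negligible_subset[of N]) (auto simp: S_def N_def)
  have intS: "integral S f = integral {0..1} f" for f :: "real \<Rightarrow> complex"
    by (rule integral_spike_set) (rule negligible_subset[OF neg], auto)+
  define G where "G t = (if t \<in> {0..s0} then of_real (b s0 t) * v t else 0)" for t
  have "(W has_vector_derivative volterra b v s0) (at s0)"
  proof (rule has_vector_derivativeI_slope)
    have "((\<lambda>y. (W y - W s0) / of_real (y - s0)) \<longlongrightarrow> volterra b v s0) (at s0 within {0<..<1})"
      unfolding tendsto_at_iff_sequentially
    proof (intro allI impI)
      fix X assume X: "\<forall>i. X i \<in> {0<..<1} - {s0}" "X \<longlonglongrightarrow> s0"
      define Q where "Q i t = (A (X i) t - A s0 t) / of_real (X i - s0)" for i t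
      have Qi: "Q i integrable_on {0..1}" for i
        unfolding Q_def using X(1)[rule_format, of i] s0
        by (intro integrable_on_divide integrable_diff Ai) auto
      have "(W (X i) - W s0) / of_real (X i - s0) = integral {0..1} (Q i)" for i
        unfolding W_def Q_def using X(1)[rule_format, of i] s0
        by (subst integral_divide, subst Henstock_Kurzweil_Integration.integral_diff) (auto intro!: Ai)
      then have WQ: "(W (X i) - W s0) / of_real (X i - s0) = integral S (Q i)" for i
        by (simp only: intS)
      have "(\<lambda>i. integral S (Q i)) \<longlonglongrightarrow> integral S G"
      proof (rule dominated_convergence(2)[where h = "\<lambda>t. M * Bv"])
        show "Q i integrable_on S" for i
          using Qi[of i] integrable_spike_set_eq[of "S" "{0..1}" "Q i"] neg by blast
        show "(\<lambda>t. M * Bv) integrable_on S"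
          using integrable_spike_set_eq[of "S" "{0..1}" "\<lambda>t. M * Bv"] neg integrable_const_ivl by blast
        show "norm (Q i t) \<le> M * Bv" if "t \<in> S" for i t
        proof -
          have t: "0 < t" "t \<le> 1" using that by (auto simp: S_def N_def)
          have Xi: "0 < X i" "X i < 1" "X i \<noteq> s0" using X(1)[rule_format, of i] by auto
          have "\<bar>a (max (X i) t) t - a (max s0 t) t\<bar> \<le> M * \<bar>max (X i) t - max s0 t\<bar>"
            using t Xi s0 by (intro lip) auto
          also have "\<dots> \<le> M * \<bar>X i - s0\<bar>"
            by (intro mult_left_mono M(1)) (auto simp: max_def)
          finally have "\<bar>a (max (X i) t) t - a (max s0 t) t\<bar> / \<bar>X i - s0\<bar> \<le> M"
            using Xi by (simp add: divide_le_eq)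
          moreover have "norm (Q i t) = \<bar>a (max (X i) t) t - a (max s0 t) t\<bar> / \<bar>X i - s0\<bar> * cmod (v t)"
            unfolding Q_def A_def left_diff_distrib[symmetric] of_real_diff[symmetric]
            by (simp only: norm_divide norm_mult norm_of_real) simp
          ultimately show ?thesis
            using mult_mono[OF _ Bv[of t] M(1) norm_ge_zero] t by (simp only: atLeastAtMost_iff less_imp_le)
        qed
        show "(\<lambda>i. Q i t) \<longlonglongrightarrow> G t" if "t \<in> S" for t
        proof -
          have t: "0 < t" "t \<le> 1" "t \<noteq> s0" using that by (auto simp: S_def N_def)
          show ?thesis
          proof (cases "t < s0")
            case True
            have "((\<lambda>u. (a u t - a s0 t) / (u - s0)) \<longlongrightarrow> b s0 t) (at s0)"
              using ab[OF t(1) True] s0 by (simp add: has_field_derivative_iff)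
            moreover have "filterlim X (at s0) sequentially"
              unfolding filterlim_at using X by auto
            ultimately have "(\<lambda>i. (a (X i) t - a s0 t) / (X i - s0)) \<longlonglongrightarrow> b s0 t"
              by (rule filterlim_compose)
            then have "(\<lambda>i. of_real ((a (X i) t - a s0 t) / (X i - s0)) * v t) \<longlonglongrightarrow> of_real (b s0 t) * v t"
              by (intro tendsto_intros)
            moreover have "\<forall>\<^sub>F i in sequentially. of_real ((a (X i) t - a s0 t) / (X i - s0)) * v t = Q i t"
              using order_tendstoD(1)[OF X(2) True]
            proof eventually_elim
              case (elim i)
              then show ?case using True
                by (simp add: Q_def A_def max_absorb1 less_imp_le diff_divide_distrib left_diff_distrib)
            qed
            ultimately have "(\<lambda>i. Q i t) \<longlonglongrightarrow> of_real (b s0 t) * v t" by (rule Lim_transform_eventually)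
            then show ?thesis using t True by (simp add: G_def)
          next
            case False
            then have lt: "s0 < t" using t by simp
            have "\<forall>\<^sub>F i in sequentially. 0 = Q i t"
              using order_tendstoD(2)[OF X(2) lt]
              by eventually_elim (use lt in \<open>simp add: Q_def A_def max_absorb2 less_imp_le\<close>)
            then have "(\<lambda>i. Q i t) \<longlonglongrightarrow> 0" by (rule Lim_transform_eventually[OF tendsto_const])
            then show ?thesis using lt by (simp add: G_def)
          qed
        qed
      qed
      also have "integral S G = integral {0..1} G" by (rule intS)
      also have "\<dots> = volterra b v s0"
      proof (rule integral_unique)
        have "(\<lambda>t. of_real (b s0 t) * v t) integrable_on {0..s0}"
          using s0 by (intro integrable_continuous_interval continuous_intros Omega1_sections(2)[OF b]
              continuous_on_subset[OF v]) auto
        then have "((\<lambda>t. of_real (b s0 t) * v t) has_integral volterra b v s0) {0..s0}"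
          unfolding volterra_def by (rule integrable_integral)
        then show "(G has_integral volterra b v s0) {0..1}"
          unfolding G_def using s0 by (subst has_integral_restrict) auto
      qed
      finally show "((\<lambda>y. (W y - W s0) / of_real (y - s0)) \<circ> X) \<longlonglongrightarrow> volterra b v s0"
        by (simp only: o_def WQ)
    qed
    then show "((\<lambda>y. (W y - W s0) / of_real (y - s0)) \<longlongrightarrow> volterra b v s0) (at s0)"
      by (simp only: at_within_open[OF s0 open_greaterThanLessThan])
  qed
  moreover have "(U has_vector_derivative - (of_real (a s0 s0) * v s0)) (at s0)"
  proof -
    have "continuous_on {0..1} (\<lambda>t. of_real (a t t) * v t)"
      by (intro continuous_intros v Omega1_sections(3)[OF a])
    from integral_has_vector_derivative'[OF this, of s0] s0
    have "(U has_vector_derivative - (of_real (a s0 s0) * v s0)) (at s0 within {0..1})"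
      by (simp add: U_def[abs_def])
    then show ?thesis using s0 by (simp add: at_within_Icc_at)
  qed
  ultimately have "((\<lambda>s. W s - U s) has_vector_derivative volterra b v s0 - - (of_real (a s0 s0) * v s0)) (at s0)"
    by (rule has_vector_derivative_diff)
  then have "((\<lambda>s. W s - U s) has_vector_derivative of_real (a s0 s0) * v s0 + volterra b v s0) (at s0)"
    by (simp add: add.commute)
  then show ?thesis
  proof (rule has_vector_derivative_transform_within_open)
    show "open {0<..<1::real}" "s0 \<in> {0<..<1}" using s0 by auto
    show "W s - U s = volterra a v s" if "s \<in> {0<..<1}" for s
      using volterra_split[OF a v, of s] that by (simp add: W_def U_def A_def[abs_def])
  qed
qed

text \<open>The derivatives of one half of a Green's kernel, on the lower triangle.  Continuity holds up to the
  boundary, differentiability only inside.\<close>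

definition triangle_derivs :: "nat \<Rightarrow> (nat \<Rightarrow> nat \<Rightarrow> real \<Rightarrow> real \<Rightarrow> real) \<Rightarrow> bool" where
  "triangle_derivs N D \<longleftrightarrow>
     (\<forall>j\<le>N. \<forall>k\<le>N. continuous_on Omega1 (\<lambda>(s, t). D j k s t)) \<and>
     (\<forall>s t. 0 < t \<longrightarrow> t < s \<longrightarrow> s < 1 \<longrightarrow>
        (\<forall>j<N. \<forall>k\<le>N. ((\<lambda>u. D j k u t) has_real_derivative D (Suc j) k s t) (at s)) \<and>
        (\<forall>j\<le>N. \<forall>k<N. ((\<lambda>u. D j k s u) has_real_derivative D j (Suc k) s t) (at t)))"

lemma triangle_derivsD:
  assumes "triangle_derivs N D"
  shows "j \<le> N \<Longrightarrow> k \<le> N \<Longrightarrow> continuous_on Omega1 (\<lambda>(s, t). D j k s t)"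
    and "0 < t \<Longrightarrow> t < s \<Longrightarrow> s < 1 \<Longrightarrow> j < N \<Longrightarrow> k \<le> N \<Longrightarrow>
      ((\<lambda>u. D j k u t) has_real_derivative D (Suc j) k s t) (at s)"
    and "0 < t \<Longrightarrow> t < s \<Longrightarrow> s < 1 \<Longrightarrow> j \<le> N \<Longrightarrow> k < N \<Longrightarrow>
      ((\<lambda>u. D j k s u) has_real_derivative D j (Suc k) s t) (at t)"
  using assms unfolding triangle_derivs_def by blast+

text \<open>The diagonal lies on the boundary, where the partial derivatives are not defined.  For
  \<open>p < q\<close> go from \<open>(p, p)\<close> to \<open>(q, q)\<close> along the horizontal and the vertical segment through
  \<open>(q, p)\<close>, whose interiors lie inside the triangle, and apply the mean value theorem to each.\<close>

lemma diagonal_derivative: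
  assumes a: "continuous_on Omega1 (\<lambda>(s, t). a s t)" and b: "continuous_on Omega1 (\<lambda>(s, t). b s t)"
    and c: "continuous_on Omega1 (\<lambda>(s, t). c s t)"
    and ab: "\<And>s t. 0 < t \<Longrightarrow> t < s \<Longrightarrow> s < 1 \<Longrightarrow> ((\<lambda>u. a u t) has_real_derivative b s t) (at s)"
    and ac: "\<And>s t. 0 < t \<Longrightarrow> t < s \<Longrightarrow> s < 1 \<Longrightarrow> ((\<lambda>u. a s u) has_real_derivative c s t) (at t)"
    and s: "s \<in> {0<..<1}"
  shows "((\<lambda>s. a s s) has_real_derivative b s s + c s s) (at s)"
  unfolding has_field_derivative_iff
proof (rule LIM_I)
  have step: "\<exists>x\<in>{p<..<q}. \<exists>y\<in>{p<..<q}. a q q - a p p = (q - p) * (b x p + c q y)"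
    if pq: "0 < p" "p < q" "q < 1" for p q
  proof -
    have "continuous_on {p..q} (\<lambda>u. a u p)"
      by (rule continuous_on_subset[OF Omega1_sections(1)[OF a]]) (use pq in auto)
    moreover have "(\<lambda>u. a u p) differentiable (at x)" if "p < x" "x < q" for x
      using ab[of p x] that pq by (auto simp: real_differentiable_def)
    ultimately obtain l x where x: "p < x" "x < q" "DERIV (\<lambda>u. a u p) x :> l" "a q p - a p p = (q - p) * l"
      using MVT[OF pq(2), of "\<lambda>u. a u p"] by blast
    have "l = b x p" using DERIV_unique[OF x(3) ab[of p x]] x pq by simp
    have "continuous_on {p..q} (\<lambda>u. a q u)"
      by (rule continuous_on_subset[OF Omega1_sections(2)[OF a, of q]]) (use pq in auto)
    moreover have "(\<lambda>u. a q u) differentiable (at y)" if "p < y" "y < q" for y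
      using ac[of y q] that pq by (auto simp: real_differentiable_def)
    ultimately obtain m y where y: "p < y" "y < q" "DERIV (\<lambda>u. a q u) y :> m" "a q q - a q p = (q - p) * m"
      using MVT[OF pq(2), of "\<lambda>u. a q u"] by blast
    have "m = c q y" using DERIV_unique[OF y(3) ac[of y q]] y pq by simp
    have "a q q - a p p = (q - p) * (b x p + c q y)"
      using x(4) y(4) \<open>l = b x p\<close> \<open>m = c q y\<close> by (simp add: algebra_simps)
    moreover have "x \<in> {p<..<q}" "y \<in> {p<..<q}" using x y by auto
    ultimately show ?thesis by blast
  qed
  fix e :: real assume e: "0 < e"
  have ss: "(s, s) \<in> Omega1" using s by (simp add: Omega1_def)
  obtain d1 where d1: "d1 > 0" "\<forall>x\<in>Omega1. dist x (s, s) < d1 \<longrightarrow> dist (case x of (s, t) \<Rightarrow> b s t) (b s s) < e / 2"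
    using b[unfolded continuous_on_iff, rule_format, OF ss, of "e / 2"] e by auto
  obtain d2 where d2: "d2 > 0" "\<forall>x\<in>Omega1. dist x (s, s) < d2 \<longrightarrow> dist (case x of (s, t) \<Rightarrow> c s t) (c s s) < e / 2"
    using c[unfolded continuous_on_iff, rule_format, OF ss, of "e / 2"] e by auto
  define d where "d = min (min (d1 / 2) (d2 / 2)) (min s (1 - s))"
  have d: "d > 0" "2 * d \<le> d1" "2 * d \<le> d2" "d \<le> s" "d \<le> 1 - s" using d1(1) d2(1) s by (simp_all add: d_def min_def)
  have "norm ((a y y - a s s) / (y - s) - (b s s + c s s)) < e" if y: "y \<noteq> s" "norm (y - s) < d" for y
  proof -
    define p q where "p = min y s" and "q = max y s"
    have pq: "0 < p" "p < q" "q < 1" "p \<le> s" "s \<le> q" "q - p < d" using y d(4,5) s by (auto simp: p_def q_def)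
    obtain x z where xz: "x \<in> {p<..<q}" "z \<in> {p<..<q}" "a q q - a p p = (q - p) * (b x p + c q z)"
      using step[OF pq(1-3)] by blast
    have "(a y y - a s s) / (y - s) = (a q q - a p p) / (q - p)"
    proof (cases "y < s")
      case True
      then have "(a y y - a s s) / (y - s) = (- (a q q - a p p)) / (- (q - p))" by (simp add: p_def q_def)
      then show ?thesis by (simp only: minus_divide_divide)
    qed (use y in \<open>simp add: p_def q_def\<close>)
    also have "\<dots> = b x p + c q z" using xz(3) pq(2) by simp
    finally have quot: "(a y y - a s s) / (y - s) = b x p + c q z" .
    have dist: "dist (u, w) (s, s) < 2 * d" if "u \<in> {p..q}" "w \<in> {p..q}" for u w
    proof -
      have "dist (u, w) (s, s) \<le> \<bar>u - s\<bar> + \<bar>w - s\<bar>"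
        unfolding dist_Pair_Pair dist_real_def by (rule sqrt_sum_squares_le_sum_abs[THEN order_trans]) simp
      also have "\<dots> < 2 * d" using that pq by auto
      finally show ?thesis .
    qed
    have "dist (x, p) (s, s) < d1" "dist (q, z) (s, s) < d2"
      using dist[of x p] dist[of q z] xz pq d by auto
    then have "\<bar>b x p - b s s\<bar> < e / 2" "\<bar>c q z - c s s\<bar> < e / 2"
      using d1(2)[rule_format, of "(x, p)"] d2(2)[rule_format, of "(q, z)"] xz pq
      by (auto simp: Omega1_def dist_real_def)
    then show ?thesis unfolding quot real_norm_def by linarith
  qed
  then show "\<exists>d>0. \<forall>y. y \<noteq> s \<and> norm (y - s) < d \<longrightarrow> norm ((a y y - a s s) / (y - s) - (b s s + c s s)) < e"
    using d(1) by blast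
qed

lemma Ck_diagonal:
  assumes D: "triangle_derivs N D"
  shows "j + m \<le> N \<Longrightarrow> k + m \<le> N \<Longrightarrow> Ck m (\<lambda>s. of_real (D j k s s))"
proof (induction m arbitrary: j k)
  case 0
  then show ?case
    using Omega1_sections(3)[OF triangle_derivsD(1)[OF D, of j k]] by (auto intro: continuous_on_of_real)
next
  case (Suc m)
  have c: "continuous_on {0..1} (\<lambda>s. complex_of_real (D j k s s))"
    using Suc.prems Omega1_sections(3)[OF triangle_derivsD(1)[OF D, of j k]] by (auto intro: continuous_on_of_real)
  have "Ck m (\<lambda>s. of_real (D (Suc j) k s s) + of_real (D j (Suc k) s s))"
    by (intro Ck_add Suc.IH) (use Suc.prems in auto)
  with c show ?case
  proof (rule Ck_SucI)
    fix s :: real assume s: "s \<in> {0<..<1}"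
    have "((\<lambda>s. D j k s s) has_real_derivative D (Suc j) k s s + D j (Suc k) s s) (at s)"
      using Suc.prems by (intro diagonal_derivative triangle_derivsD[OF D] s) auto
    from has_vector_derivative_of_real[OF this]
    show "((\<lambda>s. complex_of_real (D j k s s)) has_vector_derivative
        of_real (D (Suc j) k s s) + of_real (D j (Suc k) s s)) (at s)"
      by simp
  qed
qed

lemma Ck_volterra_step:
  assumes D: "triangle_derivs N D" and jk: "j < N" "k \<le> N" and v: "continuous_on {0..1} v"
    and "Ck m (\<lambda>s. of_real (D j k s s) * v s + volterra (D (Suc j) k) v s)"
  shows "Ck (Suc m) (volterra (D j k) v)"
proof (rule Ck_SucI[OF _ assms(5)])
  have c: "continuous_on Omega1 (\<lambda>(s, t). D j k s t)" "continuous_on Omega1 (\<lambda>(s, t). D (Suc j) k s t)"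
    using jk by (auto intro: triangle_derivsD[OF D])
  show "continuous_on {0..1} (volterra (D j k) v)" by (rule continuous_on_volterra[OF c(1) v])
  show "(volterra (D j k) v has_vector_derivative
      of_real (D j k s s) * v s + volterra (D (Suc j) k) v s) (at s)" if "s \<in> {0<..<1}" for s
    by (rule volterra_derivative[OF c triangle_derivsD(2)[OF D] v that]) (use jk in auto)
qed

text \<open>One integration gains one derivative: differentiating produces a diagonal term, which has the
  smoothness of \<open>v\<close>, and a Volterra integral with the next derivative of the kernel, to which the
  induction hypothesis applies with \<open>v\<close> regarded as having one derivative less.\<close>

lemma Ck_volterra:
  assumes D: "triangle_derivs N D" and k: "k + m \<le> N"
  shows "Ck m v \<Longrightarrow> j + Suc m \<le> N \<Longrightarrow> Ck (Suc m) (volterra (D j k) v)"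
  using k
proof (induction m arbitrary: j)
  case 0
  have v: "continuous_on {0..1} v" using 0 by simp
  have "Ck 0 (\<lambda>s. of_real (D j k s s) * v s + volterra (D (Suc j) k) v s)"
    using 0 by (intro Ck_add Ck_mult Ck_diagonal[OF D])
      (auto intro!: continuous_on_volterra triangle_derivsD[OF D])
  then show ?case using 0 by (intro Ck_volterra_step[OF D] v) auto
next
  case (Suc m)
  have v: "continuous_on {0..1} v" using Suc.prems by (intro Ck_continuous)
  have "Ck (Suc m) (\<lambda>s. of_real (D j k s s) * v s + volterra (D (Suc j) k) v s)"
    using Suc.prems by (intro Ck_add Ck_mult Ck_diagonal[OF D] Suc.IH Ck_SucD[of m v]) auto
  then show ?case using Suc.prems by (intro Ck_volterra_step[OF D] v) auto
qed

section \<open>Smoothness of the two halves of a Green's kernel\<close>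

lemma interior_Omega1: "0 < t \<Longrightarrow> t < s \<Longrightarrow> s < 1 \<Longrightarrow> (s, t) \<in> interior Omega1"
proof (rule interiorI[of "{x. 0 < snd x} \<inter> {x. snd x < fst x} \<inter> {x. fst x < 1}"])
  show "open ({x :: real \<times> real. 0 < snd x} \<inter> {x. snd x < fst x} \<inter> {x. fst x < 1})"
    by (intro open_Int open_Collect_less continuous_intros)
qed (auto simp: Omega1_def)

lemma interior_Omega2: "0 < s \<Longrightarrow> s < t \<Longrightarrow> t < 1 \<Longrightarrow> (s, t) \<in> interior Omega2"
proof (rule interiorI[of "{x. 0 < fst x} \<inter> {x. fst x < snd x} \<inter> {x. snd x < 1}"])
  show "open ({x :: real \<times> real. 0 < fst x} \<inter> {x. fst x < snd x} \<inter> {x. snd x < 1})"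
    by (intro open_Int open_Collect_less continuous_intros)
qed (auto simp: Omega2_def)

lemma has_cont_partials_family:
  assumes "has_cont_partials \<Omega> ({0..N} \<times> {0..N}) f"
  shows "\<exists>D. (\<forall>s t. (s, t) \<in> \<Omega> \<longrightarrow> D 0 0 s t = f s t) \<and>
    (\<forall>j\<le>N. \<forall>k\<le>N. continuous_on \<Omega> (\<lambda>(s, t). D j k s t)) \<and>
    (\<forall>s t. (s, t) \<in> interior \<Omega> \<longrightarrow>
      (\<forall>j<N. \<forall>k\<le>N. ((\<lambda>u. D j k u t) has_real_derivative D (Suc j) k s t) (at s)) \<and>
      (\<forall>j\<le>N. \<forall>k<N. ((\<lambda>v. D j k s v) has_real_derivative D j (Suc k) s t) (at t)))"
proof -
  obtain D where D: "\<forall>(s, t)\<in>\<Omega>. D 0 0 s t = f s t"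
     "\<forall>(j, k)\<in>{0..N} \<times> {0..N}. continuous_on \<Omega> (\<lambda>(s, t). D j k s t) \<and>
        bounded ((\<lambda>(s, t). D j k s t) ` \<Omega>)"
     "\<forall>(s, t)\<in>interior \<Omega>.
        (\<forall>j k. (Suc j, k) \<in> {0..N} \<times> {0..N} \<longrightarrow>
           ((\<lambda>u. D j k u t) has_real_derivative D (Suc j) k s t) (at s)) \<and>
        (\<forall>j k. (j, Suc k) \<in> {0..N} \<times> {0..N} \<longrightarrow>
           ((\<lambda>v. D j k s v) has_real_derivative D j (Suc k) s t) (at t))"
    using assms unfolding has_cont_partials_def by (elim exE conjE) (rule that)
  show ?thesis
  proof (intro exI[of _ D] conjI allI impI)
    show "D 0 0 s t = f s t" if "(s, t) \<in> \<Omega>" for s t using D(1) that by auto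
    show "continuous_on \<Omega> (\<lambda>(s, t). D j k s t)" if "j \<le> N" "k \<le> N" for j k
      using bspec[OF D(2), of "(j, k)"] that by simp
    fix s t j k assume int: "(s, t) \<in> interior \<Omega>"
    show "((\<lambda>u. D j k u t) has_real_derivative D (Suc j) k s t) (at s)" if "j < N" "k \<le> N"
      using bspec[OF D(3) int] that by simp
    show "((\<lambda>v. D j k s v) has_real_derivative D j (Suc k) s t) (at t)" if "j \<le> N" "k < N"
      using bspec[OF D(3) int] that by simp
  qed
qed

lemma triangle_derivs_Omega1:
  assumes "has_cont_partials Omega1 ({0..N} \<times> {0..N}) f"
  shows "\<exists>D. triangle_derivs N D \<and> (\<forall>(s, t)\<in>Omega1. f s t = D 0 0 s t)"
proof -
  from has_cont_partials_family[OF assms]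
  obtain D where D: "\<forall>s t. (s, t) \<in> Omega1 \<longrightarrow> D 0 0 s t = f s t"
    "\<forall>j\<le>N. \<forall>k\<le>N. continuous_on Omega1 (\<lambda>(s, t). D j k s t)"
    "\<forall>s t. (s, t) \<in> interior Omega1 \<longrightarrow>
      (\<forall>j<N. \<forall>k\<le>N. ((\<lambda>u. D j k u t) has_real_derivative D (Suc j) k s t) (at s)) \<and>
      (\<forall>j\<le>N. \<forall>k<N. ((\<lambda>v. D j k s v) has_real_derivative D j (Suc k) s t) (at t))"
    by (elim exE conjE) (rule that)
  have "triangle_derivs N D"
    unfolding triangle_derivs_def
  proof (rule conjI[OF D(2)], intro allI impI)
    fix s t :: real assume "0 < t" "t < s" "s < 1"
    from D(3)[rule_format, OF interior_Omega1[OF this]]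
    show "(\<forall>j<N. \<forall>k\<le>N. ((\<lambda>u. D j k u t) has_real_derivative D (Suc j) k s t) (at s)) \<and>
        (\<forall>j\<le>N. \<forall>k<N. ((\<lambda>u. D j k s u) has_real_derivative D j (Suc k) s t) (at t))"
      by simp
  qed
  then show ?thesis using D(1) by (intro exI[of _ D]) auto
qed

text \<open>The reflection \<open>(s, t) \<mapsto> (1 - s, 1 - t)\<close> exchanges the two triangles, so every fact about the lower
  triangle transfers to the upper one.\<close>

lemma triangle_derivs_Omega2:
  assumes "has_cont_partials Omega2 ({0..N} \<times> {0..N}) f"
  shows "\<exists>D. triangle_derivs N D \<and> (\<forall>(s, t)\<in>Omega2. f s t = D 0 0 (1 - s) (1 - t))"
proof -
  from has_cont_partials_family[OF assms]
  obtain D where D: "\<forall>s t. (s, t) \<in> Omega2 \<longrightarrow> D 0 0 s t = f s t"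
    "\<forall>j\<le>N. \<forall>k\<le>N. continuous_on Omega2 (\<lambda>(s, t). D j k s t)"
    "\<forall>s t. (s, t) \<in> interior Omega2 \<longrightarrow>
      (\<forall>j<N. \<forall>k\<le>N. ((\<lambda>u. D j k u t) has_real_derivative D (Suc j) k s t) (at s)) \<and>
      (\<forall>j\<le>N. \<forall>k<N. ((\<lambda>v. D j k s v) has_real_derivative D j (Suc k) s t) (at t))"
    by (elim exE conjE) (rule that)
  define D' where "D' j k s t = (- 1) ^ (j + k) * D j k (1 - s) (1 - t)" for j k s t
  have flip: "((\<lambda>u. g (1 - u)) has_real_derivative - d) (at x)"
    if "(g has_real_derivative d) (at (1 - x))" for g d and x :: real
  proof -
    have "((\<lambda>u. 1 - u) has_real_derivative -1) (at x)" by (auto intro!: derivative_eq_intros)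
    from DERIV_chain2[OF that this] show ?thesis by simp
  qed
  have "triangle_derivs N D'"
    unfolding triangle_derivs_def
  proof (intro conjI allI impI)
    fix j k assume jk: "j \<le> N" "k \<le> N"
    have "continuous_on Omega1 (\<lambda>x. (- 1) ^ (j + k) * D j k (1 - fst x) (1 - snd x))"
      by (intro continuous_intros continuous_on_compose2[OF D(2)[rule_format, OF jk], of Omega1 "\<lambda>x. (1 - fst x, 1 - snd x)", simplified])
        (auto simp: Omega1_def Omega2_def)
    then show "continuous_on Omega1 (\<lambda>(s, t). D' j k s t)"
      by (simp add: D'_def case_prod_unfold)
  next
    fix s t :: real and j k assume st: "0 < t" "t < s" "s < 1" and jk: "j < N" "k \<le> N"
    have int: "(1 - s, 1 - t) \<in> interior Omega2" using st by (intro interior_Omega2) auto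
    have "((\<lambda>u. D j k u (1 - t)) has_real_derivative D (Suc j) k (1 - s) (1 - t)) (at (1 - s))"
      using D(3)[rule_format, OF int] jk by simp
    from DERIV_cmult[OF flip[OF this], of "(- 1) ^ (j + k)"]
    show "((\<lambda>u. D' j k u t) has_real_derivative D' (Suc j) k s t) (at s)"
      by (simp add: D'_def)
  next
    fix s t :: real and j k assume st: "0 < t" "t < s" "s < 1" and jk: "j \<le> N" "k < N"
    have int: "(1 - s, 1 - t) \<in> interior Omega2" using st by (intro interior_Omega2) auto
    have "((\<lambda>u. D j k (1 - s) u) has_real_derivative D j (Suc k) (1 - s) (1 - t)) (at (1 - t))"
      using D(3)[rule_format, OF int] jk by simp
    from DERIV_cmult[OF flip[OF this], of "(- 1) ^ (j + k)"]
    show "((\<lambda>u. D' j k s u) has_real_derivative D' j (Suc k) s t) (at t)"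
      by (simp add: D'_def)
  qed
  then show ?thesis using D(1) by (intro exI[of _ D']) (auto simp: D'_def)
qed

lemma triangle_lipschitz:
  assumes D: "triangle_derivs N D" and N: "1 \<le> N"
  shows "\<exists>M\<ge>0. (\<forall>t p q. 0 < t \<longrightarrow> t \<le> p \<longrightarrow> p \<le> q \<longrightarrow> q \<le> 1 \<longrightarrow> \<bar>D 0 0 q t - D 0 0 p t\<bar> \<le> M * (q - p)) \<and>
    (\<forall>s p q. s < 1 \<longrightarrow> 0 \<le> p \<longrightarrow> p \<le> q \<longrightarrow> q \<le> s \<longrightarrow> \<bar>D 0 0 s q - D 0 0 s p\<bar> \<le> M * (q - p))"
proof -
  have c: "continuous_on Omega1 (\<lambda>(s, t). D 0 0 s t)" "continuous_on Omega1 (\<lambda>(s, t). D (Suc 0) 0 s t)"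
      "continuous_on Omega1 (\<lambda>(s, t). D 0 (Suc 0) s t)"
    using N by (auto intro: triangle_derivsD[OF D])
  obtain M1 where M1: "M1 \<ge> 0" "\<And>s t. (s, t) \<in> Omega1 \<Longrightarrow> \<bar>D (Suc 0) 0 s t\<bar> \<le> M1"
    using Omega1_bounded[OF c(2)] by blast
  obtain M2 where M2: "M2 \<ge> 0" "\<And>s t. (s, t) \<in> Omega1 \<Longrightarrow> \<bar>D 0 (Suc 0) s t\<bar> \<le> M2"
    using Omega1_bounded[OF c(3)] by blast
  have 1: "\<bar>D 0 0 q t - D 0 0 p t\<bar> \<le> (M1 + M2) * (q - p)" if "0 < t" "t \<le> p" "p \<le> q" "q \<le> 1" for t p q
  proof -
    have "\<bar>D 0 0 q t - D 0 0 p t\<bar> \<le> M1 * (q - p)"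
    proof (rule lipschitz_of_derivative[where f' = "\<lambda>s. D (Suc 0) 0 s t"])
      show "continuous_on {p..q} (\<lambda>s. D 0 0 s t)"
        by (rule continuous_on_subset[OF Omega1_sections(1)[OF c(1)]]) (use that in auto)
      show "((\<lambda>s. D 0 0 s t) has_real_derivative D (Suc 0) 0 x t) (at x)" if "x \<in> {p<..<q}" for x
        using that \<open>0 < t\<close> \<open>t \<le> p\<close> \<open>q \<le> 1\<close> N by (intro triangle_derivsD(2)[OF D]) auto
    qed (use that in \<open>auto intro!: M1(2) simp: Omega1_def\<close>)
    also have "\<dots> \<le> (M1 + M2) * (q - p)" using that M1(1) M2(1) by (intro mult_right_mono) auto
    finally show ?thesis .
  qed
  have 2: "\<bar>D 0 0 s q - D 0 0 s p\<bar> \<le> (M1 + M2) * (q - p)" if "s < 1" "0 \<le> p" "p \<le> q" "q \<le> s" for s p q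
  proof -
    have "\<bar>D 0 0 s q - D 0 0 s p\<bar> \<le> M2 * (q - p)"
    proof (rule lipschitz_of_derivative[where f' = "\<lambda>t. D 0 (Suc 0) s t"])
      show "continuous_on {p..q} (\<lambda>t. D 0 0 s t)"
        by (rule continuous_on_subset[OF Omega1_sections(2)[OF c(1), of s]]) (use that in auto)
      show "((\<lambda>t. D 0 0 s t) has_real_derivative D 0 (Suc 0) s x) (at x)" if "x \<in> {p<..<q}" for x
        using that \<open>s < 1\<close> \<open>0 \<le> p\<close> \<open>q \<le> s\<close> N by (intro triangle_derivsD(3)[OF D]) auto
    qed (use that in \<open>auto intro!: M2(2) simp: Omega1_def\<close>)
    also have "\<dots> \<le> (M1 + M2) * (q - p)" using that M1(1) M2(1) by (intro mult_right_mono) auto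
    finally show ?thesis .
  qed
  show ?thesis using 1 2 M1(1) M2(1) by (intro exI[of _ "M1 + M2"]) simp
qed

lemma triangle_linear_approximation:
  assumes D: "triangle_derivs N D" and N: "2 \<le> N"
  shows "\<exists>M\<ge>0. \<forall>s a b. s < 1 \<longrightarrow> 0 \<le> a \<longrightarrow> a < b \<longrightarrow> b \<le> s \<longrightarrow>
    (\<exists>p. degree p \<le> 1 \<and> (\<forall>t\<in>{a<..<b}. cmod (of_real (D 0 0 s t) - poly p (of_real t)) \<le> M * (b - a)\<^sup>2))"
proof -
  have c: "continuous_on Omega1 (\<lambda>(s, t). D 0 i s t)" if "i \<le> 2" for i
    using N that by (auto intro: triangle_derivsD[OF D])
  obtain M where M: "M \<ge> 0" "\<And>s t. (s, t) \<in> Omega1 \<Longrightarrow> \<bar>D 0 2 s t\<bar> \<le> M"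
    using Omega1_bounded[OF c[of 2]] by blast
  have "\<exists>p. degree p \<le> 1 \<and> (\<forall>t\<in>{a<..<b}. cmod (of_real (D 0 0 s t) - poly p (of_real t)) \<le> M * (b - a)\<^sup>2)"
    if ab: "s < 1" "0 \<le> a" "a < b" "b \<le> s" for s a b
  proof -
    have "\<exists>p. (p = 0 \<or> degree p < 2) \<and>
        (\<forall>t\<in>{a<..<b}. cmod (complex_of_real (D 0 0 s t) - poly p (of_real t)) \<le> M * (b - a)\<^sup>2)"
    proof (rule local_polynomial_approximation[OF ab(3) M(1), of 2 "\<lambda>i t. of_real (D 0 i s t)"])
      show "continuous_on {a..b} (\<lambda>t. complex_of_real (D 0 i s t))" if "i < 2" for i
        using that ab
        by (intro continuous_on_of_real continuous_on_subset[OF Omega1_sections(2)[OF c[of i], of s]]) auto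
      show "((\<lambda>t. complex_of_real (D 0 i s t)) has_vector_derivative of_real (D 0 (Suc i) s x)) (at x)"
        if "i < 2" "x \<in> {a<..<b}" for i x
        using that ab N by (intro has_vector_derivative_of_real triangle_derivsD(3)[OF D]) auto
      show "cmod (complex_of_real (D 0 2 s x)) \<le> M" if "x \<in> {a<..<b}" for x
        using that ab M(2)[of s x] by (simp add: Omega1_def)
    qed
    then obtain p where "p = 0 \<or> degree p < 2"
        "\<forall>t\<in>{a<..<b}. cmod (complex_of_real (D 0 0 s t) - poly p (of_real t)) \<le> M * (b - a)\<^sup>2"
      by blast
    moreover from this(1) have "degree p \<le> 1" by auto
    ultimately show ?thesis by blast
  qed
  then show ?thesis using M(1) by blast
qed

lemma lipschitz_join:
  fixes f :: "real \<Rightarrow> real"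
  assumes lo: "\<And>p q. 0 \<le> p \<Longrightarrow> p \<le> q \<Longrightarrow> q \<le> c \<Longrightarrow> \<bar>f q - f p\<bar> \<le> M * (q - p)"
    and hi: "\<And>p q. c \<le> p \<Longrightarrow> p \<le> q \<Longrightarrow> q \<le> 1 \<Longrightarrow> \<bar>f q - f p\<bar> \<le> M * (q - p)"
    and c: "0 \<le> c" "c \<le> 1" and xy: "x \<in> {0..1}" "y \<in> {0..1}"
  shows "\<bar>f x - f y\<bar> \<le> M * \<bar>x - y\<bar>"
proof -
  have *: "\<bar>f q - f p\<bar> \<le> M * (q - p)" if pq: "0 \<le> p" "p \<le> q" "q \<le> 1" for p q
  proof -
    consider "q \<le> c" | "c \<le> p" | "p \<le> c" "c \<le> q" by linarith
    then show ?thesis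
    proof cases
      case 3
      have "\<bar>f q - f p\<bar> \<le> \<bar>f q - f c\<bar> + \<bar>f c - f p\<bar>" by linarith
      also have "\<dots> \<le> M * (q - c) + M * (c - p)"
        using 3 pq by (intro add_mono lo hi) auto
      finally show ?thesis by (simp add: algebra_simps)
    qed (use pq lo hi in auto)
  qed
  show ?thesis using *[of x y] *[of y x] xy by (cases "x \<le> y") (auto simp: abs_minus_commute)
qed

definition kernel_int :: "(real \<Rightarrow> real \<Rightarrow> real) \<Rightarrow> (real \<Rightarrow> complex) \<Rightarrow> real \<Rightarrow> complex" where
  "kernel_int \<kappa> f s = integral {0..1} (\<lambda>t. of_real (\<kappa> s t) * f t)"

text \<open>Both halves of the kernel are described by derivatives on the lower triangle, the upper half after
  reflection.\<close>

definition split_kernel ::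
  "nat \<Rightarrow> (real \<Rightarrow> real \<Rightarrow> real) \<Rightarrow> (nat \<Rightarrow> nat \<Rightarrow> real \<Rightarrow> real \<Rightarrow> real) \<Rightarrow>
   (nat \<Rightarrow> nat \<Rightarrow> real \<Rightarrow> real \<Rightarrow> real) \<Rightarrow> bool" where
  "split_kernel N \<kappa> D1 D2 \<longleftrightarrow>
     continuous_on ({0..1} \<times> {0..1}) (\<lambda>(s, t). \<kappa> s t) \<and>
     triangle_derivs N D1 \<and> (\<forall>(s, t)\<in>Omega1. \<kappa> s t = D1 0 0 s t) \<and>
     triangle_derivs N D2 \<and> (\<forall>(s, t)\<in>Omega2. \<kappa> s t = D2 0 0 (1 - s) (1 - t))"

lemma greens_kernel_split:
  assumes "greens_kernel r \<kappa>"
  obtains D1 D2 where "split_kernel (2 * r + 2) \<kappa> D1 D2"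
proof -
  obtain \<kappa>1 \<kappa>2 \<alpha> where k: "continuous_on ({0..1} \<times> {0..1}) (\<lambda>(s, t). \<kappa> s t)"
      "\<forall>(s, t)\<in>Omega1. \<kappa> s t = \<kappa>1 s t" "\<forall>(s, t)\<in>Omega2. \<kappa> s t = \<kappa>2 s t"
      "has_cont_partials Omega1 ({0..2 * r + 2} \<times> {0..2 * r + 2}) \<kappa>1"
      "has_cont_partials Omega2 ({0..2 * r + 2} \<times> {0..2 * r + 2}) \<kappa>2"
    using assms unfolding greens_kernel_def by blast
  obtain D1 where D1: "triangle_derivs (2 * r + 2) D1" "\<forall>(s, t)\<in>Omega1. \<kappa>1 s t = D1 0 0 s t"
    using triangle_derivs_Omega1[OF k(4)] by blast
  obtain D2 where D2: "triangle_derivs (2 * r + 2) D2" "\<forall>(s, t)\<in>Omega2. \<kappa>2 s t = D2 0 0 (1 - s) (1 - t)"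
    using triangle_derivs_Omega2[OF k(5)] by blast
  have "split_kernel (2 * r + 2) \<kappa> D1 D2"
    unfolding split_kernel_def
  proof (intro conjI)
    show "\<forall>(s, t)\<in>Omega1. \<kappa> s t = D1 0 0 s t" using k(2) D1(2) by fastforce
    show "\<forall>(s, t)\<in>Omega2. \<kappa> s t = D2 0 0 (1 - s) (1 - t)" using k(3) D2(2) by fastforce
  qed (fact k(1) D1(1) D2(1))+
  then show ?thesis by (rule that)
qed

lemma integral_reflect_unit:
  fixes f :: "real \<Rightarrow> complex"
  shows "integral {a..b} f = integral {1 - b..1 - a} (\<lambda>u. f (1 - u))"
proof -
  have "integral {a..b} f = integral {a - 1..b - 1} (\<lambda>x. f (x + 1))"
    by (rule integral_shift_real_ivl[symmetric])
  also have "\<dots> = integral {- (b - 1)..- (a - 1)} (\<lambda>x. f (- x + 1))"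
    by (subst Henstock_Kurzweil_Integration.integral_reflect_real[where f = "\<lambda>x. f (x + 1)" and a = "a - 1" and b = "b - 1", symmetric])
      (rule refl)
  finally show ?thesis by (simp add: add.commute)
qed

lemma AE_open_interval: "AE t in lebesgue_on {a..b}. t \<in> {a<..<b::real}"
proof -
  have "AE t in lebesgue. t \<notin> {a, b}"
    by (rule AE_I'[of "{a, b}"]) (auto simp: negligible_iff_null_sets[symmetric])
  then have "AE t in lebesgue. t \<in> {a..b} \<longrightarrow> t \<in> {a<..<b}"
    by eventually_elim auto
  then show ?thesis by (subst AE_restrict_space_iff) auto
qed

context
  fixes N \<kappa> D1 D2
  assumes \<kappa>: "split_kernel N \<kappa> D1 D2" and N: "2 \<le> N"
begin

lemma kernel_continuous: "continuous_on ({0..1} \<times> {0..1}) (\<lambda>(s, t). \<kappa> s t)"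
  using \<kappa> by (simp add: split_kernel_def)

lemma kernel_derivs: "triangle_derivs N D1" "triangle_derivs N D2"
  using \<kappa> by (simp_all add: split_kernel_def)

lemma kernel_eq:
  "0 \<le> t \<Longrightarrow> t \<le> s \<Longrightarrow> s \<le> 1 \<Longrightarrow> \<kappa> s t = D1 0 0 s t"
  "0 \<le> s \<Longrightarrow> s \<le> t \<Longrightarrow> t \<le> 1 \<Longrightarrow> \<kappa> s t = D2 0 0 (1 - s) (1 - t)"
  using \<kappa> by (auto simp: split_kernel_def Omega1_def Omega2_def)

lemma kernel_section:
  assumes s: "s \<in> {0..1}"
  shows "continuous_on {0..1} (\<lambda>t. \<kappa> s t)"
proof -
  have "continuous_on {0..1} (\<lambda>t. case (s, t) of (s, t) \<Rightarrow> \<kappa> s t)"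
    by (rule continuous_on_compose2[OF kernel_continuous]) (use s in \<open>auto intro!: continuous_intros\<close>)
  then show ?thesis by simp
qed

lemma ess_bounded_kernel_section:
  assumes "s \<in> {0..1}"
  shows "ess_bounded (\<lambda>t. of_real (\<kappa> s t))"
  by (rule ess_bounded_continuous) (intro continuous_intros kernel_section assms)

text \<open>The kernel itself is continuous across the diagonal, so the Lipschitz bounds on the two triangles
  join to a bound on the whole section.\<close>

lemma kernel_lipschitz:
  "\<exists>M\<ge>0. (\<forall>t\<in>{0<..<1}. \<forall>x\<in>{0..1}. \<forall>y\<in>{0..1}. \<bar>\<kappa> x t - \<kappa> y t\<bar> \<le> M * \<bar>x - y\<bar>) \<and>
    (\<forall>s\<in>{0<..<1}. \<forall>x\<in>{0..1}. \<forall>y\<in>{0..1}. \<bar>\<kappa> s x - \<kappa> s y\<bar> \<le> M * \<bar>x - y\<bar>)"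
proof -
  have N1: "1 \<le> N" using N by simp
  obtain M1 where M1: "M1 \<ge> 0"
    "\<And>t p q. 0 < t \<Longrightarrow> t \<le> p \<Longrightarrow> p \<le> q \<Longrightarrow> q \<le> 1 \<Longrightarrow> \<bar>D1 0 0 q t - D1 0 0 p t\<bar> \<le> M1 * (q - p)"
    "\<And>s p q. s < 1 \<Longrightarrow> 0 \<le> p \<Longrightarrow> p \<le> q \<Longrightarrow> q \<le> s \<Longrightarrow> \<bar>D1 0 0 s q - D1 0 0 s p\<bar> \<le> M1 * (q - p)"
    using triangle_lipschitz[OF kernel_derivs(1) N1] by blast
  obtain M2 where M2: "M2 \<ge> 0"
    "\<And>t p q. 0 < t \<Longrightarrow> t \<le> p \<Longrightarrow> p \<le> q \<Longrightarrow> q \<le> 1 \<Longrightarrow> \<bar>D2 0 0 q t - D2 0 0 p t\<bar> \<le> M2 * (q - p)"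
    "\<And>s p q. s < 1 \<Longrightarrow> 0 \<le> p \<Longrightarrow> p \<le> q \<Longrightarrow> q \<le> s \<Longrightarrow> \<bar>D2 0 0 s q - D2 0 0 s p\<bar> \<le> M2 * (q - p)"
    using triangle_lipschitz[OF kernel_derivs(2) N1] by blast
  define M where "M = max M1 M2"
  have le: "z \<le> M1 * d \<Longrightarrow> 0 \<le> d \<Longrightarrow> z \<le> M * d" "z \<le> M2 * d \<Longrightarrow> 0 \<le> d \<Longrightarrow> z \<le> M * d" for z d
    by (erule order_trans, rule mult_right_mono; simp add: M_def)+
  have "\<bar>\<kappa> x t - \<kappa> y t\<bar> \<le> M * \<bar>x - y\<bar>" if t: "t \<in> {0<..<1}" and xy: "x \<in> {0..1}" "y \<in> {0..1}" for t x y
  proof (rule lipschitz_join[where c = t])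
    show "\<bar>\<kappa> q t - \<kappa> p t\<bar> \<le> M * (q - p)" if "t \<le> p" "p \<le> q" "q \<le> 1" for p q
      using M1(2)[of t p q] that t by (intro le(1)) (auto simp: kernel_eq(1))
    show "\<bar>\<kappa> q t - \<kappa> p t\<bar> \<le> M * (q - p)" if "0 \<le> p" "p \<le> q" "q \<le> t" for p q
      using M2(2)[of "1 - t" "1 - q" "1 - p"] that t
      by (intro le(2)) (auto simp: kernel_eq(2) abs_minus_commute)
  qed (use t xy in auto)
  moreover have "\<bar>\<kappa> s x - \<kappa> s y\<bar> \<le> M * \<bar>x - y\<bar>" if s: "s \<in> {0<..<1}" and xy: "x \<in> {0..1}" "y \<in> {0..1}" for s x y
  proof (rule lipschitz_join[where c = s])
    show "\<bar>\<kappa> s q - \<kappa> s p\<bar> \<le> M * (q - p)" if "0 \<le> p" "p \<le> q" "q \<le> s" for p q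
      using M1(3)[of s p q] that s by (intro le(1)) (auto simp: kernel_eq(1))
    show "\<bar>\<kappa> s q - \<kappa> s p\<bar> \<le> M * (q - p)" if "s \<le> p" "p \<le> q" "q \<le> 1" for p q
      using M2(3)[of "1 - s" "1 - q" "1 - p"] that s
      by (intro le(2)) (auto simp: kernel_eq(2) abs_minus_commute)
  qed (use s xy in auto)
  ultimately show ?thesis using M1(1) by (intro exI[of _ M]) (auto simp: M_def)
qed

text \<open>The restriction on the interval keeps it in one of the triangles: across the diagonal the kernel
  has a kink.\<close>

lemma kernel_linear_approximation:
  "\<exists>M\<ge>0. \<forall>s\<in>{0<..<1}. \<forall>a b. 0 \<le> a \<longrightarrow> a < b \<longrightarrow> b \<le> 1 \<longrightarrow> b \<le> s \<or> s \<le> a \<longrightarrow>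
    (\<exists>p. degree p \<le> 1 \<and> (\<forall>t\<in>{a<..<b}. cmod (of_real (\<kappa> s t) - poly p (of_real t)) \<le> M * (b - a)\<^sup>2))"
proof -
  obtain M1 where M1: "M1 \<ge> 0" "\<And>s a b. s < 1 \<Longrightarrow> 0 \<le> a \<Longrightarrow> a < b \<Longrightarrow> b \<le> s \<Longrightarrow>
    (\<exists>p. degree p \<le> 1 \<and> (\<forall>t\<in>{a<..<b}. cmod (of_real (D1 0 0 s t) - poly p (of_real t)) \<le> M1 * (b - a)\<^sup>2))"
    using triangle_linear_approximation[OF kernel_derivs(1) N] by blast
  obtain M2 where M2: "M2 \<ge> 0" "\<And>s a b. s < 1 \<Longrightarrow> 0 \<le> a \<Longrightarrow> a < b \<Longrightarrow> b \<le> s \<Longrightarrow>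
    (\<exists>p. degree p \<le> 1 \<and> (\<forall>t\<in>{a<..<b}. cmod (of_real (D2 0 0 s t) - poly p (of_real t)) \<le> M2 * (b - a)\<^sup>2))"
    using triangle_linear_approximation[OF kernel_derivs(2) N] by blast
  define M where "M = max M1 M2"
  have le: "z \<le> M1 * d\<^sup>2 \<Longrightarrow> z \<le> M * d\<^sup>2" "z \<le> M2 * d\<^sup>2 \<Longrightarrow> z \<le> M * d\<^sup>2" for z d :: real
    by (erule order_trans, rule mult_right_mono; simp add: M_def)+
  have "\<exists>p. degree p \<le> 1 \<and> (\<forall>t\<in>{a<..<b}. cmod (of_real (\<kappa> s t) - poly p (of_real t)) \<le> M * (b - a)\<^sup>2)"
    if s: "s \<in> {0<..<1}" and ab: "0 \<le> a" "a < b" "b \<le> 1" "b \<le> s \<or> s \<le> a" for s a b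
    using ab(4)
  proof
    assume bs: "b \<le> s"
    obtain p where p: "degree p \<le> 1"
        "\<And>t. t \<in> {a<..<b} \<Longrightarrow> cmod (of_real (D1 0 0 s t) - poly p (of_real t)) \<le> M1 * (b - a)\<^sup>2"
      using M1(2)[of s a b] ab s bs by auto
    have "cmod (of_real (\<kappa> s t) - poly p (of_real t)) \<le> M * (b - a)\<^sup>2" if t: "t \<in> {a<..<b}" for t
      using le(1)[OF p(2)[OF t]] kernel_eq(1)[of t s] t ab bs s by simp
    then show ?thesis using p(1) by blast
  next
    assume sa: "s \<le> a"
    have "\<exists>p. degree p \<le> 1 \<and> (\<forall>t\<in>{1 - b<..<1 - a}.
        cmod (of_real (D2 0 0 (1 - s) t) - poly p (of_real t)) \<le> M2 * (1 - a - (1 - b))\<^sup>2)"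
      using ab s sa by (intro M2(2)) auto
    then obtain p where p: "degree p \<le> 1"
        "\<And>t. t \<in> {1 - b<..<1 - a} \<Longrightarrow> cmod (of_real (D2 0 0 (1 - s) t) - poly p (of_real t)) \<le> M2 * (b - a)\<^sup>2"
      by auto
    define q where "q = pcompose p [:1, -1:]"
    have "degree q \<le> 1"
      using p(1) by (simp add: q_def degree_pcompose)
    moreover have "cmod (of_real (\<kappa> s t) - poly q (of_real t)) \<le> M * (b - a)\<^sup>2" if t: "t \<in> {a<..<b}" for t
    proof -
      have "cmod (of_real (D2 0 0 (1 - s) (1 - t)) - poly p (of_real (1 - t))) \<le> M * (b - a)\<^sup>2"
        by (rule le(2)[OF p(2)]) (use t in auto)
      moreover have "\<kappa> s t = D2 0 0 (1 - s) (1 - t)" using kernel_eq(2)[of s t] t ab sa s by simp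
      moreover have "poly q (of_real t) = poly p (of_real (1 - t))" by (simp add: q_def poly_pcompose)
      ultimately show ?thesis by simp
    qed
    ultimately show ?thesis by blast
  qed
  then show ?thesis using M1(1) by (intro exI[of _ M]) (auto simp: M_def)
qed

lemma kernel_int_volterra:
  assumes w: "continuous_on {0..1} w" and s: "s \<in> {0..1}"
  shows "kernel_int \<kappa> w s = volterra (D1 0 0) w s + volterra (D2 0 0) (\<lambda>u. w (1 - u)) (1 - s)"
proof -
  have "continuous_on {0..1} (\<lambda>t. of_real (\<kappa> s t) * w t)"
    by (intro continuous_intros kernel_section s w)
  then have "kernel_int \<kappa> w s = integral {0..s} (\<lambda>t. of_real (\<kappa> s t) * w t) + integral {s..1} (\<lambda>t. of_real (\<kappa> s t) * w t)"
    unfolding kernel_int_def using s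
    by (intro Henstock_Kurzweil_Integration.integral_combine[symmetric] integrable_continuous_interval) auto
  also have "integral {0..s} (\<lambda>t. of_real (\<kappa> s t) * w t) = volterra (D1 0 0) w s"
    unfolding volterra_def by (rule integral_cong) (use s in \<open>auto simp: kernel_eq(1)\<close>)
  also have "integral {s..1} (\<lambda>t. of_real (\<kappa> s t) * w t) = integral {s..1} (\<lambda>t. of_real (D2 0 0 (1 - s) (1 - t)) * w t)"
    by (rule integral_cong) (use s in \<open>auto simp: kernel_eq(2)\<close>)
  also have "\<dots> = volterra (D2 0 0) (\<lambda>u. w (1 - u)) (1 - s)"
    unfolding volterra_def by (subst integral_reflect_unit) simp
  finally show ?thesis .
qed

lemma Ck_kernel_int:
  assumes w: "Ck m w" and m: "Suc m \<le> N"
  shows "Ck (Suc m) (kernel_int \<kappa> w)"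
proof (rule Ck_cong)
  show "Ck (Suc m) (\<lambda>s. volterra (D1 0 0) w s + volterra (D2 0 0) (\<lambda>u. w (1 - u)) (1 - s))"
    by (intro Ck_add Ck_reflect[of "Suc m" "volterra (D2 0 0) (\<lambda>u. w (1 - u))"]
        Ck_volterra[OF kernel_derivs(1)] Ck_volterra[OF kernel_derivs(2)] Ck_reflect[OF w] w)
      (use m in auto)
  show "volterra (D1 0 0) w s + volterra (D2 0 0) (\<lambda>u. w (1 - u)) (1 - s) = kernel_int \<kappa> w s"
    if "s \<in> {0..1}" for s
    by (rule kernel_int_volterra[OF Ck_continuous[OF w] that, symmetric])
qed

text \<open>Bootstrapping: the equation raises the smoothness by one, as long as the kernel has enough
  derivatives.\<close>

lemma eigenfunction_smooth:
  assumes w: "continuous_on {0..1} w" and eq: "\<And>s. s \<in> {0..1} \<Longrightarrow> w s = c * kernel_int \<kappa> w s"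
  shows "m \<le> N \<Longrightarrow> Ck m w"
proof (induction m)
  case (Suc m)
  have "Ck (Suc m) (\<lambda>s. c * kernel_int \<kappa> w s)"
    using Suc by (intro Ck_mult Ck_const Ck_kernel_int) auto
  then show ?case by (rule Ck_cong) (simp add: eq)
qed (use w in simp)

end

section \<open>The integral operator on essentially bounded functions\<close>

lemma linf_eqI:
  assumes "AE t in leb01. rep_linf x t = rep_linf y t"
  shows "x = y"
proof -
  have "AE t in leb01. cmod (rep_linf (x - y) t) \<le> 0"
    using assms rep_linf_minus[of x y] by eventually_elim simp
  then have "norm (x - y) \<le> 0" by (simp add: norm_linf_le_iff)
  then show ?thesis by simp
qed

lemma rep_linf_add: "AE t in leb01. rep_linf (x + y) t = rep_linf x t + rep_linf y t"
  using rep_linf_minus[of "x + y" y] by eventually_elim simp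

lemma rep_linf_scaleC: "AE t in leb01. rep_linf (c *\<^sub>C x) t = c * rep_linf x t"
proof -
  have "linf_rel (rep_linf x) (rep_linf x)" by (simp add: linf_rel_def ess_bounded_rep)
  from scaleC_linf.abs_eq[OF this, of c]
  have "c *\<^sub>C x = abs_linf (\<lambda>t. c * rep_linf x t)" by (simp add: abs_rep_linf)
  then show ?thesis using rep_abs_linf[OF ess_bounded_cmult[OF ess_bounded_rep[of x], of c]] by simp
qed

lemma rep_linf_le_norm: "AE t in leb01. cmod (rep_linf x t) \<le> norm x"
  using norm_linf_le_iff[of x "norm x"] by simp

definition orthogonal_on_cells :: "nat \<Rightarrow> nat \<Rightarrow> linf \<Rightarrow> bool" where
  "orthogonal_on_cells m n g \<longleftrightarrow> (\<forall>j\<in>{1..n}. \<forall>p. degree p \<le> m \<longrightarrow>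
     integral (cell n j) (\<lambda>t. rep_linf g t * poly p (of_real t)) = 0)"

context
  fixes N \<kappa> D1 D2
  assumes \<kappa>: "split_kernel N \<kappa> D1 D2" and N: "2 \<le> N"
begin

lemma integrand_ess_bounded:
  assumes "s \<in> {0..1}" "ess_bounded f"
  shows "ess_bounded (\<lambda>t. of_real (\<kappa> s t) * f t)"
  by (rule ess_bounded_mult[OF ess_bounded_kernel_section[OF \<kappa> N assms(1)] assms(2)])

lemma kernel_int_eq_LINT:
  "s \<in> {0..1} \<Longrightarrow> ess_bounded f \<Longrightarrow> (LINT t|leb01. of_real (\<kappa> s t) * f t) = kernel_int \<kappa> f s"
  unfolding kernel_int_def by (rule LINT_eq_integral[OF integrand_ess_bounded order_refl])

lemma rep_integral_op_kernel_int:
  "AE s in leb01. rep_linf (integral_op \<kappa> x) s = kernel_int \<kappa> (rep_linf x) s"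
  using rep_integral_op[OF kernel_continuous[OF \<kappa> N], of x] AE_space[of leb01]
  by eventually_elim (simp add: kernel_int_eq_LINT ess_bounded_rep)

lemma kernel_int_cong:
  assumes "s \<in> {0..1}" "ess_bounded f" "ess_bounded g" "AE t in leb01. f t = g t"
  shows "kernel_int \<kappa> f s = kernel_int \<kappa> g s"
  unfolding kernel_int_def
proof (rule ess_bounded_integral_cong[OF _ _ order_refl])
  show "AE t in leb01. of_real (\<kappa> s t) * f t = of_real (\<kappa> s t) * g t"
    using assms(4) by eventually_elim simp
qed (intro integrand_ess_bounded assms)+

lemma kernel_int_add:
  assumes "s \<in> {0..1}" "ess_bounded f" "ess_bounded g"
  shows "kernel_int \<kappa> (\<lambda>t. f t + g t) s = kernel_int \<kappa> f s + kernel_int \<kappa> g s"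
  unfolding kernel_int_def distrib_left
  by (intro Henstock_Kurzweil_Integration.integral_add ess_bounded_integrable_on integrand_ess_bounded assms order_refl)

lemma kernel_int_cmult:
  "kernel_int \<kappa> (\<lambda>t. c * f t) s = c * kernel_int \<kappa> f s"
  unfolding kernel_int_def by (subst integral_mult_right[symmetric]) (simp add: mult_ac)

text \<open>The values of the operator are classes of functions, so each identity is proved almost everywhere
  for the representatives.\<close>

lemma integral_op_complex_linear: "complex_linear (integral_op \<kappa>)"
proof -
  have add: "integral_op \<kappa> (x + y) = integral_op \<kappa> x + integral_op \<kappa> y" for x y
  proof (rule linf_eqI)
    show "AE s in leb01. rep_linf (integral_op \<kappa> (x + y)) s = rep_linf (integral_op \<kappa> x + integral_op \<kappa> y) s"
      using rep_integral_op_kernel_int[of "x + y"] rep_integral_op_kernel_int[of x]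
        rep_integral_op_kernel_int[of y] rep_linf_add[of "integral_op \<kappa> x" "integral_op \<kappa> y"] AE_space[of leb01]
    proof eventually_elim
      case (elim s)
      have "kernel_int \<kappa> (rep_linf (x + y)) s = kernel_int \<kappa> (\<lambda>t. rep_linf x t + rep_linf y t) s"
        using elim(5) by (intro kernel_int_cong rep_linf_add ess_bounded_add ess_bounded_rep) simp
      also have "\<dots> = kernel_int \<kappa> (rep_linf x) s + kernel_int \<kappa> (rep_linf y) s"
        using elim(5) by (intro kernel_int_add ess_bounded_rep) simp
      finally show ?case using elim by simp
    qed
  qed
  have scale: "integral_op \<kappa> (c *\<^sub>C x) = c *\<^sub>C integral_op \<kappa> x" for c x
  proof (rule linf_eqI)
    show "AE s in leb01. rep_linf (integral_op \<kappa> (c *\<^sub>C x)) s = rep_linf (c *\<^sub>C integral_op \<kappa> x) s"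
      using rep_integral_op_kernel_int[of "c *\<^sub>C x"] rep_integral_op_kernel_int[of x]
        rep_linf_scaleC[of c "integral_op \<kappa> x"] AE_space[of leb01]
    proof eventually_elim
      case (elim s)
      have "kernel_int \<kappa> (rep_linf (c *\<^sub>C x)) s = kernel_int \<kappa> (\<lambda>t. c * rep_linf x t) s"
        using elim(4) by (intro kernel_int_cong rep_linf_scaleC ess_bounded_cmult ess_bounded_rep) simp
      then show ?case using elim by (simp add: kernel_int_cmult)
    qed
  qed
  have "compact ((\<lambda>(s, t). \<kappa> s t) ` ({0..1} \<times> {0..1}))"
    by (rule compact_continuous_image[OF kernel_continuous[OF \<kappa> N]]) (intro compact_Times compact_Icc)
  then obtain M where M: "\<And>s t. s \<in> {0..1} \<Longrightarrow> t \<in> {0..1} \<Longrightarrow> \<bar>\<kappa> s t\<bar> \<le> M"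
    unfolding bounded_iff compact_eq_bounded_closed by fastforce
  have bound: "norm (integral_op \<kappa> x) \<le> norm x * M" for x
    unfolding norm_linf_le_iff
    using rep_integral_op_kernel_int[of x] AE_space[of leb01]
  proof eventually_elim
    case (elim s)
    then have s: "s \<in> {0..1}" by simp
    have "AE t in leb01. cmod (of_real (\<kappa> s t) * rep_linf x t) \<le> norm x * M"
      using rep_linf_le_norm[of x] AE_space[of leb01]
    proof eventually_elim
      case (elim t)
      then show ?case using mult_mono[OF elim(1) M[OF s, of t]] by (simp add: norm_mult mult.commute)
    qed
    from ess_bounded_integral_bound[OF integrand_ess_bounded[OF s ess_bounded_rep] order_refl _ this]
    show ?case by (simp add: elim(1) kernel_int_def)
  qed
  have "bounded_linear (integral_op \<kappa>)"
    by (rule bounded_linear_intro[OF add _ bound]) (simp add: scaleC_of_real[symmetric] scale)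
  then show ?thesis by (simp add: complex_linear_def scale)
qed

lemma kernel_int_lipschitz:
  "\<exists>M\<ge>0. \<forall>x. \<forall>s\<in>{0..1}. \<forall>s'\<in>{0..1}.
     cmod (kernel_int \<kappa> (rep_linf x) s - kernel_int \<kappa> (rep_linf x) s') \<le> M * norm x * \<bar>s - s'\<bar>"
proof -
  obtain M where M: "M \<ge> 0" "\<And>t x y. t \<in> {0<..<1} \<Longrightarrow> x \<in> {0..1} \<Longrightarrow> y \<in> {0..1} \<Longrightarrow> \<bar>\<kappa> x t - \<kappa> y t\<bar> \<le> M * \<bar>x - y\<bar>"
    using kernel_lipschitz[OF \<kappa> N] by blast
  have "cmod (kernel_int \<kappa> (rep_linf x) s - kernel_int \<kappa> (rep_linf x) s') \<le> M * norm x * \<bar>s - s'\<bar>"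
    if s: "s \<in> {0..1}" "s' \<in> {0..1}" for x s s'
  proof -
    let ?f = "\<lambda>t. of_real (\<kappa> s t) * rep_linf x t - of_real (\<kappa> s' t) * rep_linf x t"
    have eb: "ess_bounded ?f"
      using s by (intro ess_bounded_diff integrand_ess_bounded ess_bounded_rep)
    have "AE t in leb01. cmod (?f t) \<le> M * norm x * \<bar>s - s'\<bar>"
      using rep_linf_le_norm[of x] AE_open_interval[of 0 1]
    proof eventually_elim
      case (elim t)
      have "cmod (?f t) = \<bar>\<kappa> s t - \<kappa> s' t\<bar> * cmod (rep_linf x t)"
        unfolding left_diff_distrib[symmetric] of_real_diff[symmetric] norm_mult norm_of_real ..
      also have "\<dots> \<le> (M * \<bar>s - s'\<bar>) * norm x"
        using M(1) by (intro mult_mono M(2) elim s) auto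
      finally show ?case by (simp add: mult_ac)
    qed
    from ess_bounded_integral_bound[OF eb order_refl _ this]
    have "cmod (integral {0..1} ?f) \<le> M * norm x * \<bar>s - s'\<bar>" by simp
    moreover have "integral {0..1} ?f = kernel_int \<kappa> (rep_linf x) s - kernel_int \<kappa> (rep_linf x) s'"
      unfolding kernel_int_def using s
      by (intro Henstock_Kurzweil_Integration.integral_diff ess_bounded_integrable_on integrand_ess_bounded
          ess_bounded_rep order_refl)
    ultimately show ?thesis by simp
  qed
  then show ?thesis using M(1) by blast
qed

text \<open>For arbitrary bounded \<open>x\<close> the function \<open>K x\<close> is merely Lipschitz; constants already give the
  full order.\<close>

lemma integral_op_constant_approximation:
  "\<exists>M\<ge>0. \<forall>n\<ge>1. \<forall>x. \<forall>j\<in>{1..n}. \<exists>p. degree p \<le> 2 * r \<and>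
     (AE t in lebesgue_on (cell n j).
        cmod (rep_linf (integral_op \<kappa> x) t - poly p (of_real t)) \<le> M * norm x / real n)"
proof -
  obtain M where M: "M \<ge> 0" "\<And>x s s'. s \<in> {0..1} \<Longrightarrow> s' \<in> {0..1} \<Longrightarrow>
     cmod (kernel_int \<kappa> (rep_linf x) s - kernel_int \<kappa> (rep_linf x) s') \<le> M * norm x * \<bar>s - s'\<bar>"
    using kernel_int_lipschitz by blast
  have "\<exists>p. degree p \<le> 2 * r \<and>
     (AE t in lebesgue_on (cell n j).
        cmod (rep_linf (integral_op \<kappa> x) t - poly p (of_real t)) \<le> M * norm x / real n)"
    if n: "n \<ge> 1" and j: "j \<in> {1..n}" for n x j
  proof -
    let ?s = "real j / real n"
    have s: "?s \<in> {0..1}" using n j by (auto simp: divide_simps)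
    have "AE t in lebesgue_on (cell n j). cmod (rep_linf (integral_op \<kappa> x) t -
        poly [:kernel_int \<kappa> (rep_linf x) ?s:] (of_real t)) \<le> M * norm x / real n"
      using AE_lebesgue_on_mono[OF rep_integral_op_kernel_int cell_subset[OF n j], of x]
        AE_space[of "lebesgue_on (cell n j)"]
    proof eventually_elim
      case (elim t)
      then have t: "t \<in> cell n j" by simp
      then have "t \<in> {0..1}" using cell_subset[OF n j] by blast
      from M(2)[OF this s, of x]
      have "cmod (rep_linf (integral_op \<kappa> x) t - kernel_int \<kappa> (rep_linf x) ?s) \<le> M * norm x * \<bar>t - ?s\<bar>"
        by (simp add: elim(1))
      also have "\<dots> \<le> M * norm x * (1 / real n)"
        using t cell_length[of j n] M(1) by (intro mult_left_mono) auto
      finally show ?case by simp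
    qed
    then show ?thesis by (intro exI[of _ "[:kernel_int \<kappa> (rep_linf x) ?s:]"]) simp
  qed
  then show ?thesis using M(1) by blast
qed

text \<open>Almost everywhere \<open>v\<close> equals \<open>K v / lam\<close>, which has a continuous representative; the smoothness
  of that representative is then bootstrapped.\<close>

lemma eigenvector_approximation:
  assumes v: "integral_op \<kappa> v = lam *\<^sub>C v" and lam: "lam \<noteq> 0" and m: "Suc m \<le> N"
  shows "\<exists>B\<ge>0. \<forall>n\<ge>1. \<forall>j\<in>{1..n}. \<exists>p. degree p \<le> m \<and>
     (AE t in lebesgue_on (cell n j). cmod (rep_linf v t - poly p (of_real t)) \<le> B * (1 / real n) ^ Suc m)"
proof -
  define w where "w s = (1 / lam) * kernel_int \<kappa> (rep_linf v) s" for s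
  have vw: "AE t in leb01. rep_linf v t = w t"
    using rep_integral_op_kernel_int[of v] rep_linf_scaleC[of lam v] unfolding v
    by eventually_elim (simp add: w_def lam nonzero_eq_divide_eq mult.commute)
  obtain M where M: "M \<ge> 0" "\<And>s s'. s \<in> {0..1} \<Longrightarrow> s' \<in> {0..1} \<Longrightarrow>
     cmod (kernel_int \<kappa> (rep_linf v) s - kernel_int \<kappa> (rep_linf v) s') \<le> M * norm v * \<bar>s - s'\<bar>"
    using kernel_int_lipschitz by blast
  have "continuous_on {0..1} (kernel_int \<kappa> (rep_linf v))"
    by (rule lipschitz_on_continuous_on[OF lipschitz_onI[where L = "M * norm v"]])
      (use M in \<open>auto simp: dist_norm\<close>)
  then have w: "continuous_on {0..1} w" unfolding w_def by (intro continuous_intros)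
  have eq: "w s = (1 / lam) * kernel_int \<kappa> w s" if "s \<in> {0..1}" for s
    by (simp only: w_def[of s] kernel_int_cong[OF that ess_bounded_rep ess_bounded_continuous[OF w] vw])
  have "Ck (Suc m) w" by (rule eigenfunction_smooth[OF \<kappa> N w eq m])
  from Ck_approximation[OF this]
  obtain B where B: "B \<ge> 0" "\<And>a b. a < b \<Longrightarrow> {a..b} \<subseteq> {0..1} \<Longrightarrow>
    \<exists>p. (p = 0 \<or> degree p < Suc m) \<and>
      (\<forall>x\<in>{a<..<b}. cmod (w x - poly p (of_real x)) \<le> B * (b - a) ^ Suc m)" by blast
  have "\<exists>p. degree p \<le> m \<and>
     (AE t in lebesgue_on (cell n j). cmod (rep_linf v t - poly p (of_real t)) \<le> B * (1 / real n) ^ Suc m)"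
    if n: "n \<ge> 1" and j: "j \<in> {1..n}" for n j
  proof -
    have "(real j - 1) / real n < real j / real n" using n by (simp add: divide_strict_right_mono)
    from B(2)[OF this cell_subset[OF n j], unfolded cell_length]
    obtain p where p: "p = 0 \<or> degree p < Suc m"
      "\<forall>x\<in>{(real j - 1) / real n<..<real j / real n}.
        cmod (w x - poly p (of_real x)) \<le> B * (1 / real n) ^ Suc m"
      by (elim exE conjE) (rule that)
    have "AE t in lebesgue_on (cell n j). cmod (rep_linf v t - poly p (of_real t)) \<le> B * (1 / real n) ^ Suc m"
      using AE_lebesgue_on_mono[OF vw cell_subset[OF n j]] AE_open_interval
    proof eventually_elim
      case (elim t)
      then show ?case using bspec[OF p(2) elim(2)] by (simp only: elim(1))
    qed
    moreover have "degree p \<le> m" using p(1) by auto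
    ultimately show ?thesis by blast
  qed
  then show ?thesis using B(1) by blast
qed

text \<open>Orthogonality allows any polynomial to be subtracted from the kernel section.\<close>

lemma cell_integral_bound:
  assumes n: "1 \<le> n" and j: "j \<in> {1..n}" and s: "s \<in> {0..1}"
    and orth: "orthogonal_on_cells m n g" and p: "degree p \<le> m"
    and e: "\<And>t. t \<in> {(real j - 1) / real n<..<real j / real n} \<Longrightarrow> cmod (of_real (\<kappa> s t) - poly p (of_real t)) \<le> e"
  shows "cmod (integral (cell n j) (\<lambda>t. of_real (\<kappa> s t) * rep_linf g t)) \<le> e * norm g / real n"
proof -
  let ?f = "\<lambda>t. (of_real (\<kappa> s t) - poly p (of_real t)) * rep_linf g t"
  note sub = cell_subset[OF n j]
  have eb: "ess_bounded ?f"
    by (intro ess_bounded_mult ess_bounded_diff ess_bounded_kernel_section[OF \<kappa> N s] ess_bounded_poly ess_bounded_rep)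
  have "integral (cell n j) ?f = integral (cell n j) (\<lambda>t. of_real (\<kappa> s t) * rep_linf g t)
      - integral (cell n j) (\<lambda>t. rep_linf g t * poly p (of_real t))"
    unfolding left_diff_distrib mult.commute[of "poly p _"]
    by (intro Henstock_Kurzweil_Integration.integral_diff ess_bounded_integrable_on[OF _ sub]
        integrand_ess_bounded[OF s] ess_bounded_mult ess_bounded_rep ess_bounded_poly)
  then have eq: "integral (cell n j) (\<lambda>t. of_real (\<kappa> s t) * rep_linf g t) = integral (cell n j) ?f"
    using orth j p by (simp add: orthogonal_on_cells_def)
  have "AE t in lebesgue_on (cell n j). cmod (?f t) \<le> e * norm g"
    using AE_lebesgue_on_mono[OF rep_linf_le_norm sub, of g] AE_open_interval
  proof eventually_elim
    case (elim t)
    have "0 \<le> e" using e[OF elim(2)] norm_ge_zero order_trans by blast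
    then show ?case unfolding norm_mult by (intro mult_mono e elim) auto
  qed
  from ess_bounded_integral_bound[OF eb sub _ this]
  show ?thesis unfolding eq cell_length by (simp add: divide_right_mono)
qed

lemma kernel_int_cells:
  assumes n: "1 \<le> n" and s: "s \<in> {0..1}"
  shows "kernel_int \<kappa> (rep_linf g) s = (\<Sum>j=1..n. integral (cell n j) (\<lambda>t. of_real (\<kappa> s t) * rep_linf g t))"
  unfolding kernel_int_def
  by (rule integral_uniform_partition[OF ess_bounded_integrable_on[OF integrand_ess_bounded[OF s ess_bounded_rep] order_refl] n])

text \<open>For \<open>r \<ge> 1\<close> a cell that does not contain \<open>s\<close> contributes \<open>O(h\<^sup>3)\<close>, and there are \<open>n = 1 / h\<close> of them;
  at most two cells contain \<open>s\<close>, and each contributes \<open>O(h\<^sup>2)\<close>.\<close>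

lemma integral_op_orthogonal_bound:
  "\<exists>M\<ge>0. \<forall>n\<ge>1. \<forall>g. orthogonal_on_cells (2 * r) n g \<longrightarrow>
     norm (integral_op \<kappa> g) \<le> M * (1 / real n) ^ (if r \<ge> 1 then 2 else 1) * norm g"
proof -
  obtain M1 where M1: "M1 \<ge> 0" "\<And>s x y. s \<in> {0<..<1} \<Longrightarrow> x \<in> {0..1} \<Longrightarrow> y \<in> {0..1} \<Longrightarrow> \<bar>\<kappa> s x - \<kappa> s y\<bar> \<le> M1 * \<bar>x - y\<bar>"
    using kernel_lipschitz[OF \<kappa> N] by blast
  obtain M2 where M2: "M2 \<ge> 0" "\<And>s a b. s \<in> {0<..<1} \<Longrightarrow> 0 \<le> a \<Longrightarrow> a < b \<Longrightarrow> b \<le> 1 \<Longrightarrow> b \<le> s \<or> s \<le> a \<Longrightarrow>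
    (\<exists>p. degree p \<le> 1 \<and> (\<forall>t\<in>{a<..<b}. cmod (of_real (\<kappa> s t) - poly p (of_real t)) \<le> M2 * (b - a)\<^sup>2))"
    using kernel_linear_approximation[OF \<kappa> N] by blast
  have const: "cmod (integral (cell n j) (\<lambda>t. of_real (\<kappa> s t) * rep_linf g t)) \<le> M1 / real n * norm g / real n"
    if n: "1 \<le> n" and j: "j \<in> {1..n}" and s: "s \<in> {0<..<1}" and orth: "orthogonal_on_cells (2 * r) n g"
    for n j s g
  proof (rule cell_integral_bound[OF n j _ orth, where p = "[:of_real (\<kappa> s (real j / real n)):]"])
    fix t assume t: "t \<in> {(real j - 1) / real n<..<real j / real n}"
    have "t \<in> cell n j" "real j / real n \<in> cell n j" using t n by (auto simp: divide_right_mono)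
    then have "t \<in> {0..1}" "real j / real n \<in> {0..1}" using cell_subset[OF n j] by blast+
    from M1(2)[OF s this]
    have "\<bar>\<kappa> s t - \<kappa> s (real j / real n)\<bar> \<le> M1 * \<bar>t - real j / real n\<bar>" .
    also have "\<dots> \<le> M1 * (1 / real n)"
      using t cell_length[of j n] M1(1) by (intro mult_left_mono) auto
    finally have le: "\<bar>\<kappa> s t - \<kappa> s (real j / real n)\<bar> \<le> M1 / real n" by simp
    have "of_real (\<kappa> s t) - poly [:of_real (\<kappa> s (real j / real n)):] (of_real t) =
        complex_of_real (\<kappa> s t - \<kappa> s (real j / real n))"
      by simp
    then show "cmod (of_real (\<kappa> s t) - poly [:of_real (\<kappa> s (real j / real n)):] (of_real t)) \<le> M1 / real n"
      using le by (simp only: norm_of_real)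
  qed (use s in auto)
  have lin: "cmod (integral (cell n j) (\<lambda>t. of_real (\<kappa> s t) * rep_linf g t)) \<le> M2 * (1 / real n)\<^sup>2 * norm g / real n"
    if n: "1 \<le> n" and j: "j \<in> {1..n}" and s: "s \<in> {0<..<1}" and orth: "orthogonal_on_cells (2 * r) n g"
      and r: "r \<ge> 1" and far: "s \<notin> cell n j" for n j s g
  proof -
    have "(real j - 1) / real n < real j / real n" using n by (simp add: divide_strict_right_mono)
    moreover have "real j / real n \<le> s \<or> s \<le> (real j - 1) / real n" using far by auto
    moreover have "0 \<le> (real j - 1) / real n" "real j / real n \<le> 1" using n j by (auto simp: divide_simps)
    ultimately obtain p where p: "degree p \<le> 1"
        "\<And>t. t \<in> {(real j - 1) / real n<..<real j / real n} \<Longrightarrow>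
          cmod (of_real (\<kappa> s t) - poly p (of_real t)) \<le> M2 * (1 / real n)\<^sup>2"
      using M2(2)[OF s, of "(real j - 1) / real n" "real j / real n"] unfolding cell_length by blast
    show ?thesis
      by (rule cell_integral_bound[OF n j _ orth _ p(2)]) (use s p(1) r in auto)
  qed
  define M where "M = 2 * M1 + M2"
  have "norm (integral_op \<kappa> g) \<le> M * (1 / real n) ^ (if r \<ge> 1 then 2 else 1) * norm g"
    if n: "1 \<le> n" and orth: "orthogonal_on_cells (2 * r) n g" for n g
    unfolding norm_linf_le_iff
    using rep_integral_op_kernel_int[of g] AE_open_interval[of 0 1]
  proof eventually_elim
    case (elim s)
    then have s: "s \<in> {0<..<1}" "s \<in> {0..1}" by auto
    let ?I = "\<lambda>j. integral (cell n j) (\<lambda>t. of_real (\<kappa> s t) * rep_linf g t)"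
    have "cmod (rep_linf (integral_op \<kappa> g) s) \<le> (\<Sum>j=1..n. cmod (?I j))"
      unfolding elim(1) kernel_int_cells[OF n s(2)] by (rule norm_sum)
    also have "\<dots> \<le> M * (1 / real n) ^ (if r \<ge> 1 then 2 else 1) * norm g"
    proof (cases "r \<ge> 1")
      case False
      have "(\<Sum>j=1..n. cmod (?I j)) \<le> (\<Sum>j=1..n. M1 / real n * norm g / real n)"
        by (intro sum_mono const n s orth)
      also have "\<dots> = M1 * (1 / real n) * norm g" using n by simp
      also have "\<dots> \<le> M * (1 / real n) * norm g"
        using M1(1) M2(1) by (intro mult_right_mono) (auto simp: M_def)
      finally show ?thesis using False by simp
    next
      case True
      \<comment> \<open>the cells in which the kernel section may have its kink\<close>
      define J where "J = {j \<in> {1..n}. s \<in> cell n j}"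
      have "J \<subseteq> {nat \<lceil>real n * s\<rceil>, nat \<lceil>real n * s\<rceil> + 1}"
      proof
        fix j assume "j \<in> J"
        then have j: "1 \<le> j" "real j - 1 \<le> real n * s" "real n * s \<le> real j"
          using n by (auto simp: J_def field_simps)
        then show "j \<in> {nat \<lceil>real n * s\<rceil>, nat \<lceil>real n * s\<rceil> + 1}" by (auto, linarith)
      qed
      then have "card J \<le> card {nat \<lceil>real n * s\<rceil>, nat \<lceil>real n * s\<rceil> + 1}" by (rule card_mono[rotated]) simp
      then have J2: "card J \<le> 2" by simp
      have "(\<Sum>j=1..n. cmod (?I j)) = (\<Sum>j\<in>J. cmod (?I j)) + (\<Sum>j\<in>{1..n} - J. cmod (?I j))"
        by (rule sum.subset_diff[THEN trans, OF _ _ add.commute]) (auto simp: J_def)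
      also have "(\<Sum>j\<in>J. cmod (?I j)) \<le> (\<Sum>j\<in>J. M1 / real n * norm g / real n)"
        by (intro sum_mono const n s orth) (auto simp: J_def)
      also have "\<dots> = real (card J) * (M1 / real n * norm g / real n)" by simp
      also have "\<dots> \<le> 2 * (M1 / real n * norm g / real n)"
        using J2 M1(1) by (intro mult_right_mono) auto
      also have "(\<Sum>j\<in>{1..n} - J. cmod (?I j)) \<le> (\<Sum>j\<in>{1..n} - J. M2 * (1 / real n)\<^sup>2 * norm g / real n)"
        by (intro sum_mono lin n s orth True) (auto simp: J_def)
      also have "\<dots> \<le> (\<Sum>j\<in>{1..n}. M2 * (1 / real n)\<^sup>2 * norm g / real n)"
        using M2(1) by (intro sum_mono2) auto
      also have "\<dots> = M2 * (1 / real n)\<^sup>2 * norm g" using n by simp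
      also have "2 * (M1 / real n * norm g / real n) + M2 * (1 / real n)\<^sup>2 * norm g = M * (1 / real n)\<^sup>2 * norm g"
        by (simp add: M_def power2_eq_square algebra_simps add_divide_distrib)
      finally show ?thesis using True by simp
    qed
    finally show ?case .
  qed
  then show ?thesis using M1(1) M2(1) by (intro exI[of _ M]) (auto simp: M_def)
qed

end

section \<open>Convergence of the eigenelements\<close>

theorem theorem4p4:
  fixes r :: nat
    and \<kappa> :: "real \<Rightarrow> real \<Rightarrow> real"
    and K :: "linf \<Rightarrow> linf"
    and P :: "nat \<Rightarrow> linf \<Rightarrow> linf"
    and \<Gamma> :: "real \<Rightarrow> complex"
    and lam :: complex
    and E :: "linf \<Rightarrow>\<^sub>L linf"
    and EG :: "nat \<Rightarrow> linf \<Rightarrow>\<^sub>L linf"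
    and lamG :: "nat \<Rightarrow> complex"
    and \<phi> \<phi>S :: "nat \<Rightarrow> linf"
    and h :: "nat \<Rightarrow> real"
  assumes kernel: "greens_kernel r \<kappa>"
    and K: "K = integral_op \<kappa>"
    and P: "\<And>n. P n = galerkin_proj r n"
    and h: "\<And>n. h n = 1 / real n"
    and curve: "simple_closed_rectifiable_pos \<Gamma>"
    and curve_resolvent: "path_image \<Gamma> \<subseteq> resolvent_set K"
    and lam_inside: "lam \<in> inside (path_image \<Gamma>)"
    and rest_outside: "insert 0 (spectrum K) - {lam} \<subseteq> outside (path_image \<Gamma>)"
    and lam_nonzero: "lam \<noteq> 0"
    and lam_eigenvalue: "eigenvalue K lam"
    and E: "E = spectral_projection \<Gamma> K"
    and lam_simple: "cdim (range (blinfun_apply E)) = 1"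
    and EG: "\<And>n. EG n = spectral_projection \<Gamma> (P n \<circ> K)"
    and lamG: "\<forall>\<^sub>F n in sequentially.
      eigenvalue (P n \<circ> K) (lamG n) \<and> lamG n \<in> inside (path_image \<Gamma>)"
    and eigvec: "\<forall>\<^sub>F n in sequentially.
      \<phi> n \<in> range (blinfun_apply (EG n)) \<and> norm (\<phi> n) = 1 \<and>
      (P n \<circ> K) (\<phi> n) = lamG n *\<^sub>C \<phi> n"
    and iterated: "\<And>n. \<phi>S n = (1 / lamG n) *\<^sub>C K (\<phi> n)"
  shows "(\<lambda>n. norm (\<phi> n - blinfun_apply E (\<phi> n)))
           \<in> O(\<lambda>n. if r \<ge> 1 then h n ^ (2 * r + 1) else h n)
       \<and> (\<lambda>n. norm (\<phi>S n - blinfun_apply E (\<phi>S n)))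
           \<in> O(\<lambda>n. if r \<ge> 1 then h n ^ (2 * r + 3) else h n ^ 2)
       \<and> (\<lambda>n. cmod (lam - lamG n))
           \<in> O(\<lambda>n. if r \<ge> 1 then h n ^ (2 * r + 3) else h n ^ 2)"
proof -
  obtain D1 D2 where split: "split_kernel (2 * r + 2) \<kappa> D1 D2" by (rule greens_kernel_split[OF kernel])
  have N2: "2 \<le> 2 * r + 2" by simp
  have lin: "complex_linear K" unfolding K by (rule integral_op_complex_linear[OF split N2])
  note linK = complex_linearD[OF lin]
  obtain C1 where C1: "C1 \<ge> 0" "\<And>z d x. z \<in> inside (path_image \<Gamma>) \<Longrightarrow> d > 0 \<Longrightarrow>
      (\<And>w. w \<in> path_image \<Gamma> \<Longrightarrow> d \<le> cmod (w - z)) \<Longrightarrow> norm (x - E x) \<le> C1 / d * norm (K x - z *\<^sub>C x)"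
    unfolding E using spectral_projection_estimate[OF lin curve curve_resolvent] by blast
  have EK: "E (K x) = K (E x)" for x
    unfolding E by (rule spectral_projection_commute[OF lin curve curve_resolvent])
  obtain MR where MR: "MR > 0" "\<And>w. w \<in> path_image \<Gamma> \<Longrightarrow> norm (resolvent K w) \<le> MR"
    using resolvent_bounded_on_curve[OF lin curve curve_resolvent] by blast
  have res_bound: "norm x \<le> MR * norm (K x - w *\<^sub>C x)" if w: "w \<in> path_image \<Gamma>" for w x
  proof -
    have "w \<in> resolvent_set K" using curve_resolvent w by blast
    from resolvent_bound[OF lin this, of x]
    show ?thesis by (rule order_trans) (intro mult_right_mono MR w norm_ge_zero)
  qed
  obtain v where v: "v \<noteq> 0" "K v = lam *\<^sub>C v" using lam_eigenvalue by (auto simp: eigenvalue_def)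
  have closed: "closed (path_image \<Gamma>)"
    using curve by (intro closed_path_image) (simp add: simple_closed_rectifiable_pos_def rectifiable_path_def)
  \<comment> \<open>the estimate for approximate eigenvectors, applied to an exact one\<close>
  have Ev: "E v = v"
  proof -
    have "lam \<notin> path_image \<Gamma>" using lam_inside by (auto simp: inside_def)
    from separate_point_closed[OF closed this]
    obtain d where d: "d > 0" "\<And>w. w \<in> path_image \<Gamma> \<Longrightarrow> d \<le> dist lam w" by blast
    have "norm (v - E v) \<le> C1 / d * norm (K v - lam *\<^sub>C v)"
      by (rule C1(2)[OF lam_inside d(1)]) (use d(2) in \<open>auto simp: dist_norm norm_minus_commute\<close>)
    then show ?thesis by (simp add: v(2))
  qed
  \<comment> \<open>simplicity of the eigenvalue enters here\<close>
  have range_v: "\<exists>c. E x = c *\<^sub>C v" for x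
  proof -
    obtain B where B: "B \<subseteq> range (blinfun_apply E)" "range (blinfun_apply E) \<subseteq> complex_vector.span B" "card B = 1"
      using complex_vector.basis_exists[of "range (blinfun_apply E)"] lam_simple by metis
    obtain b where b: "B = {b}" using B(3) by (auto simp: card_1_singleton_iff)
    have span: "\<exists>c. E y = c *\<^sub>C b" for y
      using B(2) unfolding b complex_vector.span_singleton by blast
    obtain c where c: "v = c *\<^sub>C b" using span[of v] Ev by auto
    obtain d where d: "E x = d *\<^sub>C b" using span[of x] by auto
    have "c \<noteq> 0" using c v(1) by auto
    then have "E x = (d / c) *\<^sub>C v" unfolding c d by (simp add: scaleC_scaleC)
    then show ?thesis by blast
  qed
  have KE: "K (E x) = lam *\<^sub>C E x" for x
  proof -
    obtain c where "E x = c *\<^sub>C v" using range_v by blast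
    then show ?thesis by (simp add: linK v(2) scaleC_scaleC mult.commute)
  qed
  have norm_E: "norm (E x) \<le> norm E * norm x" for x by (rule norm_blinfun)
  obtain KB where KB: "KB > 0" "\<And>x. norm (K x) \<le> KB * norm x"
    using bounded_linear.pos_bounded[OF linK(1)] by (auto simp: mult.commute)
  obtain CP where CP0: "CP \<ge> 0" and CP:
    "\<forall>n\<ge>1. \<forall>x. (\<forall>j\<in>{1..n}. \<forall>p. degree p \<le> 2 * r \<longrightarrow>
        integral (cell n j) (\<lambda>t. rep_linf (x - galerkin_proj r n x) t * poly p (of_real t)) = 0) \<and>
     (\<forall>c\<ge>0. (\<forall>j\<in>{1..n}. \<exists>p. degree p \<le> 2 * r \<and>
          (AE t in lebesgue_on (cell n j). cmod (rep_linf x t - poly p (of_real t)) \<le> c)) \<longrightarrow>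
        norm (x - galerkin_proj r n x) \<le> CP * c)"
    using galerkin_error[of r] by blast
  from integral_op_constant_approximation[OF split N2, of r, folded K]
  obtain M where M0: "M \<ge> 0" and M: "\<forall>n\<ge>1. \<forall>x. \<forall>j\<in>{1..n}. \<exists>p. degree p \<le> 2 * r \<and>
     (AE t in lebesgue_on (cell n j). cmod (rep_linf (K x) t - poly p (of_real t)) \<le> M * norm x / real n)"
    by (elim exE conjE) (rule that)
  obtain B where B0: "B \<ge> 0" and B: "\<forall>n\<ge>1. \<forall>j\<in>{1..n}. \<exists>p. degree p \<le> 2 * r \<and>
     (AE t in lebesgue_on (cell n j). cmod (rep_linf v t - poly p (of_real t)) \<le> B * (1 / real n) ^ Suc (2 * r))"
    using eigenvector_approximation[OF split N2 v(2)[unfolded K] lam_nonzero, of "2 * r"] by auto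
  define q where "q = (if r \<ge> 1 then 2 else 1 :: nat)"
  from integral_op_orthogonal_bound[OF split N2, of r, folded K q_def]
  obtain M4 where M40: "M4 \<ge> 0" and M4: "\<forall>n\<ge>1. \<forall>g. orthogonal_on_cells (2 * r) n g \<longrightarrow>
     norm (K g) \<le> M4 * (1 / real n) ^ q * norm g"
    by (elim exE conjE) (rule that)
  define g where "g n = K (\<phi> n) - galerkin_proj r n (K (\<phi> n))" for n
  have orth: "orthogonal_on_cells (2 * r) n (g n)" if "1 \<le> n" for n
    unfolding orthogonal_on_cells_def g_def
    by (rule CP[THEN spec, THEN mp, OF that, THEN spec, THEN conjunct1])
  define c0 where "c0 = cmod lam * norm E / norm v"
  have c00: "c0 \<ge> 0" by (simp add: c0_def)
  \<comment> \<open>a first bound of order \<open>h\<close>, enough to keep \<open>lamG n\<close> away from \<open>\<Gamma>\<close>\<close>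
  have crude: "norm (g n) \<le> CP * (M / real n)" if n: "1 \<le> n" "norm (\<phi> n) = 1" for n
  proof -
    have "\<forall>j\<in>{1..n}. \<exists>p. degree p \<le> 2 * r \<and>
        (AE t in lebesgue_on (cell n j). cmod (rep_linf (K (\<phi> n)) t - poly p (of_real t)) \<le> M / real n)"
      using M[rule_format, OF n(1), of _ "\<phi> n"] n(2) by simp
    moreover have "M / real n \<ge> 0" using M0 by simp
    ultimately show ?thesis unfolding g_def using CP n(1) by blast
  qed
  \<comment> \<open>split \<open>K (\<phi> n)\<close> into the smooth part \<open>K (E (\<phi> n))\<close>, a bounded multiple of \<open>v\<close>, and a small rest\<close>
  have fine: "norm (g n) \<le> CP * (c0 * B * (1 / real n) ^ Suc (2 * r) + M * norm (\<phi> n - E (\<phi> n)) / real n)"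
    if n: "1 \<le> n" "norm (\<phi> n) = 1" for n
  proof -
    obtain c where c: "E (\<phi> n) = c *\<^sub>C v" using range_v by blast
    have "cmod c * norm v \<le> norm E" using norm_E[of "\<phi> n"] by (simp add: c norm_scaleC n(2))
    then have "cmod c \<le> norm E / norm v" using v(1) by (simp add: pos_le_divide_eq)
    then have c_le: "cmod (lam * c) \<le> c0"
      unfolding c0_def norm_mult times_divide_eq_right[symmetric] by (rule mult_left_mono) simp
    define y where "y = \<phi> n - E (\<phi> n)"
    have "K (E (\<phi> n)) = (lam * c) *\<^sub>C v" unfolding KE by (simp add: c scaleC_scaleC)
    then have Ksum: "K (\<phi> n) = (lam * c) *\<^sub>C v + K y"
      unfolding y_def linK(3) by simp
    have "\<exists>p. degree p \<le> 2 * r \<and> (AE t in lebesgue_on (cell n j).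
        cmod (rep_linf (K (\<phi> n)) t - poly p (of_real t)) \<le> c0 * B * (1 / real n) ^ Suc (2 * r) + M * norm y / real n)"
      if j: "j \<in> {1..n}" for j
    proof -
      obtain p1 where p1: "degree p1 \<le> 2 * r"
          "AE t in lebesgue_on (cell n j). cmod (rep_linf v t - poly p1 (of_real t)) \<le> B * (1 / real n) ^ Suc (2 * r)"
        using B[rule_format, OF n(1) j] by blast
      obtain p2 where p2: "degree p2 \<le> 2 * r"
          "AE t in lebesgue_on (cell n j). cmod (rep_linf (K y) t - poly p2 (of_real t)) \<le> M * norm y / real n"
        using M[rule_format, OF n(1) j] by blast
      note sub = cell_subset[OF n(1) j]
      have "AE t in lebesgue_on (cell n j). cmod (rep_linf (K (\<phi> n)) t - poly (smult (lam * c) p1 + p2) (of_real t))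
          \<le> c0 * B * (1 / real n) ^ Suc (2 * r) + M * norm y / real n"
        using p1(2) p2(2) AE_lebesgue_on_mono[OF rep_linf_scaleC[of "lam * c" v] sub]
          AE_lebesgue_on_mono[OF rep_linf_add[of "(lam * c) *\<^sub>C v" "K y"] sub]
      proof eventually_elim
        case (elim t)
        have eq: "rep_linf (K (\<phi> n)) t - poly (smult (lam * c) p1 + p2) (of_real t) =
            (lam * c) * (rep_linf v t - poly p1 (of_real t)) + (rep_linf (K y) t - poly p2 (of_real t))"
          unfolding Ksum elim(3,4) by (simp add: right_diff_distrib)
        have "cmod ((lam * c) * (rep_linf v t - poly p1 (of_real t))) \<le> c0 * (B * (1 / real n) ^ Suc (2 * r))"
          unfolding norm_mult[of "lam * c"] by (rule mult_mono[OF c_le elim(1) c00 norm_ge_zero])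
        then show ?case
          unfolding eq using elim(2) by (intro norm_triangle_le) (simp add: mult.assoc)
      qed
      moreover have "degree (smult (lam * c) p1 + p2) \<le> 2 * r"
        using p1(1) p2(1) by (intro degree_add_le) (auto intro: order_trans[OF degree_smult_le])
      ultimately show ?thesis by blast
    qed
    moreover have "c0 * B * (1 / real n) ^ Suc (2 * r) + M * norm y / real n \<ge> 0"
      using c00 B0 M0 by simp
    ultimately show ?thesis unfolding g_def y_def using CP n(1) by blast
  qed
  have small: "\<forall>\<^sub>F n in sequentially. a * (1 / real n) \<le> b" if "b > 0" for a b :: real
    using order_tendstoD(2)[OF lim_const_over_n[of a] that]
    by eventually_elim simp
  have scaleE: "E (c *\<^sub>C x) = c *\<^sub>C E x" for c x
    unfolding E by (rule spectral_projection_scaleC[OF lin curve curve_resolvent])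
  \<comment> \<open>a lower bound for the distance between \<open>lamG n\<close> and \<open>\<Gamma>\<close>: if \<open>w \<in> \<Gamma>\<close> were closer, the unit vector \<open>\<phi> n\<close> would violate the resolvent bound at \<open>w\<close>\<close>
  define d where "d = 1 / (2 * MR)"
  have d: "d > 0" using MR(1) by (simp add: d_def)
  define C2 where "C2 = C1 / d"
  have C20: "C2 \<ge> 0" using C1(1) d by (simp add: C2_def)
  define C3 where "C3 = 2 * (CP * (c0 * B))"
  have C30: "C3 \<ge> 0" using CP0 c00 B0 by (simp add: C3_def)
  define C5 where "C5 = 2 * norm E / cmod lam * (M4 * C3)"
  have C50: "C5 \<ge> 0" using M40 C30 by (simp add: C5_def)
  define C6 where "C6 = C2 * (2 / cmod lam) * (M4 * C3)"
  have s1: "\<forall>\<^sub>F n in sequentially. CP * M * (1 / real n) \<le> d" by (rule small[OF d])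
  have s2: "\<forall>\<^sub>F n in sequentially. CP * M * C2 * (1 / real n) \<le> 1 / 2" by (rule small) simp
  have s3: "\<forall>\<^sub>F n in sequentially. C2 * C3 * (1 / real n) \<le> 1 / 2" by (rule small) simp
  have s4: "\<forall>\<^sub>F n in sequentially. C5 * (1 / real n) \<le> cmod lam / 2"
    by (rule small) (use lam_nonzero in simp)
  have main: "\<forall>\<^sub>F n in sequentially.
      norm (\<phi> n - E (\<phi> n)) \<le> C2 * C3 * (1 / real n) ^ (2 * r + 1) \<and>
      norm (\<phi>S n - E (\<phi>S n)) \<le> C6 * (1 / real n) ^ (2 * r + 1 + q) \<and>
      cmod (lam - lamG n) \<le> C5 * (1 / real n) ^ (2 * r + 1 + q)"
    using lamG eigvec eventually_ge_at_top[of 1] s1 s2 s3 s4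
  proof eventually_elim
    case (elim n)
    note n = \<open>1 \<le> n\<close>
    define \<eta> where "\<eta> = 1 / real n"
    have \<eta>: "0 < \<eta>" "\<eta> \<le> 1" using n by (simp_all add: \<eta>_def)
    have sm: "CP * M * \<eta> \<le> d" "CP * M * C2 * \<eta> \<le> 1/2" "C2 * C3 * \<eta> \<le> 1/2" "C5 * \<eta> \<le> cmod lam / 2"
      using elim lam_nonzero by (simp_all add: \<eta>_def)
    have \<phi>: "norm (\<phi> n) = 1" and ev: "galerkin_proj r n (K (\<phi> n)) = lamG n *\<^sub>C \<phi> n"
      and inside: "lamG n \<in> inside (path_image \<Gamma>)"
      using elim by (simp_all add: P)
    have g: "g n = K (\<phi> n) - lamG n *\<^sub>C \<phi> n" by (simp add: g_def ev)
    have far: "d \<le> cmod (w - lamG n)" if w: "w \<in> path_image \<Gamma>" for w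
    proof -
      have "K (\<phi> n) - w *\<^sub>C \<phi> n = g n - (w - lamG n) *\<^sub>C \<phi> n"
        by (simp add: g complex_vector.scale_left_diff_distrib)
      then have "norm (K (\<phi> n) - w *\<^sub>C \<phi> n) \<le> norm (g n) + cmod (w - lamG n)"
        using norm_triangle_ineq4[of "g n" "(w - lamG n) *\<^sub>C \<phi> n"] by (simp add: norm_scaleC \<phi>)
      also have "norm (g n) \<le> d" using crude[OF n \<phi>] sm(1) by (simp add: \<eta>_def)
      finally have "MR * norm (K (\<phi> n) - w *\<^sub>C \<phi> n) \<le> MR * (d + cmod (w - lamG n))"
        using MR(1) by simp
      then have "1 \<le> MR * (d + cmod (w - lamG n))"
        using res_bound[OF w, of "\<phi> n"] by (simp add: \<phi>)
      then have "2 * d \<le> d + cmod (w - lamG n)"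
        using MR(1) by (simp add: d_def field_simps)
      then show ?thesis by simp
    qed
    have est: "norm (x - E x) \<le> C2 * norm (K x - lamG n *\<^sub>C x)" for x
      unfolding C2_def by (rule C1(2)[OF inside d far])
    have e_le: "norm (\<phi> n - E (\<phi> n)) \<le> C2 * norm (g n)" using est[of "\<phi> n"] by (simp add: g)
    \<comment> \<open>for small \<open>\<eta>\<close> the rest is at most half of \<open>g n\<close> and is absorbed\<close>
    have g_le: "norm (g n) \<le> C3 * \<eta> ^ (2 * r + 1)"
    proof -
      have "norm (g n) \<le> CP * (c0 * B * \<eta> ^ (2 * r + 1) + M * norm (\<phi> n - E (\<phi> n)) * \<eta>)"
        using fine[OF n \<phi>] by (simp add: \<eta>_def)
      also have "\<dots> \<le> CP * (c0 * B * \<eta> ^ (2 * r + 1) + M * (C2 * norm (g n)) * \<eta>)"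
        using e_le CP0 M0 \<eta> by (intro mult_left_mono add_left_mono mult_right_mono) auto
      also have "\<dots> = CP * (c0 * B) * \<eta> ^ (2 * r + 1) + (CP * M * C2 * \<eta>) * norm (g n)"
        by (simp only: distrib_left mult_ac)
      also have "\<dots> \<le> CP * (c0 * B) * \<eta> ^ (2 * r + 1) + (1/2) * norm (g n)"
        by (intro add_left_mono mult_right_mono sm) simp
      finally show ?thesis by (simp add: C3_def)
    qed
    have first: "norm (\<phi> n - E (\<phi> n)) \<le> C2 * C3 * \<eta> ^ (2 * r + 1)"
      using e_le mult_left_mono[OF g_le C20] by (simp add: mult.assoc)
    have Kg: "norm (K (g n)) \<le> M4 * C3 * \<eta> ^ (2 * r + 1 + q)"
    proof -
      have "norm (K (g n)) \<le> M4 * \<eta> ^ q * norm (g n)"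
        using M4[rule_format, OF n orth[OF n]] by (simp add: \<eta>_def)
      also have "\<dots> \<le> M4 * \<eta> ^ q * (C3 * \<eta> ^ (2 * r + 1))"
        using M40 \<eta> by (intro mult_left_mono[OF g_le]) simp
      also have "\<dots> = M4 * C3 * \<eta> ^ (2 * r + 1 + q)" by (simp only: power_add mult_ac)
      finally show ?thesis .
    qed
    have pow: "\<eta> ^ Suc k \<le> \<eta>" for k
      using \<eta> power_decreasing[of 1 "Suc k" \<eta>] by simp
    have half: "1/2 \<le> norm (E (\<phi> n))"
    proof -
      have "norm (\<phi> n - E (\<phi> n)) \<le> C2 * C3 * \<eta>"
        using first mult_left_mono[OF pow[of "2 * r"], of "C2 * C3"] C20 C30 by simp
      then have "norm (\<phi> n - E (\<phi> n)) \<le> 1/2" using sm(3) by linarith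
      then show ?thesis using norm_triangle_sub[of "\<phi> n" "E (\<phi> n)"] \<phi> by linarith
    qed
    have eig: "cmod (lam - lamG n) \<le> C5 * \<eta> ^ (2 * r + 1 + q)"
    proof -
      have "E (g n) = (lam - lamG n) *\<^sub>C E (\<phi> n)"
        by (simp add: g blinfun.diff_right EK KE scaleE complex_vector.scale_left_diff_distrib)
      then have "E (K (g n)) = (lam * (lam - lamG n)) *\<^sub>C E (\<phi> n)"
        by (simp add: EK KE linK(5) scaleC_scaleC mult.commute)
      then have "cmod lam * (cmod (lam - lamG n) * norm (E (\<phi> n))) \<le> norm E * norm (K (g n))"
        using norm_E[of "K (g n)"] by (simp add: norm_scaleC norm_mult mult.assoc)
      moreover have "cmod lam * (cmod (lam - lamG n) * (1/2)) \<le> cmod lam * (cmod (lam - lamG n) * norm (E (\<phi> n)))"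
        by (intro mult_left_mono half) auto
      moreover have "norm E * norm (K (g n)) \<le> norm E * (M4 * C3 * \<eta> ^ (2 * r + 1 + q))"
        by (intro mult_left_mono Kg) auto
      ultimately have "cmod (lam - lamG n) * cmod lam \<le> 2 * norm E * (M4 * C3 * \<eta> ^ (2 * r + 1 + q))"
        by (simp add: mult_ac)
      then have "cmod (lam - lamG n) \<le> 2 * norm E * (M4 * C3 * \<eta> ^ (2 * r + 1 + q)) / cmod lam"
        using lam_nonzero by (simp add: pos_le_divide_eq)
      then show ?thesis by (simp add: C5_def mult_ac)
    qed
    have lamG_low: "cmod lam / 2 \<le> cmod (lamG n)"
    proof -
      have "cmod (lam - lamG n) \<le> C5 * \<eta>"
        using eig mult_left_mono[OF pow[of "2 * r + q"], of C5] C50 by simp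
      then show ?thesis using sm(4) norm_triangle_ineq2[of lam "lamG n"] by linarith
    qed
    have second: "norm (\<phi>S n - E (\<phi>S n)) \<le> C6 * \<eta> ^ (2 * r + 1 + q)"
    proof -
      have "K (\<phi>S n) - lamG n *\<^sub>C \<phi>S n = (1 / lamG n) *\<^sub>C K (g n)"
        unfolding iterated g by (simp add: linK scaleC_diff_right scaleC_scaleC mult.commute)
      then have "norm (\<phi>S n - E (\<phi>S n)) \<le> C2 * (1 / cmod (lamG n) * norm (K (g n)))"
        using est[of "\<phi>S n"] by (simp add: norm_scaleC norm_divide)
      also have "\<dots> \<le> C2 * (2 / cmod lam * (M4 * C3 * \<eta> ^ (2 * r + 1 + q)))"
      proof (intro mult_left_mono mult_mono Kg C20)
        show "1 / cmod (lamG n) \<le> 2 / cmod lam"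
          using lamG_low lam_nonzero frac_le[of 1 1 "cmod lam / 2" "cmod (lamG n)"] by simp
      qed auto
      finally show ?thesis by (simp only: C6_def mult.assoc)
    qed
    show ?case using first second eig unfolding \<eta>_def by blast
  qed
  have main1: "\<forall>\<^sub>F n in sequentially. norm (\<phi> n - E (\<phi> n)) \<le> C2 * C3 * (1 / real n) ^ (2 * r + 1)"
    using main by (rule eventually_mono) (elim conjE)
  have main2: "\<forall>\<^sub>F n in sequentially. norm (\<phi>S n - E (\<phi>S n)) \<le> C6 * (1 / real n) ^ (2 * r + 1 + q)"
    using main by (rule eventually_mono) (elim conjE)
  have main3: "\<forall>\<^sub>F n in sequentially. cmod (lam - lamG n) \<le> C5 * (1 / real n) ^ (2 * r + 1 + q)"
    using main by (rule eventually_mono) (elim conjE)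
  have bigo: "f \<in> O(\<lambda>n. if r \<ge> 1 then h n ^ a else h n ^ b)"
    if le: "\<forall>\<^sub>F n in sequentially. f n \<le> C * (1 / real n) ^ k" and nn: "\<And>n. 0 \<le> f n"
      and k: "k = (if r \<ge> 1 then a else b)" for f :: "nat \<Rightarrow> real" and C a b k
  proof (rule bigoI)
    show "\<forall>\<^sub>F n in sequentially. norm (f n) \<le> C * norm (if r \<ge> 1 then h n ^ a else h n ^ b)"
      using le
    proof eventually_elim
      case (elim n)
      then show ?case using nn[of n] by (cases "r \<ge> 1") (simp_all add: k h)
    qed
  qed
  show ?thesis
  proof (intro conjI)
    show "(\<lambda>n. norm (\<phi> n - E (\<phi> n))) \<in> O(\<lambda>n. if r \<ge> 1 then h n ^ (2 * r + 1) else h n)"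
      using bigo[OF main1, of "2 * r + 1" 1] by (simp only: power_one_right) simp
    show "(\<lambda>n. norm (\<phi>S n - E (\<phi>S n))) \<in> O(\<lambda>n. if r \<ge> 1 then h n ^ (2 * r + 3) else h n ^ 2)"
      by (rule bigo[OF main2]) (simp_all add: q_def)
    show "(\<lambda>n. cmod (lam - lamG n)) \<in> O(\<lambda>n. if r \<ge> 1 then h n ^ (2 * r + 3) else h n ^ 2)"
      by (rule bigo[OF main3]) (simp_all add: q_def)
  qed
qed

end
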